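(* Let $\alpha\in(0,1)$ and let $f:\mathbb{T}^d\to\mathbb{T}^d$ be a $C^{1+\alpha}$ irreducible non-invertible Anosov map with one-dimensional stable bundle. If $f$ is topologically conjugate to its linearization $f_*:\mathbb{T}^d\to\mathbb{T}^d$ by a homeomorphism $h$ of $\mathbb{T}^d$ with $h\circ f=f_*\circ h$, then $h$ is $C^{1+\alpha}$-smooth along the stable foliation of $f$.
   Context: $\mathbb{T}^d=\mathbb{R}^d/\mathbb{Z}^d$. A $C^1$ local diffeomorphism $f:\mathbb{T}^d\to\mathbb{T}^d$ is an Anosov map if there is a $Df$-invariant continuous subbundle $E^s\subset T\mathbb{T}^d$ (the stable bundle) that is uniformly $Df$-contracting and such that $T\mathbb{T}^d/E^s$ is uniformly $Df$-expanding. The stable foliation is the $f$-invariant foliation tangent to $E^s$. The linearization of $f$ is the linear toral map $f_*:\pi_1(\mathbb{T}^d)\to\pi_1(\mathbb{T}^d)$, an integer matrix in $GL_d(\mathbb{R})\cap M_d(\mathbb{Z})$ acting on $\mathbb{T}^d$ and homotopic to $f$. $f$ is irreducible if the characteristic polynomial of $f_*$ is irreducible over $\mathbb{Q}$; non-invertible means not a bijection. A map is $C^{1+\alpha}$-smooth along a foliation if its restriction to each leaf is $C^{1+\alpha}$. *)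

theory Defs
  imports "HOL-Analysis.Analysis" "HOL-Computational_Algebra.Polynomial"
begin

section \<open>The torus\<close>

definition int_vec :: "int ^ 'n \<Rightarrow> real ^ 'n"
  where "int_vec n = (\<chi> i. real_of_int (n $ i))"

quotient_type 'n torus = "real ^ 'n" / "\<lambda>x y. \<exists>n. x - y = int_vec n"
  morphisms rep_torus proj
proof (rule equivpI)
  show "reflp (\<lambda>x y :: real ^ 'n. \<exists>n. x - y = int_vec n)"
    by (rule reflpI, rule exI[of _ 0]) (simp add: int_vec_def vec_eq_iff)
  show "symp (\<lambda>x y :: real ^ 'n. \<exists>n. x - y = int_vec n)"
  proof (rule sympI)
    fix x y :: "real ^ 'n" assume "\<exists>n. x - y = int_vec n"
    then obtain n where "x - y = int_vec n" ..
    then have "y - x = int_vec (- n)" by (simp add: int_vec_def vec_eq_iff algebra_simps)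
    then show "\<exists>n. y - x = int_vec n" ..
  qed
  show "transp (\<lambda>x y :: real ^ 'n. \<exists>n. x - y = int_vec n)"
  proof (rule transpI)
    fix x y z :: "real ^ 'n"
    assume "\<exists>n. x - y = int_vec n" "\<exists>n. y - z = int_vec n"
    then obtain m n where "x - y = int_vec m" "y - z = int_vec n" by blast
    then have "x - z = int_vec (m + n)" by (simp add: int_vec_def vec_eq_iff algebra_simps)
    then show "\<exists>n. x - z = int_vec n" ..
  qed
qed

instantiation torus :: (finite) topological_space
begin

definition open_torus :: "'a torus set \<Rightarrow> bool"
  where "open_torus U \<longleftrightarrow> open (proj -` U)"

instance
proof
  show "open (UNIV :: 'a torus set)" by (simp add: open_torus_def)
next
  fix S T :: "'a torus set" assume "open S" "open T"
  then show "open (S \<inter> T)" by (simp add: open_torus_def vimage_Int open_Int)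
next
  fix K :: "'a torus set set" assume "\<forall>S\<in>K. open S"
  then show "open (\<Union>K)" by (simp add: open_torus_def vimage_Union open_UN)
qed

end

text \<open>The toral map induced by an integer matrix.\<close>

lift_definition toral_map :: "int ^ 'n ^ 'n \<Rightarrow> 'n::finite torus \<Rightarrow> 'n torus"
  is "\<lambda>A x. map_matrix real_of_int A *v x"
proof -
  fix A :: "int ^ 'n ^ 'n" and x y :: "real ^ 'n"
  assume "\<exists>n. x - y = int_vec n"
  then obtain n where "x - y = int_vec n" ..
  then have "map_matrix real_of_int A *v x - map_matrix real_of_int A *v y = int_vec (A *v n)"
    by (simp flip: matrix_vector_mult_diff_distrib)
       (simp add: int_vec_def matrix_vector_mult_def vec_eq_iff)
  then show "\<exists>n. map_matrix real_of_int A *v x - map_matrix real_of_int A *v y = int_vec n" ..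
qed


section \<open>Differentiability on the torus\<close>

text \<open>The tangent bundle is trivialised by \<^const>\<open>proj\<close>; smoothness is expressed through local
  lifts. A local lift that is differentiable at \<open>x\<close> is continuous there, so two such lifts of the
  same map differ near the base point by a constant integer vector (up to a deck translation), and
  the derivative does not depend on the lift.\<close>

definition has_torus_derivative ::
    "('n::finite torus \<Rightarrow> 'n torus) \<Rightarrow> ((real ^ 'n) \<Rightarrow>\<^sub>L (real ^ 'n)) \<Rightarrow> 'n torus \<Rightarrow> bool"
  where "has_torus_derivative f D p \<longleftrightarrow>
    (\<exists>x F. proj x = p \<and> (\<forall>\<^sub>F y in nhds x. proj (F y) = f (proj y)) \<and>
           (F has_derivative blinfun_apply D) (at x))"

lemma has_torus_derivative_unique:
  assumes "has_torus_derivative f D p" "has_torus_derivative f D' p"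
  shows "D = D'"
proof -
  obtain x F where x: "proj x = p" and F: "\<forall>\<^sub>F z in nhds x. proj (F z) = f (proj z)"
    and dF: "(F has_derivative blinfun_apply D) (at x)"
    using assms(1) unfolding has_torus_derivative_def by blast
  obtain y G where y: "proj y = p" and G: "\<forall>\<^sub>F z in nhds y. proj (G z) = f (proj z)"
    and dG: "(G has_derivative blinfun_apply D') (at y)"
    using assms(2) unfolding has_torus_derivative_def by blast
  obtain n where n: "x - y = int_vec n"
    using x y by (metis torus.abs_eq_iff)
  define H where "H z = F z - G (z - int_vec n)" for z
  have shift: "proj (z - int_vec n) = proj z" for z :: "real ^ 'a"
    by (subst torus.abs_eq_iff) (rule exI[of _ "- n"], simp add: int_vec_def vec_eq_iff)
  have y': "y = x - int_vec n" using n by (simp add: algebra_simps)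
  have "((\<lambda>z. G (z - int_vec n)) has_derivative blinfun_apply D') (at x)"
  proof (rule has_derivative_compose[of "\<lambda>z. z - int_vec n" "\<lambda>z. z", simplified])
    show "((\<lambda>z. z - int_vec n) has_derivative (\<lambda>z. z)) (at x)"
      by (auto intro!: derivative_eq_intros)
    show "(G has_derivative blinfun_apply D') (at (x - int_vec n))"
      using dG y' by simp
  qed
  with dF have dH: "(H has_derivative (\<lambda>v. D v - D' v)) (at x)"
    unfolding H_def by (rule has_derivative_diff)
  have cont: "((\<lambda>z. z - int_vec n) \<longlongrightarrow> y) (nhds x)"
    unfolding y' by (intro tendsto_intros filterlim_ident)
  have G': "\<forall>\<^sub>F z in nhds x. proj (G (z - int_vec n)) = f (proj z)"
    using eventually_compose_filterlim[OF G cont] by (simp add: shift)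
  have int: "\<forall>\<^sub>F z in nhds x. \<exists>m. H z = int_vec m"
    using F G' by eventually_elim (metis H_def torus.abs_eq_iff)
  have "isCont H x" using dH has_derivative_continuous by blast
  then have near: "\<forall>\<^sub>F z in nhds x. dist (H z) (H x) < 1"
    by (simp add: continuous_at tendsto_nhds_iff tendstoD flip: tendsto_at_iff_tendsto_nhds)
  obtain k where k: "H x = int_vec k"
    using eventually_nhds_x_imp_x[OF int] by blast
  from near int have const: "\<forall>\<^sub>F z in nhds x. H z = H x"
  proof eventually_elim
    case (elim z)
    then obtain m where m: "H z = int_vec m" by blast
    have "m $ i = k $ i" for i
    proof -
      have "\<bar>(H z - H x) $ i\<bar> < 1"
        using elim component_le_norm_cart[of "H z - H x" i] by (simp add: dist_norm)
      then show ?thesis unfolding m k by (simp add: int_vec_def)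
    qed
    then show ?case by (simp add: m k int_vec_def vec_eq_iff)
  qed
  have "(H has_derivative (\<lambda>v. 0)) (at x)"
  proof (rule has_derivative_transform_eventually[OF has_derivative_const[of "H x"]])
    show "\<forall>\<^sub>F z in at x. H x = H z"
      using const by (auto simp: eventually_at_filter elim: eventually_mono)
  qed simp_all
  then have "(\<lambda>v. D v - D' v) = (\<lambda>v. 0)" using dH by (rule has_derivative_unique[rotated])
  then show ?thesis by (intro blinfun_eqI) (metis eq_iff_diff_eq_0)
qed

definition torus_deriv ::
    "('n::finite torus \<Rightarrow> 'n torus) \<Rightarrow> 'n torus \<Rightarrow> ((real ^ 'n) \<Rightarrow>\<^sub>L (real ^ 'n))"
  where "torus_deriv f p = (THE D. has_torus_derivative f D p)"

definition torus_C1_on :: "'n::finite torus set \<Rightarrow> ('n torus \<Rightarrow> 'n torus) \<Rightarrow> bool"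
  where "torus_C1_on U f \<longleftrightarrow>
    (\<forall>p\<in>U. \<exists>D. has_torus_derivative f D p) \<and> continuous_on U (torus_deriv f)"

text \<open>Taking the infimum over representatives \<open>x\<close>, \<open>y\<close>, the estimate below is the Hoelder condition
  for the flat distance on the torus.\<close>

definition torus_C1_Hoelder :: "real \<Rightarrow> ('n::finite torus \<Rightarrow> 'n torus) \<Rightarrow> bool"
  where "torus_C1_Hoelder \<alpha> f \<longleftrightarrow> torus_C1_on UNIV f \<and>
    (\<exists>K. \<forall>x y. norm (torus_deriv f (proj x) - torus_deriv f (proj y)) \<le> K * dist x y powr \<alpha>)"

definition C1_local_diffeo :: "('n::finite torus \<Rightarrow> 'n torus) \<Rightarrow> bool"
  where "C1_local_diffeo f \<longleftrightarrow> torus_C1_on UNIV f \<and>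
    (\<forall>p. \<exists>U g. open U \<and> p \<in> U \<and> open (f ` U) \<and>
       homeomorphism U (f ` U) f g \<and> torus_C1_on (f ` U) g)"


section \<open>Anosov maps\<close>

definition continuous_subbundle :: "('n::finite torus \<Rightarrow> (real ^ 'n) set) \<Rightarrow> bool"
  where "continuous_subbundle E \<longleftrightarrow>
    (\<exists>k. \<forall>p. \<exists>U e. open U \<and> p \<in> U \<and> (\<forall>i<k. continuous_on U (e i)) \<and>
       (\<forall>q\<in>U. inj_on (\<lambda>i::nat. e i q) {..<k} \<and> independent ((\<lambda>i. e i q) ` {..<k}) \<and>
              span ((\<lambda>i. e i q) ` {..<k}) = E q))"

definition uniformly_contracting ::
    "('n::finite torus \<Rightarrow> 'n torus) \<Rightarrow> ('n torus \<Rightarrow> (real ^ 'n) set) \<Rightarrow> bool"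
  where "uniformly_contracting f E \<longleftrightarrow>
    (\<exists>C>0. \<exists>r. 0 < r \<and> r < 1 \<and>
       (\<forall>p n. \<forall>v\<in>E p. norm (torus_deriv (f ^^ n) p v) \<le> C * r ^ n * norm v))"

text \<open>\<open>infdist v (E p)\<close> is the norm of the class of \<open>v\<close> in the quotient of the tangent space at \<open>p\<close>
  by \<open>E p\<close>.\<close>

definition quotient_uniformly_expanding ::
    "('n::finite torus \<Rightarrow> 'n torus) \<Rightarrow> ('n torus \<Rightarrow> (real ^ 'n) set) \<Rightarrow> bool"
  where "quotient_uniformly_expanding f E \<longleftrightarrow>
    (\<exists>C>0. \<exists>\<mu>>1. \<forall>p n v.
       infdist (torus_deriv (f ^^ n) p v) (E ((f ^^ n) p)) \<ge> C * \<mu> ^ n * infdist v (E p))"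

definition stable_bundle ::
    "('n::finite torus \<Rightarrow> 'n torus) \<Rightarrow> ('n torus \<Rightarrow> (real ^ 'n) set) \<Rightarrow> bool"
  where "stable_bundle f E \<longleftrightarrow> continuous_subbundle E \<and>
    (\<forall>p. blinfun_apply (torus_deriv f p) ` E p = E (f p)) \<and>
    uniformly_contracting f E \<and> quotient_uniformly_expanding f E"

definition anosov_map :: "('n::finite torus \<Rightarrow> 'n torus) \<Rightarrow> bool"
  where "anosov_map f \<longleftrightarrow> C1_local_diffeo f \<and> (\<exists>E. stable_bundle f E)"

text \<open>\<open>A\<close> is the matrix of the action of \<open>f\<close> on the fundamental group, identified with the integer
  vectors. The fundamental group is abelian, so free homotopy classes of loops are its elements,
  independently of the base point.\<close>

definition torus_loop :: "int ^ 'n \<Rightarrow> real \<Rightarrow> 'n::finite torus"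
  where "torus_loop n t = proj (t *\<^sub>R int_vec n)"

definition is_linearization :: "('n::finite torus \<Rightarrow> 'n torus) \<Rightarrow> int ^ 'n ^ 'n \<Rightarrow> bool"
  where "is_linearization f A \<longleftrightarrow>
    (\<forall>n. homotopic_loops UNIV (f \<circ> torus_loop n) (torus_loop (A *v n)))"

definition rat_charpoly :: "int ^ 'n ^ 'n \<Rightarrow> rat poly"
  where "rat_charpoly A = det (mat [:0, 1:] - map_matrix (\<lambda>a. [:rat_of_int a:]) A)"


section \<open>One-dimensional foliations\<close>

definition has_curve_derivative ::
    "(real \<Rightarrow> 'n::finite torus) \<Rightarrow> real ^ 'n \<Rightarrow> real \<Rightarrow> real set \<Rightarrow> bool"
  where "has_curve_derivative c v t S \<longleftrightarrow>
    (\<exists>C. proj (C t) = c t \<and> (\<forall>\<^sub>F s in at t within S. proj (C s) = c s) \<and>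
         (C has_vector_derivative v) (at t within S))"

definition C1_curve_on ::
    "real set \<Rightarrow> (real \<Rightarrow> 'n::finite torus) \<Rightarrow> (real \<Rightarrow> real ^ 'n) \<Rightarrow> bool"
  where "C1_curve_on S c c' \<longleftrightarrow>
    (\<forall>t\<in>S. has_curve_derivative c (c' t) t S) \<and> continuous_on S c'"

text \<open>An injectively immersed connected one-dimensional submanifold is an injectively immersed line
  or circle; the latter is parametrised by a periodic immersion of the line.\<close>

definition leaf_parametrization ::
    "'n::finite torus set \<Rightarrow> (real \<Rightarrow> 'n torus) \<Rightarrow> (real \<Rightarrow> real ^ 'n) \<Rightarrow> bool"
  where "leaf_parametrization L c c' \<longleftrightarrow>
    C1_curve_on UNIV c c' \<and> (\<forall>t. c' t \<noteq> 0) \<and> range c = L \<and>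
    (inj c \<or> (\<exists>T>0. \<forall>s t. c s = c t \<longleftrightarrow> (\<exists>k::int. s - t = of_int k * T)))"

text \<open>A decomposition into injectively immersed leaves, covered by topological charts
  \<open>\<phi>\<close> that send the segments of a cube parallel to the \<open>j\<close>-th axis into leaves.\<close>

definition one_dim_foliation :: "'n::finite torus set set \<Rightarrow> bool"
  where "one_dim_foliation W \<longleftrightarrow> partition_on UNIV W \<and>
    (\<forall>L\<in>W. \<exists>c c'. leaf_parametrization L c c') \<and>
    (\<forall>p. \<exists>U \<phi> \<psi> j. open U \<and> p \<in> U \<and>
       homeomorphism {x :: real ^ 'n. \<forall>i. \<bar>x $ i\<bar> < 1} U \<phi> \<psi> \<and>
       (\<forall>x. (\<forall>i. \<bar>x $ i\<bar> < 1) \<longrightarrow>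
          (\<exists>L\<in>W. \<forall>y. (\<forall>i. \<bar>y $ i\<bar> < 1) \<and> (\<forall>i. i \<noteq> j \<longrightarrow> y $ i = x $ i) \<longrightarrow> \<phi> y \<in> L)))"

definition tangent_to ::
    "'n::finite torus set set \<Rightarrow> ('n torus \<Rightarrow> (real ^ 'n) set) \<Rightarrow> bool"
  where "tangent_to W E \<longleftrightarrow>
    (\<forall>L\<in>W. \<forall>c c'. leaf_parametrization L c c' \<longrightarrow> (\<forall>t. span {c' t} = E (c t)))"

definition stable_foliation ::
    "('n::finite torus \<Rightarrow> 'n torus) \<Rightarrow> ('n torus \<Rightarrow> (real ^ 'n) set) \<Rightarrow> 'n torus set set \<Rightarrow> bool"
  where "stable_foliation f E W \<longleftrightarrow>
    one_dim_foliation W \<and> tangent_to W E \<and> (\<forall>L\<in>W. f ` L \<in> W)"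

text \<open>The restriction of \<open>h\<close> to each leaf is tested in arc-length coordinates, which are intrinsic to
  the leaf; on the (possibly non-compact) leaf the Hoelder condition is imposed on compact arcs.\<close>

definition C1_Hoelder_along ::
    "real \<Rightarrow> 'n::finite torus set set \<Rightarrow> ('n torus \<Rightarrow> 'n torus) \<Rightarrow> bool"
  where "C1_Hoelder_along \<alpha> W h \<longleftrightarrow>
    (\<forall>L\<in>W. \<forall>a b c c'. a < b \<and> C1_curve_on {a..b} c c' \<and> c ` {a..b} \<subseteq> L \<and>
        (\<forall>t\<in>{a..b}. norm (c' t) = 1) \<longrightarrow>
      (\<exists>g'. C1_curve_on {a..b} (h \<circ> c) g' \<and>
        (\<exists>K. \<forall>s\<in>{a..b}. \<forall>t\<in>{a..b}. norm (g' s - g' t) \<le> K * \<bar>s - t\<bar> powr \<alpha>)))"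

end

theory Submission
  imports Defs
begin

text \<open>Let \<open>F\<close> and \<open>H\<close> be lifts of \<open>f\<close> and \<open>h\<close> to Euclidean space, so that \<open>H (F x) = A H x + const\<close>, and let
\<open>\<tau>\<^sub>w x = H\<^sup>-\<^sup>1 (H x + w)\<close>. If \<open>A\<^sup>m w\<close> is an integer vector, then for all \<open>n \<ge> m\<close> the maps \<open>F\<^sup>n \<circ> \<tau>\<^sub>w\<close>
and \<open>F\<^sup>n\<close> differ by a deck translation. Hence \<open>\<tau>\<^sub>w\<close> preserves every quantity that is determined by the distant
future of \<open>f\<close>. One such quantity is the affine structure of a stable leaf: for points \<open>x\<close>, \<open>y\<close>, \<open>z\<close> of
one leaf the ratio of \<open>F\<^sup>n y - F\<^sup>n x\<close> to \<open>F\<^sup>n z - F\<^sup>n x\<close> converges, and the limit is the ratio of the values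
at \<open>y\<close> and \<open>z\<close> of an affine coordinate based at \<open>x\<close> (\<open>stable_coord\<close>). So \<open>\<tau>\<^sub>w\<close> is affine along stable leaves
(\<open>stable_coord_cross_ratio\<close>).

This is where non-invertibility enters. As \<open>f\<close> is not a bijection, \<open>\<bar>det A\<bar> \<ge> 2\<close>, and as the characteristic
polynomial is irreducible, the vectors \<open>w\<close> for which some \<open>A\<^sup>m w\<close> is integral accumulate at every vector of
the stable line of \<open>A\<close> (\<open>stable_line_approximable\<close>). The affine coordinate depends continuously on the points,
so \<open>\<tau>\<^sub>w\<close> is affine along leaves also for \<open>w\<close> in the stable line (\<open>translated_cross_ratio\<close>). For such \<open>w\<close>
the map \<open>\<tau>\<^sub>w\<close> slides each leaf along itself: it is the translation by \<open>w\<close> in the parameter that \<open>h\<close> provides.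
Let \<open>U\<close> express the affine coordinate through this parameter. Then \<open>U (x + s) - U s = a s * U x\<close>, which is the
functional equation of a one-parameter group of affine maps, and integration in \<open>s\<close> shows that \<open>U\<close> is \<open>C\<^sup>1\<close>
with positive derivative (\<open>cross_ratio_invariant_derivative\<close>). On the other hand the affine coordinate has a
positive \<open>\<alpha>\<close>-Hoelder density with respect to arc length (\<open>arc_coord_deriv\<close>, \<open>arc_dens_Hoelder\<close>). Therefore the
parameter, and with it \<open>h\<close>, is \<open>C\<^sup>1\<^sup>+\<^sup>\<alpha>\<close> in arc length (\<open>reparametrization_C1_Hoelder\<close>).

Stable manifold theory is replaced by a statement about orbits. If all iterates of two points stay close, then
expansion transverse to the bundle forces their displacement to be tangent to the bundle up to an error of order
\<open>1 + \<alpha>\<close> (\<open>stable_pair_transverse\<close>); contraction of distances, Hoelder continuity of the bundle along leaves, and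
the fact that the stable space of \<open>A\<close> is a line (\<open>stable_space_line\<close>) all follow from this.\<close>

section \<open>Pairs of points with close forward orbits\<close>

text \<open>For a unit vector \<open>e\<close> this is the norm of the class of \<open>u\<close> modulo the line spanned by \<open>e\<close>, see \<open>infdist_line\<close>.\<close>

definition transverse :: "'a::real_inner \<Rightarrow> 'a \<Rightarrow> real"
  where "transverse e u = norm (u - (e \<bullet> u) *\<^sub>R e)"

lemma transverse_triangle: "transverse e (u + w) \<le> transverse e u + transverse e w"
proof -
  have "u + w - (e \<bullet> (u + w)) *\<^sub>R e = (u - (e \<bullet> u) *\<^sub>R e) + (w - (e \<bullet> w) *\<^sub>R e)"
    by (simp add: inner_add_right algebra_simps)
  then show ?thesis unfolding transverse_def by (metis norm_triangle_ineq)
qed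

lemma transverse_minus: "transverse e (- u) = transverse e u"
proof -
  have "- u - (e \<bullet> (- u)) *\<^sub>R e = - (u - (e \<bullet> u) *\<^sub>R e)"
    by (simp add: algebra_simps)
  then show ?thesis unfolding transverse_def by (metis norm_minus_cancel)
qed

lemma transverse_le_norm:
  assumes "norm e = 1"
  shows "transverse e u \<le> norm u"
proof -
  have "e \<bullet> e = 1" using assms by (simp add: norm_eq_1)
  then have "(transverse e u)\<^sup>2 = (norm u)\<^sup>2 - (e \<bullet> u)\<^sup>2"
    unfolding transverse_def power2_norm_eq_inner
    by (simp add: inner_diff_left inner_diff_right inner_commute power2_eq_square)
  then have "(transverse e u)\<^sup>2 \<le> (norm u)\<^sup>2" by simp
  then show ?thesis by (rule power2_le_imp_le) simp
qed

lemma halving_decay: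
  fixes d :: "nat \<Rightarrow> real"
  assumes "\<And>n. d (Suc n) \<le> d n / 2"
  shows "d n \<le> d 0 / 2 ^ n"
proof (induction n)
  case (Suc n)
  then have "d n / 2 \<le> d 0 / 2 ^ n / 2" by (rule divide_right_mono) simp
  with assms[of n] have "d (Suc n) \<le> d 0 / 2 ^ n / 2" by (rule order_trans)
  then show ?case by (simp add: field_simps)
qed simp

text \<open>The line field is represented by unit vectors \<open>e x\<close> with arbitrary, in general discontinuous signs; all results
depend on \<open>e x\<close> up to sign only. The factors \<open>1/4\<close> and \<open>4\<close> are reached by passing to an iterate. The scale
\<open>\<epsilon>\<close> is so small that within distance \<open>\<epsilon>\<close> the variation of the derivative is negligible against the
expansion, the contraction, and the lower bound \<open>g0\<close> of the contraction rate.\<close>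

locale stable_line_map =
  fixes G :: "'a::euclidean_space \<Rightarrow> 'a" and DG :: "'a \<Rightarrow> 'a \<Rightarrow>\<^sub>L 'a" and e :: "'a \<Rightarrow> 'a"
    and \<alpha> K M g0 \<epsilon> :: real
  assumes alpha_pos: "0 < \<alpha>" and K_pos: "0 < K" and M_ge: "1 \<le> M" and eps_pos: "0 < \<epsilon>"
    and eps_small: "K * \<epsilon> powr \<alpha> * (1 + 8 * M) < g0"
    and deriv: "\<And>x. (G has_derivative DG x) (at x)"
    and hoelder: "\<And>x y. norm (DG x - DG y) \<le> K * dist x y powr \<alpha>"
    and bounded: "\<And>x. norm (DG x) \<le> M"
    and unit: "\<And>x. norm (e x) = 1"
    and invariant: "\<And>x. \<exists>c. DG x (e x) = c *\<^sub>R e (G x)"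
    and rate_ge: "\<And>x. g0 \<le> norm (DG x (e x))" 
    and rate_le: "\<And>x. norm (DG x (e x)) \<le> 1/4"
    and expanding: "\<And>x u. 4 * transverse (e x) u \<le> transverse (e (G x)) (DG x u)"
begin

abbreviation orb :: "nat \<Rightarrow> 'a \<Rightarrow> 'a" where "orb n x \<equiv> (G ^^ n) x"

text \<open>A substitute for lying on the same local stable leaf that refers to orbits only.\<close>

definition stable_pair :: "'a \<Rightarrow> 'a \<Rightarrow> bool"
  where "stable_pair x y \<longleftrightarrow> (\<forall>n. dist (orb n x) (orb n y) \<le> \<epsilon>)"

definition rate :: "'a \<Rightarrow> real" where "rate x = norm (DG x (e x))"

definition unit_tangent :: "'a \<Rightarrow> 'a \<Rightarrow> bool"
  where "unit_tangent x u \<longleftrightarrow> u = e x \<or> u = - e x"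

lemma g0_pos: "0 < g0"
proof -
  have "0 \<le> K * \<epsilon> powr \<alpha> * (1 + 8 * M)" using K_pos M_ge by (intro mult_nonneg_nonneg) auto
  then show ?thesis using eps_small by linarith
qed

lemma g0_le: "g0 \<le> 1/4" by (rule order_trans[OF rate_ge rate_le])

lemma rate_pos: "0 < rate x" unfolding rate_def by (rule less_le_trans[OF g0_pos rate_ge])

lemma eps_quarter: "K * \<epsilon> powr \<alpha> * (1 + 8 * M) < 1/4"
  using eps_small g0_le by linarith

lemma small_powr: "0 \<le> d \<Longrightarrow> d \<le> \<epsilon> \<Longrightarrow> K * d powr \<alpha> \<le> K * \<epsilon> powr \<alpha>"
  using K_pos alpha_pos by (simp add: powr_mono2)

lemma DG_norm_le: "norm (DG x u) \<le> M * norm u"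
  by (rule order_trans[OF norm_blinfun]) (simp add: bounded mult_right_mono)

lemma unit_tangent_norm: "unit_tangent x u \<Longrightarrow> norm u = 1"
  unfolding unit_tangent_def using unit by auto

lemma unit_tangent_transverse: "unit_tangent x u \<Longrightarrow> transverse (e x) w = norm (w - (u \<bullet> w) *\<^sub>R u)"
  unfolding unit_tangent_def transverse_def by auto

lemma unit_tangent_rate: "unit_tangent x u \<Longrightarrow> norm (DG x u) = rate x"
  unfolding unit_tangent_def rate_def by (auto simp: blinfun.minus_right)

lemma unit_tangent_push: 
  assumes "unit_tangent x u"
  shows "unit_tangent (G x) (sgn (DG x u))" "DG x u = rate x *\<^sub>R sgn (DG x u)"
proof -
  obtain c where c: "DG x (e x) = c *\<^sub>R e (G x)" using invariant by blast
  have "c \<noteq> 0" using rate_pos[of x] c unfolding rate_def by auto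
  have sg: "sgn (e (G x)) = e (G x)" by (simp add: sgn_div_norm unit)
  have "DG x u = c *\<^sub>R e (G x) \<or> DG x u = (-c) *\<^sub>R e (G x)"
    using assms c unfolding unit_tangent_def by (auto simp: blinfun.minus_right)
  then have "sgn (DG x u) = sgn c *\<^sub>R e (G x) \<or> sgn (DG x u) = sgn (-c) *\<^sub>R e (G x)"
    by (metis sg sgn_scaleR)
  then show "unit_tangent (G x) (sgn (DG x u))" unfolding unit_tangent_def using \<open>c \<noteq> 0\<close>
    by (auto simp: sgn_real_def split: if_splits)
  show "DG x u = rate x *\<^sub>R sgn (DG x u)"
    using unit_tangent_rate[OF assms] rate_pos[of x] by (simp add: sgn_div_norm)
qed

lemma taylor: "norm (G y - G x - DG x (y - x)) \<le> K * dist x y powr \<alpha> * dist x y"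
proof -
  have "norm (G y - G x - (DG x) (y - x)) \<le> norm (y - x) * (K * dist x y powr \<alpha>)"
  proof (rule differentiable_bound_linearization[where S = "closed_segment x y" and f' = "\<lambda>z. blinfun_apply (DG z)"])
    show "(G has_derivative blinfun_apply (DG z)) (at z within closed_segment x y)" for z
      using deriv by (rule has_derivative_at_withinI)
    fix t :: real assume t: "t \<in> {0..1}"
    show "x + t *\<^sub>R (y - x) \<in> closed_segment x y"
      using t unfolding closed_segment_def by (auto intro!: exI[of _ t] simp: algebra_simps)
  next
    fix z assume z: "z \<in> closed_segment x y"
    have "norm (DG z - DG x) \<le> K * dist z x powr \<alpha>" by (rule hoelder)
    also have "\<dots> \<le> K * dist x y powr \<alpha>"
    proof (intro mult_left_mono powr_mono2)
      show "dist z x \<le> dist x y"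
        using dist_in_closed_segment[OF z] by (simp add: dist_commute)
    qed (use K_pos alpha_pos in auto)
    finally show "onorm (blinfun_apply (DG z) - blinfun_apply (DG x)) \<le> K * dist x y powr \<alpha>"
      by (simp add: norm_blinfun.rep_eq minus_blinfun.rep_eq fun_diff_def)
  qed auto
  then show ?thesis by (simp add: dist_norm norm_minus_commute mult.commute)
qed

lemma stable_pair_sym: "stable_pair x y \<longleftrightarrow> stable_pair y x"
  unfolding stable_pair_def by (simp add: dist_commute)

lemma stable_pair_step: "stable_pair x y \<Longrightarrow> stable_pair (G x) (G y)"
  unfolding stable_pair_def by (metis funpow_Suc_right o_apply)

lemma stable_pair_orb: "stable_pair x y \<Longrightarrow> stable_pair (orb n x) (orb n y)"
  by (induction n) (auto intro: stable_pair_step)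

lemma stable_pair_dist: "stable_pair x y \<Longrightarrow> dist x y \<le> \<epsilon>"
  unfolding stable_pair_def by (metis funpow_0)

text \<open>The transverse component grows at least by the factor 4 in each step, up to an error \<open>B\<close>. As it stays below
\<open>\<epsilon>\<close> forever, it cannot exceed the fixed point \<open>B / 3\<close> of the recursion \<open>q = 4 * q - B\<close>.\<close>

lemma transverse_bound:
  assumes b: "\<And>n. K * dist (orb n x) (orb n y) powr \<alpha> * dist (orb n x) (orb n y) \<le> B"
    and st: "stable_pair x y"
  shows "transverse (e x) (y - x) \<le> B / 3"
proof -
  define q where "q n = transverse (e (orb n x)) (orb n y - orb n x)" for n
  have step: "4 * q n \<le> q (Suc n) + B" for n
  proof -
    let ?X = "orb n x" and ?Y = "orb n y"
    let ?r = "G ?Y - G ?X - DG ?X (?Y - ?X)"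
    have "4 * q n \<le> transverse (e (G ?X)) (DG ?X (?Y - ?X))" unfolding q_def by (rule expanding)
    also have "DG ?X (?Y - ?X) = (G ?Y - G ?X) + (- ?r)" by simp
    also have "transverse (e (G ?X)) \<dots> \<le> transverse (e (G ?X)) (G ?Y - G ?X) + transverse (e (G ?X)) (- ?r)"
      by (rule transverse_triangle)
    also have "transverse (e (G ?X)) (- ?r) \<le> norm ?r"
      by (metis transverse_le_norm unit transverse_minus)
    also have "norm ?r \<le> B" using taylor[of ?Y ?X] b[of n] by linarith
    finally show ?thesis unfolding q_def by simp
  qed
  have qe: "q n \<le> \<epsilon>" for n
    using order_trans[OF transverse_le_norm[OF unit]] st
    unfolding stable_pair_def q_def by (simp add: dist_norm norm_minus_commute)
  \<comment> \<open>the solution of the recursion, with the geometric series of the errors summed up\<close>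
  have "q 0 \<le> q n / 4 ^ n + B / 3 * (1 - 1 / 4 ^ n)" for n
  proof (induction n)
    case (Suc n)
    then show ?case using step[of n] by (simp add: field_simps)
  qed simp
  then have "q 0 \<le> B / 3 + (\<epsilon> - B / 3) * (1 / 4) ^ n" for n
  proof -
    have "q n / 4 ^ n \<le> \<epsilon> / 4 ^ n" by (intro divide_right_mono qe) simp
    moreover have "B / 3 + (\<epsilon> - B / 3) * (1 / 4) ^ n = \<epsilon> / 4 ^ n + B / 3 * (1 - 1 / 4 ^ n)"
      by (simp add: power_one_over field_simps)
    ultimately show ?thesis using \<open>q 0 \<le> q n / 4 ^ n + B / 3 * (1 - 1 / 4 ^ n)\<close> by linarith
  qed
  then have le: "\<exists>N. \<forall>n\<ge>N. q 0 \<le> B / 3 + (\<epsilon> - B / 3) * (1 / 4) ^ n" by blast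
  have "(\<lambda>n. B / 3 + (\<epsilon> - B / 3) * (1 / 4) ^ n) \<longlonglongrightarrow> B / 3 + (\<epsilon> - B / 3) * 0"
    by (intro tendsto_intros LIMSEQ_power_zero) auto
  from LIMSEQ_le_const[OF this le] have "q 0 \<le> B / 3 + (\<epsilon> - B / 3) * 0" .
  then show ?thesis by (simp add: q_def)
qed

text \<open>The displacement is almost tangent to the line field and is therefore contracted like the line field. The bound
\<open>D\<close> has to cover all later distances, because \<open>transverse_bound\<close> uses the whole future.\<close>

lemma stable_pair_contracts_to_sup:
  assumes st: "stable_pair x y" and D: "\<And>n. dist (orb n x) (orb n y) \<le> D"
  shows "dist (G x) (G y) \<le> D / 2"
proof -
  define k where "k = K * \<epsilon> powr \<alpha>"
  have k0: "0 \<le> k" unfolding k_def using K_pos by simp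
  have D0: "0 \<le> D" by (rule order_trans[OF zero_le_dist D[of 0]])
  have pw: "K * dist (orb n x) (orb n y) powr \<alpha> * dist (orb n x) (orb n y) \<le> k * D" for n
  proof (rule mult_mono)
    show "K * dist (orb n x) (orb n y) powr \<alpha> \<le> k"
      unfolding k_def using st by (intro small_powr) (auto simp: stable_pair_def)
  qed (use D k0 in auto)
  have q: "transverse (e x) (y - x) \<le> k * D / 3"
    using transverse_bound[OF pw st] by simp
  let ?r = "(y - x) - (e x \<bullet> (y - x)) *\<^sub>R e x"
  have d: "norm (y - x) \<le> D" using D[of 0] by (simp add: dist_norm norm_minus_commute)
  have "DG x (y - x) = (e x \<bullet> (y - x)) *\<^sub>R DG x (e x) + DG x ?r"
    by (simp add: blinfun.diff_right blinfun.scaleR_right)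
  also have "norm \<dots> \<le> norm ((e x \<bullet> (y - x)) *\<^sub>R DG x (e x)) + norm (DG x ?r)"
    by (rule norm_triangle_ineq)
  also have "norm ((e x \<bullet> (y - x)) *\<^sub>R DG x (e x)) \<le> D * (1/4)"
    unfolding norm_scaleR
  proof (intro mult_mono)
    show "\<bar>e x \<bullet> (y - x)\<bar> \<le> D"
      using Cauchy_Schwarz_ineq2[of "e x" "y - x"] unit[of x] d by simp
  qed (use rate_le D0 in auto)
  also have "norm (DG x ?r) \<le> M * (k * D / 3)"
    by (rule order_trans[OF DG_norm_le]) (use q M_ge in \<open>auto simp: transverse_def intro!: mult_left_mono\<close>)
  finally have 1: "norm (DG x (y - x)) \<le> D * (1/4) + M * (k * D / 3)" by simp
  have "dist (G x) (G y) = norm (DG x (y - x) + (G y - G x - DG x (y - x)))"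
    by (simp add: dist_norm norm_minus_commute)
  also have "\<dots> \<le> norm (DG x (y - x)) + norm (G y - G x - DG x (y - x))"
    by (rule norm_triangle_ineq)
  also have "norm (G y - G x - DG x (y - x)) \<le> k * D" using taylor[of y x] pw[of 0] by simp
  finally have "dist (G x) (G y) \<le> D * (1/4 + (M * k / 3 + k))" using 1 by (simp add: algebra_simps)
  also have "\<dots> \<le> D * (1/2)"
  proof (rule mult_left_mono)
    have "0 \<le> M * k" using M_ge k0 by simp
    moreover have "k + 8 * (M * k) < 1/4" using eps_quarter unfolding k_def by (simp add: algebra_simps)
    ultimately show "1/4 + (M * k / 3 + k) \<le> 1/2" by linarith
  qed (rule D0)
  finally show ?thesis by simp
qed

text \<open>All distances but the first are at most half of the supremum of all of them, so the first one is the supremum.\<close>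

lemma stable_pair_contracts:
  assumes "stable_pair x y"
  shows "dist (G x) (G y) \<le> dist x y / 2"
proof -
  define D where "D = (SUP n. dist (orb n x) (orb n y))"
  have bdd: "bdd_above (range (\<lambda>n. dist (orb n x) (orb n y)))"
    using assms unfolding stable_pair_def by (intro bdd_aboveI2) auto
  have D: "dist (orb n x) (orb n y) \<le> D" for n
    unfolding D_def by (rule cSUP_upper[OF _ bdd]) simp
  have half: "dist (orb (Suc n) x) (orb (Suc n) y) \<le> D / 2" for n
    using stable_pair_contracts_to_sup[OF stable_pair_orb[OF assms, of n], of D] D
    by (simp flip: funpow_add[unfolded o_def, THEN fun_cong])
  have "D \<le> max (dist x y) (D / 2)"
    unfolding D_def
  proof (rule cSUP_least)
    fix n show "dist (orb n x) (orb n y) \<le> max (dist x y) ((SUP n. dist (orb n x) (orb n y)) / 2)"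
    proof (cases n)
      case (Suc m)
      then show ?thesis using half[of m] unfolding D_def by simp
    qed simp
  qed simp
  moreover have "0 \<le> D" by (rule order_trans[OF zero_le_dist D[of 0]])
  ultimately have "D \<le> dist x y" using zero_le_dist[of x y] by linarith
  then show ?thesis using half[of 0] by simp
qed

lemma stable_pair_decay:
  assumes "stable_pair x y"
  shows "dist (orb n x) (orb n y) \<le> dist x y / 2 ^ n"
  using halving_decay[of "\<lambda>n. dist (orb n x) (orb n y)" n] stable_pair_contracts stable_pair_orb[OF assms]
  by simp

text \<open>By contraction the initial distance bounds the Taylor errors at all later times in \<open>transverse_bound\<close>.\<close>

lemma stable_pair_transverse:
  assumes "stable_pair x y"
  shows "transverse (e x) (y - x) \<le> K * dist x y powr \<alpha> * dist x y"
proof -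
  have "dist (orb n x) (orb n y) \<le> dist x y" for n
  proof -
    have "dist x y / 2 ^ n \<le> dist x y / 1" by (rule divide_left_mono) auto
    then show ?thesis using stable_pair_decay[OF assms, of n] by simp
  qed
  then have "K * dist (orb n x) (orb n y) powr \<alpha> * dist (orb n x) (orb n y) \<le> K * dist x y powr \<alpha> * dist x y" for n
    using K_pos alpha_pos by (intro mult_mono mult_left_mono powr_mono2) auto
  from transverse_bound[OF this assms]
  have "transverse (e x) (y - x) \<le> K * dist x y powr \<alpha> * dist x y / 3" .
  moreover have "0 \<le> K * dist x y powr \<alpha> * dist x y" using K_pos by simp
  ultimately show ?thesis by linarith
qed

end

section \<open>The affine coordinate of a local stable leaf\<close>

lemma unit_inner_le: "norm p = 1 \<Longrightarrow> \<bar>p \<bullet> q\<bar> \<le> norm q"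
  using Cauchy_Schwarz_ineq2[of p q] by simp

lemma geometric_steps_converge:
  fixes f :: "nat \<Rightarrow> real"
  assumes step: "\<And>n. \<bar>f (Suc n) - f n\<bar> \<le> B * \<beta> ^ n" and b: "0 < \<beta>" "\<beta> < 1"
  shows "f \<longlonglongrightarrow> lim f" "\<bar>lim f - f n\<bar> \<le> B / (1 - \<beta>) * \<beta> ^ n"
proof -
  have sB: "summable (\<lambda>k. B * \<beta> ^ k)" using b by (intro summable_mult summable_geometric) auto
  have sm: "summable (\<lambda>k. f (Suc k) - f k)"
    by (rule summable_comparison_test'[OF sB, of 0]) (use step in auto)
  define L where "L = f 0 + (\<Sum>k. f (Suc k) - f k)"
  have "(\<lambda>n. \<Sum>k<n. f (Suc k) - f k) \<longlonglongrightarrow> (\<Sum>k. f (Suc k) - f k)"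
    using sm by (rule summable_LIMSEQ)
  then have "(\<lambda>n. f n - f 0) \<longlonglongrightarrow> (\<Sum>k. f (Suc k) - f k)" by (simp add: sum_lessThan_telescope)
  from tendsto_add[OF tendsto_const[of "f 0"] this] have L: "f \<longlonglongrightarrow> L" unfolding L_def by simp
  then show lim: "f \<longlonglongrightarrow> lim f" by (simp add: limI)
  have partial: "\<bar>f (n + m) - f n\<bar> \<le> B / (1 - \<beta>) * \<beta> ^ n * (1 - \<beta> ^ m)" for m
  proof (induction m)
    case (Suc m)
    have "\<bar>f (n + Suc m) - f n\<bar> \<le> \<bar>f (n + m) - f n\<bar> + \<bar>f (Suc (n + m)) - f (n + m)\<bar>" by simp
    also have "\<dots> \<le> B / (1 - \<beta>) * \<beta> ^ n * (1 - \<beta> ^ m) + B * \<beta> ^ (n + m)"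
      using Suc step[of "n + m"] by linarith
    also have "B * \<beta> ^ (n + m) = B / (1 - \<beta>) * (\<beta> ^ n * (\<beta> ^ m * (1 - \<beta>)))"
      using b by (simp add: power_add)
    also have "B / (1 - \<beta>) * \<beta> ^ n * (1 - \<beta> ^ m) + B / (1 - \<beta>) * (\<beta> ^ n * (\<beta> ^ m * (1 - \<beta>)))
        = B / (1 - \<beta>) * (\<beta> ^ n * (1 - \<beta> ^ m) + \<beta> ^ n * (\<beta> ^ m * (1 - \<beta>)))"
      by (simp only: distrib_left mult.assoc)
    also have "\<beta> ^ n * (1 - \<beta> ^ m) + \<beta> ^ n * (\<beta> ^ m * (1 - \<beta>)) = \<beta> ^ n * (1 - \<beta> ^ Suc m)"
      by (simp add: algebra_simps)
    finally show ?case by (simp only: mult.assoc)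
  qed simp
  have B0: "0 \<le> B" using order_trans[OF abs_ge_zero step[of 0]] by simp
  have "\<bar>f (m + n) - f n\<bar> \<le> B / (1 - \<beta>) * \<beta> ^ n" for m
  proof -
    have "B / (1 - \<beta>) * \<beta> ^ n * (1 - \<beta> ^ m) \<le> B / (1 - \<beta>) * \<beta> ^ n * 1"
      using b B0 by (intro mult_left_mono) auto
    then show ?thesis using partial[of m] by (simp add: add.commute)
  qed
  moreover have "(\<lambda>m. \<bar>f (m + n) - f n\<bar>) \<longlonglongrightarrow> \<bar>lim f - f n\<bar>"
    using LIMSEQ_ignore_initial_segment[OF lim, of n] by (intro tendsto_intros)
  ultimately show "\<bar>lim f - f n\<bar> \<le> B / (1 - \<beta>) * \<beta> ^ n" by (intro LIMSEQ_le_const2) auto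
qed

lemma ln_diff_bound:
  fixes a b :: real
  assumes "0 < g" "g \<le> a" "g \<le> b"
  shows "\<bar>ln a - ln b\<bar> \<le> \<bar>a - b\<bar> / g"
proof -
  have *: "ln a - ln b \<le> \<bar>a - b\<bar> / g" if "g \<le> a" "g \<le> b" for a b :: real
  proof -
    have "ln a - ln b \<le> (a - b) / b" using assms(1) that by (intro ln_diff_le) auto
    also have "\<dots> \<le> \<bar>a - b\<bar> / b" using assms(1) that by (intro divide_right_mono) auto
    also have "\<dots> \<le> \<bar>a - b\<bar> / g" using assms(1) that by (intro divide_left_mono) auto
    finally show ?thesis .
  qed
  show ?thesis using *[OF assms(2,3)] *[OF assms(3,2)] by (auto simp: abs_le_iff abs_minus_commute)
qed

context stable_line_map
begin

text \<open>The displacement of the two points is almost tangent at both of them, so both tangent lines are close to its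
direction. This is Hoelder continuity of the line field along leaves, with the exponent of the derivative.\<close>

lemma stable_tangent_close:
  assumes st: "stable_pair x y" and u: "unit_tangent x u" and u': "unit_tangent y u'" and pos: "0 \<le> u \<bullet> u'"
  shows "norm (u - u') \<le> 8 * (K * dist x y powr \<alpha>)"
proof -
  define d k s a b where "d = dist x y" and "k = K * dist x y powr \<alpha>" and "s = u \<bullet> u'"
    and "a = u \<bullet> (y - x)" and "b = u' \<bullet> (y - x)"
  have nu: "u \<bullet> u = 1" "u' \<bullet> u' = 1" using u u' unit_tangent_norm by (auto simp: norm_eq_1[symmetric])
  have k0: "0 \<le> k" unfolding k_def using K_pos by simp
  have "k \<le> K * \<epsilon> powr \<alpha>" unfolding k_def by (intro small_powr stable_pair_dist st) simp
  then have "k * (1 + 8 * M) < 1/4"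
    using eps_quarter mult_right_mono[of k "K * \<epsilon> powr \<alpha>" "1 + 8 * M"] M_ge by linarith
  moreover have "k * 1 \<le> k * M" using k0 M_ge by (intro mult_left_mono) auto
  ultimately have k1: "k < 1/36" by (simp add: algebra_simps)
  have 1: "norm ((y - x) - a *\<^sub>R u) \<le> k * d"
    using stable_pair_transverse[OF st] unit_tangent_transverse[OF u] unfolding a_def k_def d_def by simp
  have "norm ((x - y) - (u' \<bullet> (x - y)) *\<^sub>R u') \<le> k * d"
    using stable_pair_transverse[of y x] st stable_pair_sym[of x y] unit_tangent_transverse[OF u']
    unfolding k_def d_def by (simp add: dist_commute)
  moreover have "(x - y) - (u' \<bullet> (x - y)) *\<^sub>R u' = - ((y - x) - b *\<^sub>R u')"
    unfolding b_def by (simp add: inner_diff_right algebra_simps)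
  ultimately have 2: "norm ((y - x) - b *\<^sub>R u') \<le> k * d" by (simp only: norm_minus_cancel)
  have "a *\<^sub>R u - b *\<^sub>R u' = ((y - x) - b *\<^sub>R u') - ((y - x) - a *\<^sub>R u)" by simp
  then have 3: "norm (a *\<^sub>R u - b *\<^sub>R u') \<le> 2 * k * d"
    using norm_triangle_ineq4[of "(y - x) - b *\<^sub>R u'" "(y - x) - a *\<^sub>R u"] 1 2 by simp
  have "d = norm (((y - x) - a *\<^sub>R u) + a *\<^sub>R u)" unfolding d_def by (simp add: dist_norm norm_minus_commute)
  also have "\<dots> \<le> k * d + \<bar>a\<bar>" 
    using norm_triangle_ineq[of "(y - x) - a *\<^sub>R u" "a *\<^sub>R u"] 1 u unit_tangent_norm[OF u] by simp
  finally have a: "d / 2 \<le> \<bar>a\<bar>"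
    using mult_right_mono[of k "1/2" d] k1 unfolding d_def by auto
  \<comment> \<open>\<open>s\<close> is the cosine of the angle between the two unit vectors, so \<open>1 - s\<^sup>2\<close> is what has to be small\<close>
  have "(norm (a *\<^sub>R u - b *\<^sub>R u'))\<^sup>2 = (b - a * s)\<^sup>2 + a\<^sup>2 * (1 - s\<^sup>2)"
    unfolding power2_norm_eq_inner s_def
    by (simp add: inner_diff_left inner_diff_right nu inner_commute power2_eq_square algebra_simps)
  then have "a\<^sup>2 * (1 - s\<^sup>2) \<le> (norm (a *\<^sub>R u - b *\<^sub>R u'))\<^sup>2" by simp
  also have "\<dots> \<le> (2 * k * d)\<^sup>2" using 3 by (intro power_mono) auto
  finally have 4: "a\<^sup>2 * (1 - s\<^sup>2) \<le> 4 * k\<^sup>2 * d\<^sup>2" by (simp add: power_mult_distrib)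
  have s: "0 \<le> s" "s \<le> 1" using pos Cauchy_Schwarz_ineq2[of u u'] u u' unit_tangent_norm unfolding s_def by auto
  have ss: "0 \<le> 1 - s\<^sup>2" using s by (simp add: power_le_one)
  have 5: "norm (u - u') \<le> 8 * k" if "1 - s\<^sup>2 \<le> 16 * k\<^sup>2"
  proof (rule power2_le_imp_le)
    have "s * s \<le> s * 1" using s by (intro mult_left_mono) auto
    have "(norm (u - u'))\<^sup>2 = 2 - 2 * s"
      unfolding power2_norm_eq_inner s_def by (simp add: inner_diff_left inner_diff_right nu inner_commute)
    also have "\<dots> \<le> 2 * (1 - s\<^sup>2)" using \<open>s * s \<le> s * 1\<close> by (simp add: power2_eq_square)
    also have "\<dots> \<le> (8 * k)\<^sup>2" 
      unfolding power_mult_distrib using that zero_le_power2[of k] by simp (use zero_le_power2[of k] in linarith)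
    finally show "(norm (u - u'))\<^sup>2 \<le> (8 * k)\<^sup>2" .
  qed (use k0 in simp)
  show ?thesis
  proof (cases "d = 0")
    case True
    then have "x = y" by (simp add: d_def)
    then have "u' = u \<or> u' = - u" using u u' unfolding unit_tangent_def by auto
    then have "s = 1" using nu s unfolding s_def by auto
    then show ?thesis using 5 unfolding k_def by simp
  next
    case False
    then have d: "0 < d" unfolding d_def by simp
    have "d\<^sup>2 / 4 \<le> a\<^sup>2" using power_mono[OF a, of 2] d by (simp add: power_divide)
    then have "d\<^sup>2 / 4 * (1 - s\<^sup>2) \<le> 4 * k\<^sup>2 * d\<^sup>2" using 4 mult_right_mono[OF _ ss] order_trans by blast
    then have "d\<^sup>2 * (1 - s\<^sup>2) \<le> d\<^sup>2 * (16 * k\<^sup>2)" by (simp add: algebra_simps)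
    then have "1 - s\<^sup>2 \<le> 16 * k\<^sup>2" using d by (simp add: mult_le_cancel_left_pos)
    then show ?thesis using 5 unfolding k_def by simp
  qed
qed

lemma push_close:
  assumes st: "stable_pair x y" and u: "unit_tangent x u" and u': "unit_tangent y u'" and pos: "0 \<le> u \<bullet> u'"
  shows "norm (DG x u - DG y u') \<le> (1 + 8 * M) * (K * dist x y powr \<alpha>)"
proof -
  have "DG x u - DG y u' = DG x (u - u') + (DG x - DG y) u'"
    by (simp add: blinfun.diff_right blinfun.diff_left)
  then have "norm (DG x u - DG y u') \<le> norm (DG x (u - u')) + norm ((DG x - DG y) u')"
    by (metis norm_triangle_ineq)
  also have "norm (DG x (u - u')) \<le> M * (8 * (K * dist x y powr \<alpha>))"
    using DG_norm_le[of x "u - u'"] stable_tangent_close[OF assms] M_ge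
    by (elim order_trans) (simp add: mult_left_mono)
  also have "norm ((DG x - DG y) u') \<le> K * dist x y powr \<alpha>"
    using norm_blinfun[of "DG x - DG y" u'] hoelder[of x y] unit_tangent_norm[OF u'] by simp
  finally show ?thesis by (simp add: algebra_simps)
qed

text \<open>If the images pointed to opposite sides, they would differ by at least \<open>g0\<close>, which is more than the variation of
the derivative allows.\<close>

lemma push_keeps_orientation:
  assumes st: "stable_pair x y" and u: "unit_tangent x u" and u': "unit_tangent y u'" and pos: "0 \<le> u \<bullet> u'"
  shows "0 < sgn (DG x u) \<bullet> sgn (DG y u')"
proof (rule ccontr)
  define w w' where "w = sgn (DG x u)" and "w' = sgn (DG y u')"
  assume "\<not> 0 < sgn (DG x u) \<bullet> sgn (DG y u')"
  then have neg: "w \<bullet> w' \<le> 0" unfolding w_def w'_def by simp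
  have nw: "w \<bullet> w = 1" "w' \<bullet> w' = 1"
    using unit_tangent_push[OF u] unit_tangent_push[OF u'] unit_tangent_norm unfolding w_def w'_def
    by (auto simp: norm_eq_1[symmetric])
  have "K * dist x y powr \<alpha> * (1 + 8 * M) \<le> K * \<epsilon> powr \<alpha> * (1 + 8 * M)"
    using M_ge by (intro mult_right_mono small_powr stable_pair_dist st) auto
  then have less: "norm (DG x u - DG y u') < g0"
    using push_close[OF assms] eps_small by (simp add: mult.commute)
  have v: "DG x u - DG y u' = rate x *\<^sub>R w - rate y *\<^sub>R w'"
    using unit_tangent_push(2)[OF u] unit_tangent_push(2)[OF u'] unfolding w_def w'_def by simp
  have "(norm (DG x u - DG y u'))\<^sup>2 = (rate x)\<^sup>2 + (rate y)\<^sup>2 - 2 * (rate x * rate y * (w \<bullet> w'))"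
    unfolding v power2_norm_eq_inner
    by (simp add: inner_diff_left inner_diff_right nw inner_commute power2_eq_square algebra_simps)
  moreover have "rate x * rate y * (w \<bullet> w') \<le> 0"
    using rate_pos[of x] rate_pos[of y] neg by (simp add: mult_nonneg_nonpos)
  ultimately have "(rate x)\<^sup>2 \<le> (norm (DG x u - DG y u'))\<^sup>2" using zero_le_power2[of "rate y"] by linarith
  then have "rate x \<le> norm (DG x u - DG y u')" by (rule power2_le_imp_le) simp
  then show False using less rate_ge[of x] unfolding rate_def by linarith
qed

lemma rate_close:
  assumes st: "stable_pair x y"
  shows "\<bar>rate x - rate y\<bar> \<le> (1 + 8 * M) * (K * dist x y powr \<alpha>)"
proof -
  define u where "u = (if 0 \<le> e x \<bullet> e y then e y else - e y)"
  have ex: "unit_tangent x (e x)" and u: "unit_tangent y u" unfolding u_def unit_tangent_def by auto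
  have "0 \<le> e x \<bullet> u" unfolding u_def by auto
  from push_close[OF st ex u this] show ?thesis
    using norm_triangle_ineq3[of "DG x (e x)" "DG y u"] unit_tangent_rate[OF u] unit_tangent_rate[OF ex] by simp
qed

text \<open>The transverse component of the displacement and the Taylor remainder are both of order \<open>1 + \<alpha>\<close>.\<close>

lemma push_expansion:
  assumes st: "stable_pair x y" and u: "unit_tangent x u"
  shows "norm (G y - G x - (rate x * (u \<bullet> (y - x))) *\<^sub>R sgn (DG x u)) \<le> (M + 1) * (K * dist x y powr \<alpha> * dist x y)"
proof -
  let ?r = "(y - x) - (u \<bullet> (y - x)) *\<^sub>R u"
  have r: "norm ?r \<le> K * dist x y powr \<alpha> * dist x y"
    using stable_pair_transverse[OF st] unit_tangent_transverse[OF u] by simp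
  have "DG x (y - x) = (u \<bullet> (y - x)) *\<^sub>R DG x u + DG x ?r"
    by (simp add: blinfun.diff_right blinfun.scaleR_right)
  also have "(u \<bullet> (y - x)) *\<^sub>R DG x u = (rate x * (u \<bullet> (y - x))) *\<^sub>R sgn (DG x u)"
    by (subst unit_tangent_push(2)[OF u]) (simp add: mult.commute)
  finally have "G y - G x - (rate x * (u \<bullet> (y - x))) *\<^sub>R sgn (DG x u) = DG x ?r + (G y - G x - DG x (y - x))"
    by (simp add: algebra_simps)
  then have "norm (G y - G x - (rate x * (u \<bullet> (y - x))) *\<^sub>R sgn (DG x u)) \<le> norm (DG x ?r) + norm (G y - G x - DG x (y - x))"
    by (metis norm_triangle_ineq)
  also have "norm (DG x ?r) \<le> M * (K * dist x y powr \<alpha> * dist x y)"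
    by (rule order_trans[OF DG_norm_le]) (use M_ge r in \<open>auto intro!: mult_left_mono\<close>)
  also have "norm (G y - G x - DG x (y - x)) \<le> K * dist x y powr \<alpha> * dist x y" by (rule taylor)
  finally show ?thesis by (simp add: algebra_simps)
qed

lemma dist_push_le:
  assumes st: "stable_pair x y"
  shows "dist (G x) (G y) \<le> rate x * dist x y + (M + 1) * (K * dist x y powr \<alpha> * dist x y)"
proof -
  have u: "unit_tangent x (e x)" unfolding unit_tangent_def by simp
  let ?v = "(rate x * (e x \<bullet> (y - x))) *\<^sub>R sgn (DG x (e x))"
  have "dist (G x) (G y) = norm ((G y - G x - ?v) + ?v)" by (simp add: dist_norm norm_minus_commute)
  also have "\<dots> \<le> norm (G y - G x - ?v) + norm ?v" by (rule norm_triangle_ineq)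
  also have "norm ?v \<le> rate x * dist x y"
  proof -
    have "norm ?v = rate x * \<bar>e x \<bullet> (y - x)\<bar>"
      using unit_tangent_norm[OF unit_tangent_push(1)[OF u]] rate_pos[of x] by (simp add: abs_mult)
    also have "\<dots> \<le> rate x * dist x y"
      using unit_inner_le[OF unit, of x "y - x"] rate_pos[of x]
      by (intro mult_left_mono) (auto simp: dist_norm norm_minus_commute)
    finally show ?thesis .
  qed
  finally show ?thesis using push_expansion[OF st u] by linarith
qed

primrec direction :: "nat \<Rightarrow> 'a \<Rightarrow> 'a \<Rightarrow> 'a" where
  "direction 0 x u = u"
| "direction (Suc n) x u = sgn (DG (orb n x) (direction n x u))"

text \<open>By the chain rule, the factor by which the \<open>n\<close>-th iterate contracts the line at \<open>x\<close>.\<close>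

definition contraction :: "nat \<Rightarrow> 'a \<Rightarrow> real" where "contraction n x = (\<Prod>i<n. rate (orb i x))"

lemma contraction_pos: "0 < contraction n x" unfolding contraction_def by (simp add: prod_pos rate_pos)

lemma contraction_0: "contraction 0 x = 1" and contraction_Suc: "contraction (Suc n) x = contraction n x * rate (orb n x)"
  unfolding contraction_def by simp_all

lemma direction_unit_tangent: "unit_tangent x u \<Longrightarrow> unit_tangent (orb n x) (direction n x u)"
  by (induction n) (auto intro: unit_tangent_push)

lemma direction_orientation:
  assumes "stable_pair x y" "unit_tangent x u" "unit_tangent y u'" "0 < u \<bullet> u'"
  shows "0 < direction n x u \<bullet> direction n y u'"
proof (induction n)
  case (Suc n)
  then show ?case 
    using push_keeps_orientation[OF stable_pair_orb[OF assms(1)] direction_unit_tangent[OF assms(2)] direction_unit_tangent[OF assms(3)]]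
    by simp
qed (use assms in simp)

text \<open>Distances of stable pairs are at least halved in each step, so their \<open>\<alpha>\<close>-th powers decay like the powers of
\<open>\<beta>\<close>.\<close>

definition \<beta> :: real where "\<beta> = (1/2) powr \<alpha>"

lemma beta: "0 < \<beta>" "\<beta> < 1"
  unfolding \<beta>_def using alpha_pos by (auto simp: powr01_less_one)

lemma dist_powr_decay:
  assumes "stable_pair x y"
  shows "dist (orb n x) (orb n y) powr \<alpha> \<le> dist x y powr \<alpha> * \<beta> ^ n"
proof -
  have "dist (orb n x) (orb n y) powr \<alpha> \<le> (dist x y * (1/2) ^ n) powr \<alpha>"
  proof (rule powr_mono2)
    have "dist x y / 2 ^ n = dist x y * (1/2) ^ n" by (simp add: power_one_over)
    then show "dist (orb n x) (orb n y) \<le> dist x y * (1/2) ^ n" using stable_pair_decay[OF assms, of n] by simp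
  qed (use alpha_pos in auto)
  also have "\<dots> = dist x y powr \<alpha> * \<beta> ^ n"
  proof -
    have "((1/2::real) ^ n) powr \<alpha> = (1/2) powr (real n * \<alpha>)"
      by (subst powr_realpow[symmetric]) (simp, simp only: powr_powr)
    also have "\<dots> = ((1/2) powr \<alpha>) powr real n" by (simp only: powr_powr mult.commute)
    also have "\<dots> = \<beta> ^ n" unfolding \<beta>_def by (rule powr_realpow) simp
    finally show ?thesis by (subst powr_mult) simp_all
  qed
  finally show ?thesis .
qed

definition "dist_const = exp ((M + 1) * K * \<epsilon> powr \<alpha> / g0 / (1 - \<beta>))"

lemma dist_const_pos: "0 < dist_const" unfolding dist_const_def by simp

text \<open>In the \<open>i\<close>-th step the distance is contracted by the rate of the line field up to a factor \<open>1 + O(\<beta> ^ i)\<close>, and the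
product of these factors is bounded.\<close>

lemma dist_le_contraction:
  assumes st: "stable_pair x y"
  shows "dist (orb n x) (orb n y) \<le> dist_const * contraction n x * dist x y"
proof -
  define c where "c = (M + 1) * K * \<epsilon> powr \<alpha> / g0"
  have c0: "0 \<le> c" unfolding c_def using M_ge K_pos g0_pos by simp
  have "dist (orb n x) (orb n y) \<le> contraction n x * dist x y * exp (c * (\<Sum>i<n. \<beta> ^ i))"
  proof (induction n)
    case 0 then show ?case by (simp add: contraction_0)
  next
    case (Suc n)
    let ?d = "dist (orb n x) (orb n y)" and ?r = "rate (orb n x)"
    have "dist (orb (Suc n) x) (orb (Suc n) y) \<le> ?r * ?d + (M + 1) * (K * ?d powr \<alpha> * ?d)"
      using dist_push_le[OF stable_pair_orb[OF st]] by simp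
    also have "(M + 1) * (K * ?d powr \<alpha> * ?d) \<le> (M + 1) * (K * (\<epsilon> powr \<alpha> * \<beta> ^ n) * ?d)"
    proof (intro mult_left_mono mult_right_mono)
      have "dist x y powr \<alpha> * \<beta> ^ n \<le> \<epsilon> powr \<alpha> * \<beta> ^ n"
        using stable_pair_dist[OF st] alpha_pos beta by (intro mult_right_mono powr_mono2) auto
      then show "?d powr \<alpha> \<le> \<epsilon> powr \<alpha> * \<beta> ^ n" using dist_powr_decay[OF st, of n] by linarith
    qed (use M_ge K_pos in auto)
    also have "\<dots> = g0 * (c * \<beta> ^ n * ?d)" unfolding c_def using g0_pos by (simp add: field_simps)
    also have "\<dots> \<le> ?r * (c * \<beta> ^ n * ?d)"
      using rate_ge[of "orb n x"] c0 beta unfolding rate_def by (intro mult_right_mono) auto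
    also have "?r * ?d + ?r * (c * \<beta> ^ n * ?d) = ?r * ((1 + c * \<beta> ^ n) * ?d)" by (simp add: algebra_simps)
    also have "\<dots> \<le> ?r * (exp (c * \<beta> ^ n) * (contraction n x * dist x y * exp (c * (\<Sum>i<n. \<beta> ^ i))))"
      using Suc rate_pos[of "orb n x"] c0 beta
      by (intro mult_left_mono mult_mono exp_ge_add_one_self) auto
    also have "\<dots> = contraction (Suc n) x * dist x y * exp (c * (\<Sum>i<Suc n. \<beta> ^ i))"
      by (simp add: contraction_Suc exp_add algebra_simps)
    finally show ?case by simp
  qed
  also have "\<dots> \<le> contraction n x * dist x y * dist_const"
  proof (rule mult_left_mono)
    have "(\<Sum>i<n. \<beta> ^ i) \<le> 1 / (1 - \<beta>)"
      using beta by (simp add: sum_gp_strict divide_right_mono)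
    then have "c * (\<Sum>i<n. \<beta> ^ i) \<le> c * (1 / (1 - \<beta>))" using c0 by (rule mult_left_mono)
    then show "exp (c * (\<Sum>i<n. \<beta> ^ i)) \<le> dist_const" unfolding dist_const_def c_def[symmetric] by simp
  qed (use contraction_pos[of n x] in simp)
  finally show ?thesis by (simp add: mult.commute mult.assoc mult.left_commute)
qed

text \<open>The displacement after \<open>n\<close> steps, projected to the line field and rescaled so that unit tangent vectors at \<open>x\<close>
keep length one.\<close>

definition coord_n :: "nat \<Rightarrow> 'a \<Rightarrow> 'a \<Rightarrow> 'a \<Rightarrow> real"
  where "coord_n n x u y = (direction n x u \<bullet> (orb n y - orb n x)) / contraction n x"

text \<open>The affine coordinate of the local stable leaf of \<open>x\<close>, normalised at \<open>x\<close>: a change of the base point changes it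
by an affine map, see \<open>stable_coord_cocycle\<close>.\<close>

definition stable_coord :: "'a \<Rightarrow> 'a \<Rightarrow> 'a \<Rightarrow> real"
  where "stable_coord x u y = lim (\<lambda>n. coord_n n x u y)"

definition "step_const = (M + 1) * K * dist_const / g0"

lemma step_const_pos: "0 < step_const" unfolding step_const_def using M_ge K_pos dist_const_pos g0_pos by simp

lemma coord_n_step:
  assumes st: "stable_pair x y" and u: "unit_tangent x u"
  shows "\<bar>coord_n (Suc n) x u y - coord_n n x u y\<bar> \<le> step_const * dist x y powr \<alpha> * dist x y * \<beta> ^ n"
proof -
  let ?X = "orb n x" and ?Y = "orb n y" and ?u = "direction n x u"
  let ?d = "dist ?X ?Y"
  let ?w = "sgn (DG ?X ?u)"
  have st': "stable_pair ?X ?Y" and u': "unit_tangent ?X ?u"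
    using stable_pair_orb[OF st] direction_unit_tangent[OF u] by auto
  let ?v = "G ?Y - G ?X - (rate ?X * (?u \<bullet> (?Y - ?X))) *\<^sub>R ?w"
  have nw: "norm ?w = 1" using unit_tangent_push(1)[OF u'] by (rule unit_tangent_norm)
  then have ww: "?w \<bullet> ?w = 1" by (simp add: norm_eq_1)
  have "?w \<bullet> (G ?Y - G ?X) - rate ?X * (?u \<bullet> (?Y - ?X)) = ?w \<bullet> ?v"
    by (simp add: inner_diff_right ww)
  then have "\<bar>?w \<bullet> (G ?Y - G ?X) - rate ?X * (?u \<bullet> (?Y - ?X))\<bar> = \<bar>?w \<bullet> ?v\<bar>" by (rule arg_cong)
  also have "\<bar>?w \<bullet> ?v\<bar> \<le> norm ?v" by (rule unit_inner_le[OF nw])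
  also have "norm ?v \<le> (M + 1) * (K * ?d powr \<alpha> * ?d)" by (rule push_expansion[OF st' u'])
  also have "\<dots> \<le> (M + 1) * (K * (dist x y powr \<alpha> * \<beta> ^ n) * (dist_const * contraction n x * dist x y))"
    using M_ge K_pos dist_powr_decay[OF st] dist_le_contraction[OF st] beta
    by (intro mult_left_mono mult_mono) auto
  also have "\<dots> = step_const * dist x y powr \<alpha> * dist x y * \<beta> ^ n * (contraction n x * g0)"
    unfolding step_const_def using g0_pos by (simp add: field_simps)
  also have "\<dots> \<le> step_const * dist x y powr \<alpha> * dist x y * \<beta> ^ n * contraction (Suc n) x"
    unfolding contraction_Suc using step_const_pos beta contraction_pos[of n x] rate_ge[of ?X]
    by (intro mult_left_mono) (auto simp: rate_def)
  finally have "\<bar>(?w \<bullet> (G ?Y - G ?X) - rate ?X * (?u \<bullet> (?Y - ?X))) / contraction (Suc n) x\<bar> \<le> step_const * dist x y powr \<alpha> * dist x y * \<beta> ^ n"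
    using contraction_pos[of "Suc n" x] by (simp add: pos_divide_le_eq)
  moreover have "(?w \<bullet> (G ?Y - G ?X) - rate ?X * (?u \<bullet> (?Y - ?X))) / contraction (Suc n) x = coord_n (Suc n) x u y - coord_n n x u y"
    unfolding coord_n_def contraction_Suc using contraction_pos[of n x] rate_pos[of ?X] by (simp add: diff_divide_distrib)
  ultimately show ?thesis by simp
qed

definition "error_const = step_const / (1 - \<beta>)"

lemma error_const_pos: "0 < error_const" unfolding error_const_def using step_const_pos beta by simp

lemma stable_coord_tendsto:
  assumes "stable_pair x y" "unit_tangent x u"
  shows "(\<lambda>n. coord_n n x u y) \<longlonglongrightarrow> stable_coord x u y"
  unfolding stable_coord_def using geometric_steps_converge(1)[OF coord_n_step[OF assms] beta] .

lemma stable_coord_approx: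
  assumes "stable_pair x y" "unit_tangent x u"
  shows "\<bar>stable_coord x u y - coord_n n x u y\<bar> \<le> error_const * dist x y powr \<alpha> * dist x y * \<beta> ^ n"
  using geometric_steps_converge(2)[OF coord_n_step[OF assms] beta, of n]
  unfolding stable_coord_def error_const_def by (simp add: field_simps)

lemma stable_coord_near:
  assumes "stable_pair x y" "unit_tangent x u"
  shows "\<bar>stable_coord x u y - u \<bullet> (y - x)\<bar> \<le> error_const * dist x y powr \<alpha> * dist x y"
  using stable_coord_approx[OF assms, of 0] by (simp add: coord_n_def contraction_0)

text \<open>The logarithm of the factor between the normalisations of the affine coordinate at \<open>y\<close> and at \<open>x\<close>.\<close>

definition log_dens :: "'a \<Rightarrow> 'a \<Rightarrow> real"
  where "log_dens x y = lim (\<lambda>n. ln (contraction n y) - ln (contraction n x))"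

definition "log_dens_const = (1 + 8 * M) * K / g0 / (1 - \<beta>)"

lemma log_dens_const_pos: "0 < log_dens_const" unfolding log_dens_const_def using M_ge K_pos g0_pos beta by simp

lemma log_dens:
  assumes st: "stable_pair x y"
  shows "(\<lambda>n. ln (contraction n y) - ln (contraction n x)) \<longlonglongrightarrow> log_dens x y" "\<bar>log_dens x y\<bar> \<le> log_dens_const * dist x y powr \<alpha>"
proof -
  define B where "B = (1 + 8 * M) * K / g0 * dist x y powr \<alpha>"
  have step: "\<bar>(ln (contraction (Suc n) y) - ln (contraction (Suc n) x)) - (ln (contraction n y) - ln (contraction n x))\<bar> \<le> B * \<beta> ^ n" for n
  proof -
    let ?X = "orb n x" and ?Y = "orb n y"
    have ln_Suc: "ln (contraction (Suc n) z) = ln (contraction n z) + ln (rate (orb n z))" for z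
      unfolding contraction_Suc by (rule ln_mult_pos[OF contraction_pos rate_pos])
    have "\<bar>ln (rate ?Y) - ln (rate ?X)\<bar> \<le> \<bar>rate ?Y - rate ?X\<bar> / g0"
      unfolding rate_def by (rule ln_diff_bound[OF g0_pos rate_ge rate_ge])
    also have "\<dots> \<le> (1 + 8 * M) * (K * dist ?X ?Y powr \<alpha>) / g0"
      using rate_close[OF stable_pair_orb[OF st, of n]] g0_pos by (intro divide_right_mono) (auto simp: abs_minus_commute)
    also have "\<dots> \<le> (1 + 8 * M) * (K * (dist x y powr \<alpha> * \<beta> ^ n)) / g0"
      using M_ge K_pos g0_pos dist_powr_decay[OF st, of n] by (intro divide_right_mono mult_left_mono) auto
    also have "\<dots> = B * \<beta> ^ n" unfolding B_def by simp
    finally show ?thesis unfolding ln_Suc by simp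
  qed
  note conv = geometric_steps_converge[OF step beta]
  show "(\<lambda>n. ln (contraction n y) - ln (contraction n x)) \<longlonglongrightarrow> log_dens x y" unfolding log_dens_def by (rule conv(1))
  show "\<bar>log_dens x y\<bar> \<le> log_dens_const * dist x y powr \<alpha>"
    using conv(2)[of 0] unfolding log_dens_def[symmetric] log_dens_const_def B_def by (simp add: contraction_0)
qed

lemma log_dens_add:
  assumes "stable_pair x y" "stable_pair y z" "stable_pair x z"
  shows "log_dens x z = log_dens x y + log_dens y z"
proof -
  have "(\<lambda>n. (ln (contraction n y) - ln (contraction n x)) + (ln (contraction n z) - ln (contraction n y))) \<longlonglongrightarrow> log_dens x y + log_dens y z"
    using assms by (intro tendsto_add log_dens)
  then have "(\<lambda>n. ln (contraction n z) - ln (contraction n x)) \<longlonglongrightarrow> log_dens x y + log_dens y z" by simp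
  then show ?thesis using log_dens(1)[OF assms(3)] LIMSEQ_unique by blast
qed

text \<open>Late displacements from \<open>y\<close> to \<open>z\<close> are projected to the line at the orbit of \<open>x\<close> on the left and to the line at
the orbit of \<open>y\<close> on the right. These lines approach each other, so only the two normalisations remain different.\<close>

lemma stable_coord_cocycle:
  assumes xy: "stable_pair x y" and yz: "stable_pair y z" and xz: "stable_pair x z"
    and u: "unit_tangent x u" and u': "unit_tangent y u'" and pos: "0 < u \<bullet> u'"
  shows "stable_coord x u z - stable_coord x u y = exp (log_dens x y) * stable_coord y u' z"
proof -
  define D where "D n = (direction n x u - direction n y u') \<bullet> (orb n z - orb n y) / contraction n y" for n
  define R where "R n = exp (ln (contraction n y) - ln (contraction n x))" for n
  have R: "R n = contraction n y / contraction n x" for n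
    unfolding R_def using contraction_pos by (simp add: exp_diff)
  have eq: "coord_n n x u z - coord_n n x u y = R n * (coord_n n y u' z + D n)" for n
    unfolding coord_n_def D_def R using contraction_pos[of n x] contraction_pos[of n y]
    by (simp add: field_simps inner_diff_left inner_diff_right)
  have D: "\<bar>D n\<bar> \<le> 8 * K * dist x y powr \<alpha> * dist_const * dist y z * \<beta> ^ n" for n
  proof -
    have "norm (direction n x u - direction n y u') \<le> 8 * (K * dist (orb n x) (orb n y) powr \<alpha>)"
      using direction_orientation[OF xy u u' pos, of n]
      by (intro stable_tangent_close stable_pair_orb xy direction_unit_tangent u u') simp
    also have "\<dots> \<le> 8 * (K * (dist x y powr \<alpha> * \<beta> ^ n))"
      using K_pos dist_powr_decay[OF xy, of n] by (intro mult_left_mono) auto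
    finally have 1: "norm (direction n x u - direction n y u') \<le> 8 * K * dist x y powr \<alpha> * \<beta> ^ n" by simp
    have "\<bar>(direction n x u - direction n y u') \<bullet> (orb n z - orb n y)\<bar> \<le> norm (direction n x u - direction n y u') * norm (orb n z - orb n y)"
      by (rule Cauchy_Schwarz_ineq2)
    also have "\<dots> \<le> (8 * K * dist x y powr \<alpha> * \<beta> ^ n) * (dist_const * contraction n y * dist y z)"
      using 1 dist_le_contraction[OF yz, of n] K_pos beta
      by (intro mult_mono) (auto simp: dist_norm norm_minus_commute)
    finally show ?thesis unfolding D_def abs_divide using contraction_pos[of n y]
      by (simp add: pos_divide_le_eq algebra_simps)
  qed
  have "D \<longlonglongrightarrow> 0"
  proof (rule Lim_null_comparison)
    show "\<forall>\<^sub>F n in sequentially. norm (D n) \<le> 8 * K * dist x y powr \<alpha> * dist_const * dist y z * \<beta> ^ n"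
      using D by simp
    have "(\<lambda>n. 8 * K * dist x y powr \<alpha> * dist_const * dist y z * \<beta> ^ n) \<longlonglongrightarrow> 8 * K * dist x y powr \<alpha> * dist_const * dist y z * 0"
      using beta by (intro tendsto_intros LIMSEQ_power_zero) auto
    then show "(\<lambda>n. 8 * K * dist x y powr \<alpha> * dist_const * dist y z * \<beta> ^ n) \<longlonglongrightarrow> 0" by simp
  qed
  then have "(\<lambda>n. R n * (coord_n n y u' z + D n)) \<longlonglongrightarrow> exp (log_dens x y) * (stable_coord y u' z + 0)"
    unfolding R_def by (intro tendsto_intros log_dens xy stable_coord_tendsto yz u')
  moreover have "(\<lambda>n. coord_n n x u z - coord_n n x u y) \<longlonglongrightarrow> stable_coord x u z - stable_coord x u y"
    by (intro tendsto_intros stable_coord_tendsto xy xz u)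
  ultimately show ?thesis unfolding eq using LIMSEQ_unique by force
qed

lemma orb_continuous: "continuous_on UNIV (orb n)"
proof (induction n)
  case (Suc n)
  have "continuous_on UNIV G" using has_derivative_continuous[OF deriv] by (auto simp: continuous_on_eq_continuous_at)
  from continuous_on_compose2[OF this Suc] show ?case by (simp add: o_def)
qed simp

lemma orb_tendsto: "(f \<longlongrightarrow> x) F \<Longrightarrow> ((\<lambda>k. orb n (f k)) \<longlongrightarrow> orb n x) F"
  using orb_continuous[of n] by (rule continuous_on_tendsto_compose) auto

lemma DG_tendsto: 
  assumes "(f \<longlongrightarrow> x) F" shows "((\<lambda>k. DG (f k)) \<longlongrightarrow> DG x) F"
proof -
  have "((\<lambda>k. K * dist (f k) x powr \<alpha>) \<longlongrightarrow> K * dist x x powr \<alpha>) F"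
    using assms alpha_pos by (intro tendsto_intros) auto
  then have "((\<lambda>k. K * dist (f k) x powr \<alpha>) \<longlongrightarrow> 0) F" using alpha_pos by simp
  from Lim_null_comparison[OF _ this, of "\<lambda>k. DG (f k) - DG x"] hoelder
  show ?thesis by (subst LIM_zero_iff[symmetric]) simp
qed

lemma direction_tendsto:
  assumes "(f \<longlongrightarrow> x) F" "(U \<longlongrightarrow> u) F" "unit_tangent x u"
  shows "((\<lambda>k. direction n (f k) (U k)) \<longlongrightarrow> direction n x u) F"
proof (induction n)
  case (Suc n)
  have "DG (orb n x) (direction n x u) \<noteq> 0"
    using unit_tangent_rate[OF direction_unit_tangent[OF assms(3)], of n] rate_pos[of "orb n x"] by auto
  moreover have "((\<lambda>k. DG (orb n (f k)) (direction n (f k) (U k))) \<longlongrightarrow> DG (orb n x) (direction n x u)) F"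
    by (intro blinfun.tendsto DG_tendsto orb_tendsto assms Suc)
  ultimately show ?case by (auto intro: tendsto_sgn)
qed (use assms in simp)

lemma contraction_tendsto:
  assumes f: "(f \<longlongrightarrow> x) F" "(U \<longlongrightarrow> u) F" and u: "unit_tangent x u" "\<And>k. unit_tangent (f k) (U k)"
  shows "((\<lambda>k. contraction n (f k)) \<longlongrightarrow> contraction n x) F"
proof -
  have "((\<lambda>k. norm (DG (orb i (f k)) (direction i (f k) (U k)))) \<longlongrightarrow> norm (DG (orb i x) (direction i x u))) F" for i
    by (intro tendsto_norm blinfun.tendsto DG_tendsto orb_tendsto direction_tendsto f u)
  then have "((\<lambda>k. rate (orb i (f k))) \<longlongrightarrow> rate (orb i x)) F" for i
    using unit_tangent_rate[OF direction_unit_tangent] u by simp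
  then show ?thesis unfolding contraction_def by (intro tendsto_prod)
qed

text \<open>Each approximation is continuous in the points, and by \<open>stable_coord_approx\<close> the approximations converge uniformly
over all stable pairs.\<close>

lemma stable_coord_tendsto_along:
  assumes f: "f \<longlonglongrightarrow> x" "U \<longlonglongrightarrow> u" "g \<longlonglongrightarrow> y" and u: "unit_tangent x u" "\<And>k. unit_tangent (f k) (U k)"
    and st: "\<And>k. stable_pair (f k) (g k)" "stable_pair x y"
  shows "(\<lambda>k. stable_coord (f k) (U k) (g k)) \<longlonglongrightarrow> stable_coord x u y"
proof (rule swap_uniform_limit'[where F = sequentially and S = UNIV])
  show "\<forall>\<^sub>F n in sequentially. (\<lambda>k. coord_n n (f k) (U k) (g k)) \<longlonglongrightarrow> coord_n n x u y"
    unfolding coord_n_def using contraction_pos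
    by (intro always_eventually allI tendsto_divide tendsto_inner tendsto_diff orb_tendsto direction_tendsto contraction_tendsto[OF f(1,2) u] f u)
      (auto simp: less_le)
  show "(\<lambda>n. coord_n n x u y) \<longlonglongrightarrow> stable_coord x u y" using st u by (intro stable_coord_tendsto)
  show "uniform_limit UNIV (\<lambda>n k. coord_n n (f k) (U k) (g k)) (\<lambda>k. stable_coord (f k) (U k) (g k)) sequentially"
  proof (rule uniform_limitI)
    fix r :: real assume "0 < r"
    have "(\<lambda>n. error_const * \<epsilon> powr \<alpha> * \<epsilon> * \<beta> ^ n) \<longlonglongrightarrow> error_const * \<epsilon> powr \<alpha> * \<epsilon> * 0"
      using beta by (intro tendsto_intros LIMSEQ_power_zero) auto
    then have "\<forall>\<^sub>F n in sequentially. error_const * \<epsilon> powr \<alpha> * \<epsilon> * \<beta> ^ n < r"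
      using \<open>0 < r\<close> by (intro order_tendstoD) auto
    then show "\<forall>\<^sub>F n in sequentially. \<forall>k\<in>UNIV. dist (coord_n n (f k) (U k) (g k)) (stable_coord (f k) (U k) (g k)) < r"
    proof eventually_elim
      case (elim n)
      have "dist (coord_n n (f k) (U k) (g k)) (stable_coord (f k) (U k) (g k)) \<le> error_const * dist (f k) (g k) powr \<alpha> * dist (f k) (g k) * \<beta> ^ n" for k
        using stable_coord_approx[OF st(1) u(2), of k n] by (simp add: dist_real_def abs_minus_commute)
      also have "\<dots> k \<le> error_const * \<epsilon> powr \<alpha> * \<epsilon> * \<beta> ^ n" for k
        using stable_pair_dist[OF st(1)[of k]] error_const_pos beta alpha_pos eps_pos
        by (intro mult_right_mono mult_mono powr_mono2) auto
      finally show ?case using elim by (auto intro: le_less_trans)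
    qed
  qed
qed auto

text \<open>From time \<open>m\<close> on, displacements from the orbits of \<open>x'\<close> and of \<open>x\<close> coincide. The approximations of the two
coordinates then differ by a factor that is the same for all end points, so the ratio of two coordinates is the
same at \<open>x'\<close> and at \<open>x\<close>. Absolute values appear because the orientations \<open>u\<close> and \<open>u'\<close> are unrelated.\<close>

lemma stable_coord_cross_ratio:
  assumes u: "unit_tangent x u" "unit_tangent x' u'"
    and st: "stable_pair x y" "stable_pair x z" "stable_pair x' y'" "stable_pair x' z'"
    and merge: "\<And>n. n \<ge> m \<Longrightarrow> orb n y' - orb n x' = orb n y - orb n x"
      "\<And>n. n \<ge> m \<Longrightarrow> orb n z' - orb n x' = orb n z - orb n x"
      "\<And>n. n \<ge> m \<Longrightarrow> e (orb n x') = e (orb n x)"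
  shows "\<bar>stable_coord x' u' y'\<bar> * \<bar>stable_coord x u z\<bar> = \<bar>stable_coord x' u' z'\<bar> * \<bar>stable_coord x u y\<bar>"
proof (rule LIMSEQ_unique)
  show "(\<lambda>n. \<bar>coord_n n x' u' y'\<bar> * \<bar>coord_n n x u z\<bar>) \<longlonglongrightarrow> \<bar>stable_coord x' u' y'\<bar> * \<bar>stable_coord x u z\<bar>"
    by (intro tendsto_intros stable_coord_tendsto st u)
  have R: "(\<lambda>n. \<bar>coord_n n x' u' z'\<bar> * \<bar>coord_n n x u y\<bar>) \<longlonglongrightarrow> \<bar>stable_coord x' u' z'\<bar> * \<bar>stable_coord x u y\<bar>"
    by (intro tendsto_intros stable_coord_tendsto st u)
  have "\<bar>coord_n n x' u' z'\<bar> * \<bar>coord_n n x u y\<bar> = \<bar>coord_n n x' u' y'\<bar> * \<bar>coord_n n x u z\<bar>" if "n \<ge> m" for n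
  proof -
    have "direction n x' u' = direction n x u \<or> direction n x' u' = - direction n x u"
      using direction_unit_tangent[OF u(1), of n] direction_unit_tangent[OF u(2), of n] merge(3)[OF that]
      unfolding unit_tangent_def by auto
    then have "\<bar>direction n x' u' \<bullet> w\<bar> = \<bar>direction n x u \<bullet> w\<bar>" for w by auto
    then show ?thesis unfolding coord_n_def abs_divide merge(1,2)[OF that] by simp
  qed
  then show "(\<lambda>n. \<bar>coord_n n x' u' y'\<bar> * \<bar>coord_n n x u z\<bar>) \<longlonglongrightarrow> \<bar>stable_coord x' u' z'\<bar> * \<bar>stable_coord x u y\<bar>"
    by (intro Lim_transform_eventually[OF R] eventually_sequentiallyI[of m])
qed

end

section \<open>The functional equation of an affine one-parameter group\<close>

lemma Hoelder_imp_continuous_on: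
  fixes g :: "'a::metric_space \<Rightarrow> 'b::real_normed_vector"
  assumes \<alpha>: "0 < \<alpha>" and g: "\<And>s t. s \<in> S \<Longrightarrow> t \<in> S \<Longrightarrow> norm (g s - g t) \<le> c * dist s t powr \<alpha>"
  shows "continuous_on S g"
  unfolding continuous_on_def
proof
  fix t assume t: "t \<in> S"
  have "((\<lambda>s. c * dist s t powr \<alpha>) \<longlongrightarrow> c * dist t t powr \<alpha>) (at t within S)"
    using \<alpha> by (intro tendsto_intros) auto
  then have "((\<lambda>s. c * dist s t powr \<alpha>) \<longlongrightarrow> 0) (at t within S)" using \<alpha> by simp
  from Lim_null_comparison[OF _ this, of "\<lambda>s. g s - g t"] g[OF _ t]
  have "((\<lambda>s. g s - g t) \<longlongrightarrow> 0) (at t within S)" by (simp add: eventually_at_filter)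
  then show "(g \<longlongrightarrow> g t) (at t within S)" by (rule LIM_zero_cancel)
qed

lemma superlinear_has_derivative_0:
  fixes R :: "real \<Rightarrow> real"
  assumes "0 < \<alpha>" and R: "\<And>s. s \<in> S \<Longrightarrow> \<bar>R s\<bar> \<le> c * \<bar>s - t\<bar> powr \<alpha> * \<bar>s - t\<bar>" and t: "t \<in> S"
  shows "(R has_real_derivative 0) (at t within S)"
proof -
  have R0: "R t = 0" using R[OF t] by simp
  have "((\<lambda>s. c * \<bar>s - t\<bar> powr \<alpha>) \<longlongrightarrow> c * \<bar>t - t\<bar> powr \<alpha>) (at t within S)"
    using assms(1) by (intro tendsto_intros) auto
  then have lim: "((\<lambda>s. c * \<bar>s - t\<bar> powr \<alpha>) \<longlongrightarrow> 0) (at t within S)" using assms(1) by simp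
  have "((\<lambda>s. (R s - R t) / (s - t)) \<longlongrightarrow> 0) (at t within S)"
  proof (rule Lim_null_comparison[OF _ lim])
    show "\<forall>\<^sub>F s in at t within S. norm ((R s - R t) / (s - t)) \<le> c * \<bar>s - t\<bar> powr \<alpha>"
      unfolding eventually_at_filter
    proof (intro always_eventually allI impI)
      fix s assume "s \<noteq> t" "s \<in> S"
      then show "norm ((R s - R t) / (s - t)) \<le> c * \<bar>s - t\<bar> powr \<alpha>"
        using R[of s] R0 by (simp add: pos_divide_le_eq)
    qed
  qed
  then show ?thesis by (simp add: has_field_derivative_iff)
qed

text \<open>The chain rule read backwards: the difference quotient of \<open>\<sigma>\<close> is the quotient of those of \<open>P\<close> and \<open>U\<close>.\<close>

lemma factor_has_derivative:
  fixes \<sigma> P U :: "real \<Rightarrow> real"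
  assumes P: "(P has_real_derivative p) (at t within T)" and PU: "\<And>s. s \<in> T \<Longrightarrow> P s = U (\<sigma> s)"
    and U: "(U has_real_derivative d) (at (\<sigma> t) within \<sigma> ` T)" and d: "d \<noteq> 0"
    and cont: "continuous (at t within T) \<sigma>" and inj: "inj_on \<sigma> T" "inj_on U (\<sigma> ` T)" and t: "t \<in> T"
  shows "(\<sigma> has_real_derivative p / d) (at t within T)"
proof -
  have 1: "((\<lambda>s. (P s - P t) / (s - t)) \<longlongrightarrow> p) (at t within T)" using P by (simp add: has_field_derivative_iff)
  have 2: "((\<lambda>y. (U y - U (\<sigma> t)) / (y - \<sigma> t)) \<longlongrightarrow> d) (at (\<sigma> t) within \<sigma> ` T)"
    using U by (simp add: has_field_derivative_iff)
  have ne: "\<forall>\<^sub>F s in at t within T. s \<in> T \<and> \<sigma> s \<noteq> \<sigma> t"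
    unfolding eventually_at_filter using inj t by (intro always_eventually) (auto dest: inj_onD)
  have 3: "filterlim \<sigma> (at (\<sigma> t) within \<sigma> ` T) (at t within T)"
    unfolding filterlim_at using cont ne by (auto simp: continuous_within elim: eventually_mono)
  have "((\<lambda>s. ((P s - P t) / (s - t)) / ((U (\<sigma> s) - U (\<sigma> t)) / (\<sigma> s - \<sigma> t))) \<longlongrightarrow> p / d) (at t within T)"
    using filterlim_compose[OF 2 3] by (intro tendsto_divide 1 d) 
  then have "((\<lambda>s. (\<sigma> s - \<sigma> t) / (s - t)) \<longlongrightarrow> p / d) (at t within T)"
  proof (rule Lim_transform_eventually)
    show "\<forall>\<^sub>F s in at t within T. ((P s - P t) / (s - t)) / ((U (\<sigma> s) - U (\<sigma> t)) / (\<sigma> s - \<sigma> t)) = (\<sigma> s - \<sigma> t) / (s - t)"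
      using ne
    proof eventually_elim
      case (elim s)
      then have "U (\<sigma> s) \<noteq> U (\<sigma> t)" using inj(2) t by (auto dest: inj_onD)
      then show ?case using elim t PU by simp
    qed
  qed
  then show ?thesis by (simp add: has_field_derivative_iff)
qed

text \<open>The hypothesis amounts to \<open>U (x + s) = U s + A s * U x\<close> with a positive function \<open>A\<close>. Integration over \<open>s\<close> in
\<open>{0..\<eta>}\<close> expresses \<open>U x\<close> through integrals of \<open>U\<close>, which are differentiable in \<open>x\<close>. The coefficient of \<open>U x\<close> in
the integrated equation is the integral \<open>I\<close> of \<open>A\<close>, hence positive.\<close>

lemma cross_ratio_invariant_derivative:
  fixes U :: "real \<Rightarrow> real"
  assumes S: "0 < \<eta>" "\<eta> < S" and cont: "continuous_on {0..S} U" and mono: "strict_mono_on {0..S} U" and U0: "U 0 = 0"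
    and cross: "\<And>x y s. 0 \<le> x \<Longrightarrow> 0 \<le> y \<Longrightarrow> 0 \<le> s \<Longrightarrow> x + s \<le> S \<Longrightarrow> y + s \<le> S \<Longrightarrow>
      (U (x + s) - U s) * U y = (U (y + s) - U s) * U x"
  obtains I where "0 < I" "\<And>x. x \<in> {0..S-\<eta>} \<Longrightarrow> (U has_real_derivative (U (x + \<eta>) - U x) / I) (at x within {0..S-\<eta>})"
proof -
  define V where "V x = integral {0..x} U" for x
  have V: "(V has_real_derivative U x) (at x within {0..S})" if "x \<in> {0..S}" for x
    unfolding V_def using integral_has_real_derivative[OF cont that] .
  have intU: "U integrable_on {x..y}" if "0 \<le> x" "y \<le> S" for x y
    by (rule integrable_continuous_real, rule continuous_on_subset[OF cont]) (use that in auto)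
  \<comment> \<open>the largest argument that every shift by at most \<open>\<eta>\<close> keeps in the domain\<close>
  define y where "y = S - \<eta>"
  have y: "0 < y" "y + \<eta> = S" "y \<le> S" unfolding y_def using S by auto
  have Uy: "0 < U y" using strict_mono_onD[OF mono, of 0 y] y U0 by simp
  define A where "A s = (U (y + s) - U s) / U y" for s
  have contA: "continuous_on {0..\<eta>} A"
    unfolding A_def using y S Uy
    by (intro continuous_intros continuous_on_compose2[OF cont]) auto
  have A: "U (x + s) = U s + A s * U x" if "0 \<le> x" "x \<le> y" "0 \<le> s" "s \<le> \<eta>" for x s
    using cross[of x y s] that y Uy unfolding A_def by (simp add: field_simps)
  have Apos: "0 < A s" if "0 \<le> s" "s \<le> \<eta>" for s
    unfolding A_def using strict_mono_onD[OF mono, of s "y + s"] that y Uy by simp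
  define I where "I = integral {0..\<eta>} A"
  have intA: "A integrable_on {0..\<eta>}" using contA by (rule integrable_continuous_real)
  have I: "0 < I"
  proof -
    obtain s0 where s0: "s0 \<in> {0..\<eta>}" "\<And>s. s \<in> {0..\<eta>} \<Longrightarrow> A s0 \<le> A s"
      using continuous_attains_inf[OF _ _ contA] S by auto
    have "0 < \<eta> * A s0" using Apos[of s0] s0 S by simp
    also have "\<dots> = integral {0..\<eta>} (\<lambda>_. A s0)" using S by simp
    also have "\<dots> \<le> I" unfolding I_def using s0 by (intro integral_le intA) auto
    finally show ?thesis .
  qed
  \<comment> \<open>the functional equation integrated over the shift; its right-hand side is differentiable in \<open>x\<close>\<close>
  have eq: "U x = (V (x + \<eta>) - V x - V \<eta>) / I" if "x \<in> {0..S - \<eta>}" for x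
  proof -
    have x: "0 \<le> x" "x \<le> y" using that unfolding y_def by auto
    have "V (x + \<eta>) - V x = integral {x..x + \<eta>} U"
      unfolding V_def using Henstock_Kurzweil_Integration.integral_combine[of 0 x "x + \<eta>" U] intU[of 0 "x + \<eta>"] x y S by simp
    also have "\<dots> = integral {0..\<eta>} (\<lambda>s. U (x + s))"
      using integral_shift_real_ivl[of x x "x + \<eta>" U] by (simp add: add.commute)
    also have "\<dots> = integral {0..\<eta>} (\<lambda>s. U s + A s * U x)"
      using A x by (intro Henstock_Kurzweil_Integration.integral_cong) auto
    also have "\<dots> = V \<eta> + I * U x"
      unfolding V_def I_def using intU[of 0 \<eta>] intA S y
      by (subst Henstock_Kurzweil_Integration.integral_add) (auto intro: integrable_on_mult_left)
    finally show ?thesis using I by (simp add: field_simps)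
  qed
  have "(U has_real_derivative (U (x + \<eta>) - U x) / I) (at x within {0..S-\<eta>})" if x: "x \<in> {0..S - \<eta>}" for x
  proof -
    have 1: "((\<lambda>x. V (x + \<eta>)) has_real_derivative U (x + \<eta>)) (at x within {0..S-\<eta>})"
    proof -
      have "(V has_real_derivative U (x + \<eta>)) (at (x + \<eta>) within (\<lambda>x. x + \<eta>) ` {0..S - \<eta>})"
        by (rule DERIV_subset[OF V]) (use x S in auto)
      moreover have "((\<lambda>x. x + \<eta>) has_real_derivative 1) (at x within {0..S - \<eta>})"
        by (auto intro!: derivative_eq_intros)
      ultimately show ?thesis using DERIV_image_chain by (fastforce simp: o_def)
    qed
    have 2: "(V has_real_derivative U x) (at x within {0..S-\<eta>})"
      by (rule DERIV_subset[OF V]) (use x S in auto)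
    have "((\<lambda>x. (V (x + \<eta>) - V x - V \<eta>) / I) has_real_derivative (U (x + \<eta>) - U x) / I) (at x within {0..S-\<eta>})"
      using 1 2 by (auto intro!: derivative_eq_intros simp: less_imp_neq[OF I, symmetric])
    then show ?thesis
      by (rule has_field_derivative_transform_within[OF _ zero_less_one x]) (use eq in auto)
  qed
  with I show thesis using that by blast
qed

text \<open>The last hypothesis says that translations in the parameter \<open>\<sigma>\<close> are affine in the coordinate \<open>P\<close>. Writing
\<open>P = U \<circ> \<sigma>\<close>, the function \<open>U\<close> is differentiable by \<open>cross_ratio_invariant_derivative\<close>, so \<open>\<sigma>\<close> has the
derivative \<open>\<rho> / (U' \<circ> \<sigma>)\<close>, where \<open>U' \<circ> \<sigma>\<close> is Lipschitz. The end point \<open>b\<close> itself is not reached, because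
the formula for \<open>U'\<close> at one parameter value involves \<open>U\<close> at a later one.\<close>

lemma reparametrization_C1_Hoelder:
  fixes \<sigma> P \<rho> :: "real \<Rightarrow> real"
  assumes m: "a \<le> m" "m < b" and \<alpha>: "0 < \<alpha>" "\<alpha> < 1"
    and \<sigma>: "continuous_on {a..b} \<sigma>" "strict_mono_on {a..b} \<sigma>" "\<sigma> a = 0"
    and P: "\<And>t. t \<in> {a..b} \<Longrightarrow> (P has_real_derivative \<rho> t) (at t within {a..b})" "P a = 0"
    and \<rho>: "\<And>t. t \<in> {a..b} \<Longrightarrow> 0 < \<rho> t" "\<And>s t. s \<in> {a..b} \<Longrightarrow> t \<in> {a..b} \<Longrightarrow> \<bar>\<rho> s - \<rho> t\<bar> \<le> L * \<bar>s - t\<bar> powr \<alpha>"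
    and cross: "\<And>s t t' q q'. s \<in> {a..b} \<Longrightarrow> t \<in> {a..b} \<Longrightarrow> t' \<in> {a..b} \<Longrightarrow> q \<in> {a..b} \<Longrightarrow> q' \<in> {a..b} \<Longrightarrow>
       \<sigma> q = \<sigma> t + \<sigma> s \<Longrightarrow> \<sigma> q' = \<sigma> t' + \<sigma> s \<Longrightarrow> (P q - P s) * P t' = (P q' - P s) * P t"
  obtains D c where "\<And>t. t \<in> {a..m} \<Longrightarrow> (\<sigma> has_real_derivative D t) (at t within {a..m})"
    "\<And>s t. s \<in> {a..m} \<Longrightarrow> t \<in> {a..m} \<Longrightarrow> \<bar>D s - D t\<bar> \<le> c * \<bar>s - t\<bar> powr \<alpha>"
proof -
  have ab: "a < b" using m by simp
  have injs: "inj_on \<sigma> {a..b}" using \<sigma>(2) strict_mono_on_imp_inj_on by blast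
  have sigma_mono: "\<sigma> s \<le> \<sigma> t" if "s \<in> {a..b}" "t \<in> {a..b}" "s \<le> t" for s t
    using strict_mono_onD[OF \<sigma>(2) that(1,2)] that(3) by (cases "s = t") auto
  define S where "S = \<sigma> b"
  define \<kappa> where "\<kappa> = the_inv_into {a..b} \<sigma>"
  have img: "\<sigma> ` {a..b} = {0..S}"
  proof
    show "\<sigma> ` {a..b} \<subseteq> {0..S}" unfolding S_def \<sigma>(3)[symmetric] using sigma_mono ab by auto
    show "{0..S} \<subseteq> \<sigma> ` {a..b}" 
      using IVT'[of \<sigma> a _ b] \<sigma>(1,3) ab unfolding S_def by fastforce
  qed
  have k1: "\<kappa> (\<sigma> t) = t" if "t \<in> {a..b}" for t
    unfolding \<kappa>_def using the_inv_into_f_f[OF injs that] .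
  have k2: "\<kappa> y \<in> {a..b}" "\<sigma> (\<kappa> y) = y" if "y \<in> {0..S}" for y
    using that unfolding img[symmetric] by (auto simp: k1)
  have k3: "continuous_on {0..S} \<kappa>"
    using continuous_on_inv[OF \<sigma>(1), of \<kappa>] k1 unfolding img by auto
  have contP: "continuous_on {a..b} P" using P(1) DERIV_continuous continuous_on_eq_continuous_within by blast
  have monoP: "P s < P t" if "s \<in> {a..b}" "t \<in> {a..b}" "s < t" for s t
  proof (rule DERIV_pos_imp_increasing_open[OF that(3)])
    fix x assume x: "s < x" "x < t"
    have "(P has_real_derivative \<rho> x) (at x)" using P(1)[of x] x that at_within_Icc_at[of a x b] by auto
    then show "\<exists>y. (P has_real_derivative y) (at x) \<and> 0 < y" using \<rho>(1)[of x] x that by auto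
  qed (rule continuous_on_subset[OF contP], use that in auto)
  define U where "U y = P (\<kappa> y)" for y
  have U0: "U 0 = 0" unfolding U_def using k1[of a] \<sigma>(3) P(2) ab by simp
  have contU: "continuous_on {0..S} U"
    unfolding U_def by (rule continuous_on_compose2[OF contP k3]) (use k2 in auto)
  have monoU: "strict_mono_on {0..S} U"
  proof (rule strict_mono_onI)
    fix x y assume xy: "x \<in> {0..S}" "y \<in> {0..S}" "x < y"
    have "\<kappa> x < \<kappa> y"
    proof (rule ccontr)
      assume "\<not> \<kappa> x < \<kappa> y"
      then have "\<sigma> (\<kappa> y) \<le> \<sigma> (\<kappa> x)" using k2 xy by (intro sigma_mono) auto
      then show False using k2 xy by simp
    qed
    then show "U x < U y" unfolding U_def using k2 xy by (intro monoP) auto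
  qed
  have sm: "0 \<le> \<sigma> m" "\<sigma> m < S" 
    using sigma_mono[of a m] strict_mono_onD[OF \<sigma>(2), of m b] m \<sigma>(3) unfolding S_def by auto
  \<comment> \<open>half of the available room, so that \<open>U\<close> is differentiable also at the shifted points\<close>
  define \<eta> where "\<eta> = (S - \<sigma> m) / 2"
  have \<eta>: "0 < \<eta>" "\<eta> < S" "\<sigma> m + \<eta> = S - \<eta>" unfolding \<eta>_def using sm by (auto simp: field_simps)
  have crossU: "(U (x + s) - U s) * U y = (U (y + s) - U s) * U x"
    if "0 \<le> x" "0 \<le> y" "0 \<le> s" "x + s \<le> S" "y + s \<le> S" for x y s
    unfolding U_def using that by (intro cross k2(1)) (auto simp: k2)
  obtain I where I: "0 < I" and dU: "\<And>x. x \<in> {0..S-\<eta>} \<Longrightarrow> (U has_real_derivative (U (x + \<eta>) - U x) / I) (at x within {0..S-\<eta>})"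
    using cross_ratio_invariant_derivative[OF \<eta>(1,2) contU monoU U0 crossU] by blast
  define d where "d x = (U (x + \<eta>) - U x) / I" for x
  define D where "D t = \<rho> t / d (\<sigma> t)" for t
  have sub: "{a..m} \<subseteq> {a..b}" using m by auto
  have st: "\<sigma> t \<in> {0..\<sigma> m}" if "t \<in> {a..m}" for t
    using sigma_mono[of a t] sigma_mono[of t m] that m \<sigma>(3) by auto
  have dpos: "0 < d x" if "x \<in> {0..\<sigma> m}" for x
    unfolding d_def using strict_mono_onD[OF monoU, of x "x + \<eta>"] that \<eta> I by auto
  have deriv: "(\<sigma> has_real_derivative D t) (at t within {a..m})" if t: "t \<in> {a..m}" for t
    unfolding D_def
  proof (rule factor_has_derivative)
    show "(P has_real_derivative \<rho> t) (at t within {a..m})" by (rule DERIV_subset[OF P(1) sub]) (use t m in auto)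
    show "P s = U (\<sigma> s)" if "s \<in> {a..m}" for s unfolding U_def using k1[of s] that m by simp
    have i: "\<sigma> ` {a..m} \<subseteq> {0..S-\<eta>}" using st \<eta> by fastforce
    show "(U has_real_derivative d (\<sigma> t)) (at (\<sigma> t) within \<sigma> ` {a..m})"
      unfolding d_def by (rule DERIV_subset[OF dU i]) (use st[OF t] \<eta> in auto)
    show "d (\<sigma> t) \<noteq> 0" using dpos[OF st[OF t]] by simp
    show "continuous (at t within {a..m}) \<sigma>"
      using continuous_on_subset[OF \<sigma>(1) sub] t by (simp add: continuous_on_eq_continuous_within)
    show "inj_on \<sigma> {a..m}" using injs sub by (rule inj_on_subset)
    show "inj_on U (\<sigma> ` {a..m})"
      using strict_mono_on_imp_inj_on[OF monoU] by (rule inj_on_subset) (use i \<eta> in auto)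
  qed (use t in auto)
  have contd: "continuous_on {0..\<sigma> m} d"
    unfolding d_def using \<eta> I by (intro continuous_intros continuous_on_compose2[OF contU]) auto
  obtain x0 where x0: "x0 \<in> {0..\<sigma> m}" "\<And>x. x \<in> {0..\<sigma> m} \<Longrightarrow> d x0 \<le> d x"
    using continuous_attains_inf[OF _ _ contd] sm by auto
  define d0 where "d0 = d x0"
  have d0: "0 < d0" unfolding d0_def using dpos x0 by simp
  have dge: "d0 \<le> d (\<sigma> t)" if "t \<in> {a..m}" for t unfolding d0_def using x0 st[OF that] by simp
  have cr: "continuous_on {a..m} \<rho>"
    using \<rho>(2) sub by (intro Hoelder_imp_continuous_on[OF \<alpha>(1), of _ _ L]) (auto simp: dist_real_def)
  obtain B where "\<forall>x\<in>\<rho> ` {a..m}. norm x \<le> B"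
    using compact_imp_bounded[OF compact_continuous_image[OF cr compact_Icc]] unfolding bounded_iff by blast
  then have B: "\<bar>\<rho> t\<bar> \<le> B" if "t \<in> {a..m}" for t using that by auto
  have B0: "0 \<le> B" using B[of a] m by simp
  obtain BU where "\<forall>x\<in>U ` {0..S}. norm x \<le> BU"
    using compact_imp_bounded[OF compact_continuous_image[OF contU compact_Icc]] unfolding bounded_iff by blast
  then have BU: "\<bar>U y\<bar> \<le> BU" if "y \<in> {0..S}" for y using that by auto
  have BU0: "0 \<le> BU" using BU[of 0] sm by simp
  have lipU: "\<bar>U x - U y\<bar> \<le> 2 * BU / I * \<bar>x - y\<bar>" if "x \<in> {0..S-\<eta>}" "y \<in> {0..S-\<eta>}" for x y
  proof -
    have "norm (U x - U y) \<le> 2 * BU / I * norm (x - y)"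
    proof (rule field_differentiable_bound[where S = "{0..S-\<eta>}"])
      fix z assume z: "z \<in> {0..S-\<eta>}"
      show "(U has_real_derivative (U (z + \<eta>) - U z) / I) (at z within {0..S-\<eta>})" by (rule dU[OF z])
      have "\<bar>U (z + \<eta>)\<bar> \<le> BU" "\<bar>U z\<bar> \<le> BU" using z \<eta> by (auto intro!: BU)
      then have "\<bar>U (z + \<eta>) - U z\<bar> \<le> 2 * BU" by linarith
      then show "norm ((U (z + \<eta>) - U z) / I) \<le> 2 * BU / I" using I by (simp add: divide_right_mono)
    qed (use that in auto)
    then show ?thesis by simp
  qed
  have Dle: "\<bar>D t\<bar> \<le> B / d0" if "t \<in> {a..m}" for t
    unfolding D_def abs_divide using B[OF that] dge[OF that] d0 B0 by (intro frac_le) auto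
  have lips: "\<bar>\<sigma> s - \<sigma> t\<bar> \<le> B / d0 * \<bar>s - t\<bar>" if "s \<in> {a..m}" "t \<in> {a..m}" for s t
    using field_differentiable_bound[of "{a..m}" \<sigma> D "B / d0" s t] deriv Dle that by auto
  define c' where "c' = (2 * BU / I + 2 * BU / I) / I * (B / d0)"
  have c'0: "0 \<le> c'" unfolding c'_def using BU0 I B0 d0 by simp
  have lipd: "\<bar>d (\<sigma> s) - d (\<sigma> t)\<bar> \<le> c' * \<bar>s - t\<bar>" if s: "s \<in> {a..m}" and t: "t \<in> {a..m}" for s t
  proof -
    have in1: "\<sigma> s \<in> {0..S-\<eta>}" "\<sigma> t \<in> {0..S-\<eta>}" "\<sigma> s + \<eta> \<in> {0..S-\<eta>}" "\<sigma> t + \<eta> \<in> {0..S-\<eta>}"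
      using st[OF s] st[OF t] \<eta> by auto
    have "d (\<sigma> s) - d (\<sigma> t) = ((U (\<sigma> s + \<eta>) - U (\<sigma> t + \<eta>)) - (U (\<sigma> s) - U (\<sigma> t))) / I"
      unfolding d_def by (simp add: diff_divide_distrib)
    also have "\<bar>\<dots>\<bar> \<le> (2 * BU / I * \<bar>\<sigma> s - \<sigma> t\<bar> + 2 * BU / I * \<bar>\<sigma> s - \<sigma> t\<bar>) / I"
      unfolding abs_divide using lipU[OF in1(3,4)] lipU[OF in1(1,2)] I
      by (intro frac_le) auto
    also have "\<dots> = (2 * BU / I + 2 * BU / I) / I * \<bar>\<sigma> s - \<sigma> t\<bar>" by (simp add: add_divide_distrib ring_distribs)
    also have "\<dots> \<le> (2 * BU / I + 2 * BU / I) / I * (B / d0 * \<bar>s - t\<bar>)"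
      using lips[OF s t] BU0 I by (intro mult_left_mono) auto
    finally show ?thesis unfolding c'_def by simp
  qed
  \<comment> \<open>the quotient rule for Hoelder constants; the Lipschitz denominator is converted to exponent \<open>\<alpha>\<close> on \<open>{a..b}\<close>\<close>
  define c where "c = L / d0 + B * c' * (b - a) powr (1 - \<alpha>) / d0\<^sup>2"
  have "\<bar>D s - D t\<bar> \<le> c * \<bar>s - t\<bar> powr \<alpha>" if s: "s \<in> {a..m}" and t: "t \<in> {a..m}" for s t
  proof -
    define ds dt where "ds = d (\<sigma> s)" and "dt = d (\<sigma> t)"
    have dd: "d0 \<le> ds" "d0 \<le> dt" unfolding ds_def dt_def using dge s t by auto
    have "\<bar>s - t\<bar> = \<bar>s - t\<bar> powr \<alpha> * \<bar>s - t\<bar> powr (1 - \<alpha>)" by (simp flip: powr_add)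
    also have "\<dots> \<le> \<bar>s - t\<bar> powr \<alpha> * (b - a) powr (1 - \<alpha>)"
      using s t m \<alpha> by (intro mult_left_mono powr_mono2) auto
    finally have ab1: "\<bar>s - t\<bar> \<le> \<bar>s - t\<bar> powr \<alpha> * (b - a) powr (1 - \<alpha>)" .
    have "D s - D t = (\<rho> s - \<rho> t) / ds + \<rho> t * (dt - ds) / (ds * dt)"
      unfolding D_def ds_def[symmetric] dt_def[symmetric] using dd d0 by (simp add: field_simps)
    then have "\<bar>D s - D t\<bar> \<le> \<bar>\<rho> s - \<rho> t\<bar> / ds + \<bar>\<rho> t\<bar> * \<bar>dt - ds\<bar> / (ds * dt)"
      using dd d0 abs_triangle_ineq[of "(\<rho> s - \<rho> t) / ds" "\<rho> t * (dt - ds) / (ds * dt)"] by (simp add: abs_mult)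
    also have "\<bar>\<rho> s - \<rho> t\<bar> / ds \<le> L * \<bar>s - t\<bar> powr \<alpha> / d0"
      using \<rho>(2)[of s t] s t m dd d0 by (intro frac_le) (auto intro: order_trans[OF abs_ge_zero])
    also have "\<bar>\<rho> t\<bar> * \<bar>dt - ds\<bar> / (ds * dt) \<le> B * (c' * (\<bar>s - t\<bar> powr \<alpha> * (b - a) powr (1 - \<alpha>))) / d0\<^sup>2"
    proof (rule frac_le)
      have "\<bar>dt - ds\<bar> \<le> c' * \<bar>s - t\<bar>" using lipd[OF s t] unfolding ds_def dt_def by (simp add: abs_minus_commute)
      also have "\<dots> \<le> c' * (\<bar>s - t\<bar> powr \<alpha> * (b - a) powr (1 - \<alpha>))" using ab1 c'0 by (rule mult_left_mono)
      finally show "\<bar>\<rho> t\<bar> * \<bar>dt - ds\<bar> \<le> B * (c' * (\<bar>s - t\<bar> powr \<alpha> * (b - a) powr (1 - \<alpha>)))"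
        using B[OF t] B0 by (intro mult_mono) auto
      show "d0\<^sup>2 \<le> ds * dt" unfolding power2_eq_square using dd d0 by (intro mult_mono) auto
    qed (use B0 c'0 d0 in auto)
    finally show ?thesis unfolding c_def by (simp add: distrib_right distrib_left mult_ac)
  qed
  with deriv show thesis using that by blast
qed

section \<open>Arcs tangent to the line field\<close>

context stable_line_map
begin

definition tangent_arc :: "(real \<Rightarrow> 'a) \<Rightarrow> (real \<Rightarrow> 'a) \<Rightarrow> real \<Rightarrow> real \<Rightarrow> bool"
  where "tangent_arc C C' a b \<longleftrightarrow> a < b \<and> continuous_on {a..b} C' \<and>
    (\<forall>t\<in>{a..b}. (C has_vector_derivative C' t) (at t within {a..b}) \<and> unit_tangent (C t) (C' t))"

lemma contraction_le: "contraction n x \<le> (1/4) ^ n"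
  unfolding contraction_def using prod_mono[of "{..<n}" "\<lambda>i. rate (orb i x)" "\<lambda>_. 1/4"] rate_le rate_pos
  by (simp add: rate_def less_imp_le)

lemma tangent_arc_orb:
  assumes "tangent_arc C C' a b" "t \<in> {a..b}"
  shows "((\<lambda>t. orb n (C t)) has_vector_derivative (contraction n (C t) *\<^sub>R direction n (C t) (C' t))) (at t within {a..b})"
proof (induction n)
  case 0
  then show ?case using assms unfolding tangent_arc_def by (simp add: contraction_0)
next
  case (Suc n)
  have u: "unit_tangent (orb n (C t)) (direction n (C t) (C' t))"
    using assms unfolding tangent_arc_def by (intro direction_unit_tangent) auto
  have "(G has_derivative DG (orb n (C t))) (at (orb n (C t)) within (\<lambda>t. orb n (C t)) ` {a..b})"
    using deriv by (rule has_derivative_at_withinI)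
  from vector_derivative_diff_chain_within[OF Suc this]
  have "((\<lambda>t. orb (Suc n) (C t)) has_vector_derivative DG (orb n (C t)) (contraction n (C t) *\<^sub>R direction n (C t) (C' t))) (at t within {a..b})"
    by (simp add: o_def)
  also have "DG (orb n (C t)) (contraction n (C t) *\<^sub>R direction n (C t) (C' t)) = contraction n (C t) *\<^sub>R DG (orb n (C t)) (direction n (C t) (C' t))"
    by (rule blinfun.scaleR_right)
  also have "DG (orb n (C t)) (direction n (C t) (C' t)) = rate (orb n (C t)) *\<^sub>R direction (Suc n) (C t) (C' t)"
    using unit_tangent_push(2)[OF u] by simp
  finally show ?case by (simp add: contraction_Suc)
qed

lemma tangent_arc_contracts:
  assumes arc: "tangent_arc C C' a b" and st: "s \<in> {a..b}" "t \<in> {a..b}"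
  shows "dist (orb n (C s)) (orb n (C t)) \<le> (1/4) ^ n * \<bar>s - t\<bar>"
proof -
  have "norm (orb n (C s) - orb n (C t)) \<le> (1/4) ^ n * norm (s - t)"
  proof (rule differentiable_bound[where S = "{a..b}"])
    fix x assume x: "x \<in> {a..b}"
    show "((\<lambda>t. orb n (C t)) has_derivative (\<lambda>y. y *\<^sub>R (contraction n (C x) *\<^sub>R direction n (C x) (C' x)))) (at x within {a..b})"
      using tangent_arc_orb[OF arc x] unfolding has_vector_derivative_def .
    have "unit_tangent (orb n (C x)) (direction n (C x) (C' x))"
      using arc x unfolding tangent_arc_def by (intro direction_unit_tangent) auto
    then have nd: "norm (direction n (C x) (C' x)) = 1" by (rule unit_tangent_norm)
    have "norm (y *\<^sub>R (contraction n (C x) *\<^sub>R direction n (C x) (C' x))) \<le> (1/4) ^ n * norm y" for y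
      using mult_left_mono[OF contraction_le[of n "C x"], of "\<bar>y\<bar>"] contraction_pos[of n "C x"] nd by (simp add: mult.commute abs_mult)
    then show "onorm (\<lambda>y. y *\<^sub>R (contraction n (C x) *\<^sub>R direction n (C x) (C' x))) \<le> (1/4) ^ n"
      by (intro onorm_bound) auto
  qed (use st in auto)
  then show ?thesis by (simp add: dist_norm)
qed

lemma tangent_arc_stays_close:
  assumes "tangent_arc C C' a b" "s \<in> {a..b}" "t \<in> {a..b}"
  shows "dist (orb n (C s)) (orb n (C t)) \<le> \<bar>s - t\<bar>"
proof -
  have "(1/4) ^ n * \<bar>s - t\<bar> \<le> 1 * \<bar>s - t\<bar>" by (intro mult_right_mono power_le_one) auto
  then show ?thesis using tangent_arc_contracts[OF assms, of n] by simp
qed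

lemma tangent_arc_subinterval:
  assumes "tangent_arc C C' a b" "a \<le> p" "p < q" "q \<le> b"
  shows "tangent_arc C C' p q"
  unfolding tangent_arc_def
proof (intro conjI ballI)
  have sub: "{p..q} \<subseteq> {a..b}" using assms by auto
  show "p < q" by fact
  show "continuous_on {p..q} C'"
    by (rule continuous_on_subset[OF _ sub]) (use assms(1) in \<open>simp add: tangent_arc_def\<close>)
  fix t assume "t \<in> {p..q}"
  then have t: "t \<in> {a..b}" using sub by auto
  show "(C has_vector_derivative C' t) (at t within {p..q})"
    by (rule has_vector_derivative_within_subset[OF _ sub]) (use assms(1) t in \<open>simp add: tangent_arc_def\<close>)
  show "unit_tangent (C t) (C' t)" using assms(1) t by (simp add: tangent_arc_def)
qed

lemma tangent_arc_reverse:
  assumes "tangent_arc C C' a b"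
  shows "tangent_arc (\<lambda>t. C (- t)) (\<lambda>t. - C' (- t)) (- b) (- a)"
  unfolding tangent_arc_def
proof (intro conjI ballI)
  show "- b < - a" using assms unfolding tangent_arc_def by simp
  have "continuous_on {a..b} C'" using assms unfolding tangent_arc_def by simp
  then have "continuous_on {- b..- a} (\<lambda>t. C' (- t))"
    by (rule continuous_on_compose2) (auto intro!: continuous_intros)
  then show "continuous_on {- b..- a} (\<lambda>t. - C' (- t))" by (intro continuous_intros)
  fix t assume t: "t \<in> {- b..- a}"
  then have t': "- t \<in> {a..b}" by auto
  have "(C has_vector_derivative C' (- t)) (at (- t) within uminus ` {- b..- a})"
    using assms t' unfolding tangent_arc_def by simp
  moreover have "(uminus has_vector_derivative - 1) (at t within {- b..- a})"
    by (auto intro!: derivative_eq_intros)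
  ultimately show "((\<lambda>t. C (- t)) has_vector_derivative - C' (- t)) (at t within {- b..- a})"
    using vector_diff_chain_within[of uminus "-1" t "{- b..- a}" C "C' (- t)"] by (simp add: o_def)
  show "unit_tangent (C (- t)) (- C' (- t))"
    using assms t' unfolding tangent_arc_def unit_tangent_def by fastforce
qed

lemma tangent_arc_unit: "tangent_arc C C' a b \<Longrightarrow> t \<in> {a..b} \<Longrightarrow> unit_tangent (C t) (C' t)"
  unfolding tangent_arc_def by simp

lemma tangent_arc_continuous: "tangent_arc C C' a b \<Longrightarrow> continuous_on {a..b} C"
  unfolding tangent_arc_def
  by (meson continuous_on_eq_continuous_within has_vector_derivative_continuous)

text \<open>Coherence fixes one orientation along the arc, as needed for the cocycle identity between any two of its points.\<close>

definition coherent :: "(real \<Rightarrow> 'a) \<Rightarrow> real \<Rightarrow> real \<Rightarrow> bool"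
  where "coherent C' a b \<longleftrightarrow> (\<forall>s\<in>{a..b}. \<forall>t\<in>{a..b}. 0 < C' s \<bullet> C' t)"

context
  fixes C C' a b
  assumes arc: "tangent_arc C C' a b" and short: "b - a \<le> \<epsilon>" and coh: "coherent C' a b"
begin

lemma arc_stable: "s \<in> {a..b} \<Longrightarrow> t \<in> {a..b} \<Longrightarrow> stable_pair (C s) (C t)"
  unfolding stable_pair_def
  by (intro allI, rule order_trans[OF tangent_arc_stays_close[OF arc]]) (use short in auto)

lemma arc_tangent: "t \<in> {a..b} \<Longrightarrow> unit_tangent (C t) (C' t)"
  using arc unfolding tangent_arc_def by simp

lemma arc_ab: "a < b" using arc unfolding tangent_arc_def by simp

definition "arc_dens t = exp (log_dens (C a) (C t))"
definition "arc_coord t = stable_coord (C a) (C' a) (C t)"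

lemma arc_dist: "s \<in> {a..b} \<Longrightarrow> t \<in> {a..b} \<Longrightarrow> dist (C s) (C t) \<le> \<bar>s - t\<bar>"
  using tangent_arc_stays_close[OF arc, of s t 0] by simp

lemma arc_cocycle:
  assumes "s \<in> {a..b}" "t \<in> {a..b}"
  shows "arc_coord s - arc_coord t = arc_dens t * stable_coord (C t) (C' t) (C s)"
  unfolding arc_coord_def arc_dens_def using assms arc_ab coh
  by (intro stable_coord_cocycle arc_stable arc_tangent) (auto simp: coherent_def)

lemma arc_dens_Hoelder:
  obtains L where "\<And>s t. s \<in> {a..b} \<Longrightarrow> t \<in> {a..b} \<Longrightarrow> \<bar>arc_dens s - arc_dens t\<bar> \<le> L * \<bar>s - t\<bar> powr \<alpha>"
proof
  fix s t assume st: "s \<in> {a..b}" "t \<in> {a..b}"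
  have aa: "a \<in> {a..b}" using arc_ab by simp
  have ld: "\<bar>log_dens (C x) (C y)\<bar> \<le> log_dens_const * \<bar>x - y\<bar> powr \<alpha>" if "x \<in> {a..b}" "y \<in> {a..b}" for x y
    by (rule order_trans[OF log_dens(2)[OF arc_stable[OF that]]])
      (use arc_dist[OF that] log_dens_const_pos alpha_pos in \<open>auto intro!: mult_left_mono powr_mono2\<close>)
  define B where "B = log_dens_const * (b - a) powr \<alpha>"
  have le: "log_dens (C a) (C x) \<le> B" if "x \<in> {a..b}" for x
  proof -
    have "log_dens_const * \<bar>a - x\<bar> powr \<alpha> \<le> B" unfolding B_def using that log_dens_const_pos alpha_pos by (intro mult_left_mono powr_mono2) auto
    then show ?thesis using ld[OF aa that] by linarith
  qed
  have exp_lip: "\<bar>exp p - exp q\<bar> \<le> exp B * \<bar>p - q\<bar>" if "p \<le> B" "q \<le> B" for p q :: real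
  proof -
    have "norm (exp p - exp q) \<le> exp B * norm (p - q)"
      by (rule field_differentiable_bound[where S = "{..B}" and f' = exp])
        (use that in \<open>auto intro: DERIV_subset DERIV_exp\<close>)
    then show ?thesis by simp
  qed
  have "\<bar>arc_dens s - arc_dens t\<bar> \<le> exp B * \<bar>log_dens (C a) (C s) - log_dens (C a) (C t)\<bar>"
    unfolding arc_dens_def using st by (intro exp_lip le)
  also have "log_dens (C a) (C s) - log_dens (C a) (C t) = log_dens (C t) (C s)"
    using log_dens_add[of "C a" "C t" "C s"] arc_stable st aa by simp
  also have "exp B * \<bar>log_dens (C t) (C s)\<bar> \<le> exp B * (log_dens_const * \<bar>t - s\<bar> powr \<alpha>)"
    using ld[OF st(2,1)] by (intro mult_left_mono) auto
  finally show "\<bar>arc_dens s - arc_dens t\<bar> \<le> exp B * log_dens_const * \<bar>s - t\<bar> powr \<alpha>" by (simp add: abs_minus_commute)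
qed

text \<open>By the cocycle identity it suffices to differentiate the coordinate based at \<open>C t\<close>, and near \<open>C t\<close> this coordinate
is the projection to the tangent line up to an error of order \<open>1 + \<alpha>\<close>.\<close>

lemma arc_coord_deriv:
  assumes t: "t \<in> {a..b}"
  shows "(arc_coord has_real_derivative arc_dens t) (at t within {a..b})"
proof -
  define Q where "Q s = stable_coord (C t) (C' t) (C s)" for s
  have "\<bar>Q s - C' t \<bullet> (C s - C t)\<bar> \<le> error_const * \<bar>s - t\<bar> powr \<alpha> * \<bar>s - t\<bar>" if s: "s \<in> {a..b}" for s
  proof -
    have "\<bar>Q s - C' t \<bullet> (C s - C t)\<bar> \<le> error_const * dist (C t) (C s) powr \<alpha> * dist (C t) (C s)"
      unfolding Q_def by (intro stable_coord_near arc_stable arc_tangent s t)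
    also have "\<dots> \<le> error_const * \<bar>s - t\<bar> powr \<alpha> * \<bar>s - t\<bar>"
      using arc_dist[OF t s] error_const_pos alpha_pos by (intro mult_mono mult_left_mono powr_mono2) (auto simp: abs_minus_commute)
    finally show ?thesis .
  qed
  then have 1: "((\<lambda>s. Q s - C' t \<bullet> (C s - C t)) has_real_derivative 0) (at t within {a..b})"
    using t by (intro superlinear_has_derivative_0[OF alpha_pos])
  have "(C has_vector_derivative C' t) (at t within {a..b})" using arc t unfolding tangent_arc_def by simp
  then have "((\<lambda>s. C' t \<bullet> (C s - C t)) has_vector_derivative C' t \<bullet> C' t) (at t within {a..b})"
    unfolding has_vector_derivative_def by (auto intro!: derivative_eq_intros)
  moreover have "C' t \<bullet> C' t = 1" using unit_tangent_norm[OF arc_tangent[OF t]] by (simp add: norm_eq_1)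
  ultimately have 2: "((\<lambda>s. C' t \<bullet> (C s - C t)) has_real_derivative 1) (at t within {a..b})"
    by (simp add: has_real_derivative_iff_has_vector_derivative)
  have "(Q has_real_derivative 1) (at t within {a..b})" using DERIV_add[OF 1 2] by simp
  then have "((\<lambda>s. arc_coord t + arc_dens t * Q s) has_real_derivative arc_dens t) (at t within {a..b})"
    by (auto intro!: derivative_eq_intros)
  then show ?thesis
    by (rule has_field_derivative_transform_within[OF _ zero_less_one t])
      (use arc_cocycle[OF _ t] in \<open>auto simp: Q_def algebra_simps\<close>)
qed

lemma arc_coord_0: "arc_coord a = 0"
  using arc_cocycle[of a a] stable_coord_near[OF arc_stable arc_tangent, of a a] arc_ab
  unfolding arc_coord_def by simp

lemma arc_coord_mono:
  assumes "s \<in> {a..b}" "t \<in> {a..b}" "s < t"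
  shows "arc_coord s < arc_coord t"
proof (rule DERIV_pos_imp_increasing_open[OF assms(3)])
  fix x assume x: "s < x" "x < t"
  have "(arc_coord has_real_derivative arc_dens x) (at x)" 
    using arc_coord_deriv[of x] x assms at_within_Icc_at[of a x b] by auto
  then show "\<exists>y. (arc_coord has_real_derivative y) (at x) \<and> 0 < y" unfolding arc_dens_def by (intro exI) auto
next
  have "continuous_on {a..b} arc_coord"
    using arc_coord_deriv DERIV_continuous continuous_on_eq_continuous_within by blast
  then show "continuous_on {s..t} arc_coord" by (rule continuous_on_subset) (use assms in auto)
qed

lemma arc_inj: "inj_on C {a..b}"
proof (rule inj_onI, rule ccontr)
  fix s t assume st: "s \<in> {a..b}" "t \<in> {a..b}" "C s = C t" "s \<noteq> t"
  then have "arc_coord s = arc_coord t" unfolding arc_coord_def by simp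
  then show False using arc_coord_mono[of s t] arc_coord_mono[of t s] st by linarith
qed

end

end

section \<open>Conjugacy with a linear map\<close>

text \<open>The homeomorphism \<open>H\<close>, with inverse \<open>Hi\<close>, conjugates \<open>G\<close> to an affine map with linear part \<open>L\<close>. The last assumption
is continuity of the line field: unit tangent vectors extend along convergent sequences of base points.\<close>

locale linearized_line_map = stable_line_map G DG e \<alpha> K M g0 \<epsilon>
  for G :: "'a::euclidean_space \<Rightarrow> 'a" and DG e \<alpha> K M g0 \<epsilon> +
  fixes H Hi L :: "'a \<Rightarrow> 'a" and k0 :: 'a
  assumes alpha_less: "\<alpha> < 1"
    and H_unif: "uniformly_continuous_on UNIV H" and Hi_unif: "uniformly_continuous_on UNIV Hi"
    and Hi_H: "\<And>x. Hi (H x) = x" and H_Hi: "\<And>y. H (Hi y) = y"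
    and lin: "linear L" and conj: "\<And>x. H (G x) = L (H x) + k0"
    and tangent_section: "\<And>x u f. unit_tangent x u \<Longrightarrow> f \<longlonglongrightarrow> x \<Longrightarrow> \<exists>U. U \<longlonglongrightarrow> u \<and> (\<forall>k::nat. unit_tangent (f k) (U k))"
begin

lemma H_orb_diff: "H (orb n x) - H (orb n y) = (L ^^ n) (H x - H y)"
proof (induction n)
  case (Suc n)
  have "H (orb (Suc n) x) - H (orb (Suc n) y) = L (H (orb n x)) - L (H (orb n y))" by (simp add: conj)
  also have "\<dots> = L (H (orb n x) - H (orb n y))" by (simp add: linear_diff[OF lin])
  finally show ?case using Suc by simp
qed simp

lemma Hi_close:
  assumes "0 < r"
  obtains \<delta> where "0 < \<delta>" "\<And>x y. norm (H x - H y) < \<delta> \<Longrightarrow> dist x y < r"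
  using Hi_unif assms unfolding uniformly_continuous_on_def by (metis Hi_H UNIV_I dist_norm)

lemma H_close:
  assumes "0 < r"
  obtains \<delta> where "0 < \<delta>" "\<And>x y. dist x y < \<delta> \<Longrightarrow> norm (H x - H y) < r"
  using H_unif assms unfolding uniformly_continuous_on_def by (metis UNIV_I dist_norm)

text \<open>The map \<open>x \<mapsto> Hi (H x + w)\<close> leaves the differences of \<open>H\<close> along two orbits unchanged, and \<open>H\<close> and \<open>Hi\<close> are
uniformly continuous. So the loss in closeness of orbits does not depend on \<open>w\<close>.\<close>

lemma translate_stable:
  obtains \<delta> where "0 < \<delta>" "\<delta> \<le> \<epsilon>"
    "\<And>x y w. (\<And>n. dist (orb n x) (orb n y) < \<delta>) \<Longrightarrow> stable_pair (Hi (H x + w)) (Hi (H y + w))"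
proof -
  obtain r where r: "0 < r" "\<And>x y. norm (H x - H y) < r \<Longrightarrow> dist x y < \<epsilon>" using Hi_close[OF eps_pos] by metis
  obtain d where d: "0 < d" "\<And>x y. dist x y < d \<Longrightarrow> norm (H x - H y) < r" using H_close[OF r(1)] by metis
  show thesis
  proof (rule that[of "min d \<epsilon>"])
    fix x y w assume close: "\<And>n. dist (orb n x) (orb n y) < min d \<epsilon>"
    have "dist (orb n (Hi (H x + w))) (orb n (Hi (H y + w))) < \<epsilon>" for n
    proof (rule r(2))
      have "H (orb n (Hi (H x + w))) - H (orb n (Hi (H y + w))) = H (orb n x) - H (orb n y)"
        unfolding H_orb_diff H_Hi by simp
      then show "norm (H (orb n (Hi (H x + w))) - H (orb n (Hi (H y + w)))) < r"
        using d(2)[of "orb n x" "orb n y"] close[of n] by simp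
    qed
    then show "stable_pair (Hi (H x + w)) (Hi (H y + w))" unfolding stable_pair_def by (simp add: less_imp_le)
  qed (use d eps_pos in auto)
qed

definition decaying :: "'a \<Rightarrow> bool" where "decaying w \<longleftrightarrow> (\<lambda>n. (L ^^ n) w) \<longlonglongrightarrow> 0"

lemma arc_decaying:
  assumes arc: "tangent_arc C C' a b" and st: "s \<in> {a..b}" "t \<in> {a..b}"
  shows "decaying (H (C s) - H (C t))"
  unfolding decaying_def H_orb_diff[symmetric] tendsto_iff
proof (intro allI impI)
  fix r :: real assume "0 < r"
  then obtain d where d: "0 < d" "\<And>x y. dist x y < d \<Longrightarrow> norm (H x - H y) < r" using H_close by metis
  have "(\<lambda>n. (1/4) ^ n * \<bar>s - t\<bar>) \<longlonglongrightarrow> 0 * \<bar>s - t\<bar>" by (intro tendsto_intros LIMSEQ_power_zero) auto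
  then have "\<forall>\<^sub>F n in sequentially. (1/4) ^ n * \<bar>s - t\<bar> < d" using d by (intro order_tendstoD) auto
  then show "\<forall>\<^sub>F n in sequentially. dist (H (orb n (C s)) - H (orb n (C t))) 0 < r"
  proof eventually_elim
    case (elim n)
    then show ?case using d(2)[of "orb n (C s)" "orb n (C t)"] tangent_arc_contracts[OF arc st, of n] by simp
  qed
qed

lemma pow_scaleR: "(L ^^ n) (c *\<^sub>R w) = c *\<^sub>R (L ^^ n) w"
  by (induction n) (simp_all add: linear_scale[OF lin])

lemma arc_short_exists:
  assumes arc: "tangent_arc C C' a b" and r: "0 < r"
  obtains \<delta> where "0 < \<delta>" "\<And>s t. s \<in> {a..b} \<Longrightarrow> t \<in> {a..b} \<Longrightarrow> \<bar>s - t\<bar> \<le> \<delta> \<Longrightarrow> norm (C' s - C' t) < r"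
proof -
  have "uniformly_continuous_on {a..b} C'"
    using arc unfolding tangent_arc_def by (intro compact_uniformly_continuous) auto
  then obtain d where d: "0 < d" "\<And>s t. s \<in> {a..b} \<Longrightarrow> t \<in> {a..b} \<Longrightarrow> dist s t < d \<Longrightarrow> dist (C' s) (C' t) < r"
    using r unfolding uniformly_continuous_on_def by metis
  show thesis by (rule that[of "d / 2"]) (use d in \<open>auto simp: dist_norm\<close>)
qed

lemma coherentI:
  assumes "\<And>s. s \<in> {p..q} \<Longrightarrow> norm (C' s) = 1" "\<And>s t. s \<in> {p..q} \<Longrightarrow> t \<in> {p..q} \<Longrightarrow> norm (C' s - C' t) < 1"
  shows "coherent C' p q"
  unfolding coherent_def
proof (intro ballI)
  fix s t assume st: "s \<in> {p..q}" "t \<in> {p..q}"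
  have "(norm (C' s - C' t))\<^sup>2 < 1\<^sup>2" using assms(2)[OF st] by (intro power_strict_mono) auto
  then show "0 < C' s \<bullet> C' t"
    using assms(1)[OF st(1)] assms(1)[OF st(2)] dot_norm_neg[of "C' s" "C' t"] by simp
qed

end

section \<open>Paths with Hoelder continuous derivative\<close>

definition C1_Hoelder_on :: "real \<Rightarrow> real \<Rightarrow> real \<Rightarrow> (real \<Rightarrow> 'b::real_normed_vector) \<Rightarrow> bool"
  where "C1_Hoelder_on \<alpha> p q Z \<longleftrightarrow> (\<exists>g c. (\<forall>t\<in>{p..q}. (Z has_vector_derivative g t) (at t within {p..q})) \<and>
    (\<forall>s\<in>{p..q}. \<forall>t\<in>{p..q}. norm (g s - g t) \<le> c * \<bar>s - t\<bar> powr \<alpha>))"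

lemma C1_Hoelder_on_reverse:
  assumes "C1_Hoelder_on \<alpha> a b Z"
  shows "C1_Hoelder_on \<alpha> (- b) (- a) (\<lambda>t. Z (- t))"
proof -
  obtain g c where g: "\<And>t. t \<in> {a..b} \<Longrightarrow> (Z has_vector_derivative g t) (at t within {a..b})"
    "\<And>s t. s \<in> {a..b} \<Longrightarrow> t \<in> {a..b} \<Longrightarrow> norm (g s - g t) \<le> c * \<bar>s - t\<bar> powr \<alpha>"
    using assms(1) unfolding C1_Hoelder_on_def by metis
  have "((\<lambda>t. Z (- t)) has_vector_derivative - g (- t)) (at t within {- b..- a})" if "t \<in> {- b..- a}" for t
  proof -
    have "(Z has_vector_derivative g (- t)) (at (- t) within uminus ` {- b..- a})"
      using g(1)[of "- t"] that by simp
    moreover have "(uminus has_vector_derivative - 1) (at t within {- b..- a})"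
      by (auto intro!: derivative_eq_intros)
    ultimately show ?thesis
      using vector_diff_chain_within[of uminus "-1" t "{- b..- a}" Z "g (- t)"] by (simp add: o_def)
  qed
  moreover have "norm (- g (- s) - - g (- t)) \<le> c * \<bar>s - t\<bar> powr \<alpha>" if "s \<in> {- b..- a}" "t \<in> {- b..- a}" for s t
    using g(2)[of "- t" "- s"] that by (simp add: algebra_simps)
  ultimately show ?thesis unfolding C1_Hoelder_on_def by (intro exI[of _ "\<lambda>t. - g (- t)"] exI[of _ c]) blast
qed

text \<open>The two derivatives agree at an interior point of the overlap, which serves as an intermediate point in the Hoelder
estimate.\<close>

lemma C1_Hoelder_on_glue:
  assumes 1: "C1_Hoelder_on \<alpha> p y Z" and 2: "C1_Hoelder_on \<alpha> x q Z" and le: "p \<le> x" "x < y" "y \<le> q" and \<alpha>: "0 < \<alpha>"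
  shows "C1_Hoelder_on \<alpha> p q Z"
proof -
  obtain g c where g: "\<And>t. t \<in> {p..y} \<Longrightarrow> (Z has_vector_derivative g t) (at t within {p..y})"
    "\<And>s t. s \<in> {p..y} \<Longrightarrow> t \<in> {p..y} \<Longrightarrow> norm (g s - g t) \<le> c * \<bar>s - t\<bar> powr \<alpha>"
    using 1 unfolding C1_Hoelder_on_def by metis
  obtain g' c' where g': "\<And>t. t \<in> {x..q} \<Longrightarrow> (Z has_vector_derivative g' t) (at t within {x..q})"
    "\<And>s t. s \<in> {x..q} \<Longrightarrow> t \<in> {x..q} \<Longrightarrow> norm (g' s - g' t) \<le> c' * \<bar>s - t\<bar> powr \<alpha>"
    using 2 unfolding C1_Hoelder_on_def by metis
  define m where "m = (x + y) / 2"
  have m: "x < m" "m < y" unfolding m_def using le by auto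
  have "(Z has_vector_derivative g m) (at m)" "(Z has_vector_derivative g' m) (at m)"
    using g(1)[of m] g'(1)[of m] m le at_within_Icc_at[of p m y] at_within_Icc_at[of x m q] by auto
  then have eq: "g m = g' m" by (rule vector_derivative_unique_at)
  define k where "k t = (if t < m then g t else g' t)" for t
  have d: "(Z has_vector_derivative k t) (at t within {p..q})" if t: "t \<in> {p..q}" for t
  proof (cases "t < m")
    case True
    have "at t within {p..q} = at t within {p..y}"
      by (rule at_within_nhd[of _ "{..<y}"]) (use True m le in auto)
    then show ?thesis unfolding k_def using True g(1)[of t] t m by simp
  next
    case False
    have "at t within {p..q} = at t within {x..q}"
      by (rule at_within_nhd[of _ "{x<..}"]) (use False m le in auto)
    then show ?thesis unfolding k_def using False g'(1)[of t] t m by simp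
  qed
  define b where "b = \<bar>c\<bar> + \<bar>c'\<bar>"
  have b: "c * r \<le> b * r" "c' * r \<le> b * r" "c * r \<le> \<bar>c\<bar> * r" "c' * r \<le> \<bar>c'\<bar> * r" if "0 \<le> r" for r :: real
    unfolding b_def using that by (auto intro!: mult_right_mono)
  have mid: "norm (k s - k t) \<le> b * \<bar>s - t\<bar> powr \<alpha>" if st: "s \<in> {p..q}" "t \<in> {p..q}" "s < m" "m \<le> t" for s t
  proof -
    have "k s - k t = (g s - g m) + (g' m - g' t)" unfolding k_def eq using st by simp
    then have "norm (k s - k t) \<le> norm (g s - g m) + norm (g' m - g' t)" by (metis norm_triangle_ineq)
    also have "norm (g s - g m) \<le> c * \<bar>s - m\<bar> powr \<alpha>" using g(2)[of s m] st m by simp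
    also have "\<dots> \<le> \<bar>c\<bar> * \<bar>s - m\<bar> powr \<alpha>" by (intro b) simp
    also have "\<dots> \<le> \<bar>c\<bar> * \<bar>s - t\<bar> powr \<alpha>" using st \<alpha> by (intro mult_left_mono powr_mono2) auto
    also have "norm (g' m - g' t) \<le> c' * \<bar>m - t\<bar> powr \<alpha>" using g'(2)[of m t] st m le by simp
    also have "\<dots> \<le> \<bar>c'\<bar> * \<bar>m - t\<bar> powr \<alpha>" by (intro b) simp
    also have "\<dots> \<le> \<bar>c'\<bar> * \<bar>s - t\<bar> powr \<alpha>" using st \<alpha> by (intro mult_left_mono powr_mono2) auto
    finally show ?thesis unfolding b_def by (simp add: distrib_right)
  qed
  have h: "norm (k s - k t) \<le> b * \<bar>s - t\<bar> powr \<alpha>" if st: "s \<in> {p..q}" "t \<in> {p..q}" for s t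
  proof -
    consider "s < m" "t < m" | "s < m" "m \<le> t" | "m \<le> s" "t < m" | "m \<le> s" "m \<le> t" by linarith
    then show ?thesis
    proof cases
      case 1
      then show ?thesis unfolding k_def using g(2)[of s t] b(1)[of "\<bar>s - t\<bar> powr \<alpha>"] st m by simp
    next
      case 2 then show ?thesis using mid[of s t] st by simp
    next
      case 3 then show ?thesis using mid[of t s] st by (simp add: norm_minus_commute abs_minus_commute)
    next
      case 4
      then show ?thesis unfolding k_def using g'(2)[of s t] b(2)[of "\<bar>s - t\<bar> powr \<alpha>"] st m by simp
    qed
  qed
  from d h show ?thesis unfolding C1_Hoelder_on_def by blast
qed

lemma C1_Hoelder_on_from_short:
  assumes short: "\<And>p q. a \<le> p \<Longrightarrow> p < q \<Longrightarrow> q \<le> b \<Longrightarrow> q - p \<le> \<delta> \<Longrightarrow> C1_Hoelder_on \<alpha> p q Z"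
    and \<delta>: "0 < \<delta>" and ab: "a < b" and \<alpha>: "0 < \<alpha>"
  shows "C1_Hoelder_on \<alpha> a b Z"
proof -
  define \<eta> where "\<eta> = \<delta> / 2"
  have \<eta>: "0 < \<eta>" "2 * \<eta> = \<delta>" unfolding \<eta>_def using \<delta> by auto
  have "C1_Hoelder_on \<alpha> a (min b (a + real (Suc k) * \<eta>)) Z" for k
  proof (induction k)
    case 0
    show ?case using \<eta> ab by (intro short) auto
  next
    case (Suc k)
    let ?x = "min b (a + real (Suc k) * \<eta>)" and ?x' = "min b (a + real (Suc (Suc k)) * \<eta>)"
    show ?case
    proof (cases "b \<le> a + real (Suc k) * \<eta>")
      case True
      then have "?x' = ?x" using \<eta> by (auto simp: min_def algebra_simps)
      then show ?thesis using Suc by simp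
    next
      case False
      have k0: "0 \<le> real k * \<eta>" using \<eta> by simp
      have x: "?x = a + real k * \<eta> + \<eta>" using False by (simp add: algebra_simps)
      have x': "?x' \<le> ?x + \<eta>" "?x < ?x'" using False \<eta> by (auto simp: min_def algebra_simps)
      have "C1_Hoelder_on \<alpha> (?x - \<eta>) ?x' Z" using x x' k0 \<eta> by (intro short) auto
      from C1_Hoelder_on_glue[OF Suc this] show ?thesis using x x' k0 \<eta> \<alpha> by simp
    qed
  qed
  moreover obtain k :: nat where "(b - a) / \<eta> < real k" using reals_Archimedean2 by blast
  then have "b \<le> a + real (Suc k) * \<eta>" using \<eta> by (simp add: field_simps)
  ultimately show ?thesis by (metis min.absorb1)
qed

section \<open>The stable space of the linear map\<close>

context linearized_line_map
begin

text \<open>The orbit of the point \<open>y\<close> with \<open>H y = H (C t0) + s *\<^sub>R w\<close> stays close to the orbits of the arc. Let \<open>C t\<close> be the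
point of the arc for which \<open>y - C t\<close> is orthogonal to the tangent at \<open>t0\<close>. Since \<open>C t\<close> and \<open>y\<close> form a stable pair,
their displacement is also almost tangent, and so it vanishes.\<close>

lemma short_arc_captures:
  assumes arc: "tangent_arc C C' a b" and short: "b - a \<le> \<epsilon> / 2" and turn: "\<And>s t. s \<in> {a..b} \<Longrightarrow> t \<in> {a..b} \<Longrightarrow> norm (C' s - C' t) < 1/2"
    and t0: "a < t0" "t0 < b" and w: "decaying w"
  shows "\<exists>s0>0. \<forall>s. \<bar>s\<bar> < s0 \<longrightarrow> (\<exists>t\<in>{a..b}. H (C t) - H (C t0) = s *\<^sub>R w)"
proof -
  have unitC: "unit_tangent (C t) (C' t)" "norm (C' t) = 1" if "t \<in> {a..b}" for t
    using tangent_arc_unit[OF arc that] unit_tangent_norm by auto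
  have coh: "coherent C' a b" by (rule coherentI) (use unitC in simp, rule less_trans[OF turn], auto)
  define u where "u = C' t0"
  define x0 where "x0 = C t0"
  define \<phi> where "\<phi> t = C t \<bullet> u" for t
  have d\<phi>: "(\<phi> has_real_derivative (C' t \<bullet> u)) (at t within {a..b})" if "t \<in> {a..b}" for t
  proof -
    have "(C has_vector_derivative C' t) (at t within {a..b})" using arc that unfolding tangent_arc_def by simp
    then show ?thesis
      unfolding \<phi>_def has_real_derivative_iff_has_vector_derivative has_vector_derivative_def
      by (auto intro!: derivative_eq_intros)
  qed
  have cont\<phi>: "continuous_on {a..b} \<phi>"
    using d\<phi> DERIV_continuous continuous_on_eq_continuous_within by blast
  have mono: "\<phi> s < \<phi> t" if st: "a \<le> s" "s < t" "t \<le> b" for s t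
  proof (rule DERIV_pos_imp_increasing_open[OF st(2)])
    fix x assume x: "s < x" "x < t"
    have "(\<phi> has_real_derivative (C' x \<bullet> u)) (at x)" using d\<phi>[of x] x st at_within_Icc_at[of a x b] by auto
    moreover have "0 < C' x \<bullet> u" unfolding u_def using coh x st t0 unfolding coherent_def by auto
    ultimately show "\<exists>y. (\<phi> has_real_derivative y) (at x) \<and> 0 < y" by blast
  qed (rule continuous_on_subset[OF cont\<phi>], use st in auto)
  define \<rho> where "\<rho> = min (\<phi> t0 - \<phi> a) (\<phi> b - \<phi> t0)"
  have \<rho>: "0 < \<rho>" unfolding \<rho>_def using mono[of a t0] mono[of t0 b] t0 by simp
  have "Bseq (\<lambda>n. (L ^^ n) w)" using w unfolding decaying_def by (intro convergent_imp_Bseq convergentI)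
  then obtain B where B: "0 < B" "\<And>n. norm ((L ^^ n) w) \<le> B" unfolding Bseq_def by blast
  obtain d1 where d1: "0 < d1" "\<And>x y. norm (H x - H y) < d1 \<Longrightarrow> dist x y < \<epsilon> / 2"
    using Hi_close[of "\<epsilon> / 2"] eps_pos by auto
  obtain d2 where d2: "0 < d2" "\<And>x y. norm (H x - H y) < d2 \<Longrightarrow> dist x y < \<rho>" using Hi_close[OF \<rho>] by metis
  define s0 where "s0 = min d1 d2 / B"
  have s0: "0 < s0" unfolding s0_def using B d1 d2 by simp
  have "\<exists>t\<in>{a..b}. H (C t) - H (C t0) = s *\<^sub>R w" if s: "\<bar>s\<bar> < s0" for s
  proof -
    \<comment> \<open>bounded powers of \<open>L\<close> on \<open>w\<close> keep the orbit of this point close to the orbit of \<open>x0\<close>\<close>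
    define y where "y = Hi (H x0 + s *\<^sub>R w)"
    have Hy: "H y - H x0 = s *\<^sub>R w" unfolding y_def H_Hi by simp
    have small: "norm ((L ^^ n) (s *\<^sub>R w)) < min d1 d2" for n
    proof -
      have "norm ((L ^^ n) (s *\<^sub>R w)) = \<bar>s\<bar> * norm ((L ^^ n) w)" by (simp add: pow_scaleR)
      also have "\<dots> \<le> \<bar>s\<bar> * B" using B by (intro mult_left_mono) auto
      also have "\<dots> < s0 * B" using s B by simp
      finally show ?thesis unfolding s0_def using B by simp
    qed
    have close: "dist (orb n y) (orb n x0) < \<epsilon> / 2" for n
      using small[of n] by (intro d1(2)) (simp add: H_orb_diff Hy)
    have "dist y x0 < \<rho>" using small[of 0] by (intro d2(2)) (simp add: Hy)
    then have "\<bar>(y - x0) \<bullet> u\<bar> < \<rho>"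
      using Cauchy_Schwarz_ineq2[of "y - x0" u] unitC(2)[of t0] t0 unfolding u_def by (simp add: dist_norm)
    then have "\<phi> a \<le> y \<bullet> u" "y \<bullet> u \<le> \<phi> b"
      unfolding \<rho>_def \<phi>_def x0_def by (auto simp: inner_diff_left)
    then obtain t where t: "t \<in> {a..b}" "\<phi> t = y \<bullet> u"
      using IVT'[of \<phi> a "y \<bullet> u" b] cont\<phi> t0 by auto
    have st: "stable_pair (C t) y" unfolding stable_pair_def
    proof
      fix n
      have "dist (orb n (C t)) (orb n x0) \<le> \<epsilon> / 2"
        unfolding x0_def using tangent_arc_stays_close[OF arc t(1), of t0 n] t t0 short by auto
      then show "dist (orb n (C t)) (orb n y) \<le> \<epsilon>"
        using close[of n] dist_triangle2[of "orb n (C t)" "orb n y" "orb n x0"] by simp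
    qed
    define d where "d = y - C t"
    \<comment> \<open>\<open>d\<close> is orthogonal to the tangent at \<open>t0\<close> and almost parallel to the one at \<open>t\<close>, yet these two tangents are close\<close>
    have du: "d \<bullet> u = 0" unfolding d_def using t(2) unfolding \<phi>_def by (simp add: inner_diff_left)
    define k where "k = K * dist (C t) y powr \<alpha>"
    have "k * (1 + 8 * M) \<le> K * \<epsilon> powr \<alpha> * (1 + 8 * M)"
      unfolding k_def using M_ge by (intro mult_right_mono small_powr stable_pair_dist st) auto
    then have k: "k * (1 + 8 * M) < 1/4" using eps_quarter by simp
    have k0: "0 \<le> k" unfolding k_def using K_pos by simp
    have k1: "k < 1/4" using k mult_left_mono[of 1 "1 + 8 * M" k] k0 M_ge by simp
    have "transverse (e (C t)) d \<le> k * norm d"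
      using stable_pair_transverse[OF st] unfolding k_def d_def by (simp add: dist_norm norm_minus_commute)
    then have q: "norm (d - (C' t \<bullet> d) *\<^sub>R C' t) \<le> k * norm d"
      unfolding unit_tangent_transverse[OF unitC(1)[OF t(1)]] .
    have "C' t \<bullet> d = (C' t - u) \<bullet> d" using du by (simp add: inner_diff_left inner_commute[of u d])
    then have "\<bar>C' t \<bullet> d\<bar> \<le> norm (C' t - u) * norm d" using Cauchy_Schwarz_ineq2[of "C' t - u" d] by simp
    also have "\<dots> \<le> 1/2 * norm d" using turn[OF t(1), of t0] t0 unfolding u_def by (intro mult_right_mono) auto
    finally have "norm ((C' t \<bullet> d) *\<^sub>R C' t) \<le> 1/2 * norm d" using unitC(2)[OF t(1)] by simp
    then have "norm d \<le> k * norm d + 1/2 * norm d"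
      using q norm_triangle_ineq[of "d - (C' t \<bullet> d) *\<^sub>R C' t" "(C' t \<bullet> d) *\<^sub>R C' t"] by simp
    moreover have "k * norm d \<le> 1/4 * norm d" using k1 by (intro mult_right_mono) auto
    ultimately have "norm d \<le> 0" by linarith
    then have "y = C t" unfolding d_def by simp
    then show ?thesis using Hy t(1) unfolding x0_def by blast
  qed
  with s0 show ?thesis by blast
qed

lemma short_subarc:
  assumes arc: "tangent_arc C C' a b" and r: "0 < r" "0 < r'"
  obtains q where "a < q" "q \<le> b" "q - a \<le> r" "\<And>s t. s \<in> {a..q} \<Longrightarrow> t \<in> {a..q} \<Longrightarrow> norm (C' s - C' t) < r'"
proof -
  obtain \<delta> where \<delta>: "0 < \<delta>" "\<And>s t. s \<in> {a..b} \<Longrightarrow> t \<in> {a..b} \<Longrightarrow> \<bar>s - t\<bar> \<le> \<delta> \<Longrightarrow> norm (C' s - C' t) < r'"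
    using arc_short_exists[OF arc r(2)] by metis
  have ab: "a < b" using arc unfolding tangent_arc_def by simp
  show thesis
    by (rule that[of "min b (a + min \<delta> r)"]) (use ab \<delta>(1) r in \<open>auto intro!: \<delta>(2)\<close>)
qed

text \<open>By \<open>short_arc_captures\<close>, a segment around zero in each line of decaying vectors corresponds to points of a single
arc. The segment of one line already covers a neighbourhood of the base point \<open>t0\<close> in the parameter interval, which
leaves no room for a second line.\<close>

lemma stable_space_line:
  assumes arc0: "tangent_arc C C' a b0"
  obtains v where "v \<noteq> 0" "decaying v" "\<And>w. decaying w \<Longrightarrow> \<exists>c. w = c *\<^sub>R v"
proof -
  obtain b where b: "a < b" "b \<le> b0" "b - a \<le> \<epsilon> / 2" and turn: "\<And>s t. s \<in> {a..b} \<Longrightarrow> t \<in> {a..b} \<Longrightarrow> norm (C' s - C' t) < 1/2"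
    using short_subarc[OF arc0, of "\<epsilon> / 2" "1/2"] eps_pos by auto
  have arc: "tangent_arc C C' a b" using tangent_arc_subinterval[OF arc0] b by simp
  have coh: "coherent C' a b"
    by (rule coherentI) (use tangent_arc_unit[OF arc] unit_tangent_norm in blast, rule less_trans[OF turn], auto)
  define t0 where "t0 = (a + b) / 2"
  have t0: "a < t0" "t0 < b" unfolding t0_def using b by auto
  define \<Sigma> where "\<Sigma> t = H (C t) - H (C t0)" for t
  have injH: "inj H" by (metis Hi_H injI)
  have injC: "inj_on C {a..b}" by (rule arc_inj[OF arc _ coh]) (use b eps_pos in simp)
  have inj\<Sigma>: "inj_on \<Sigma> {a..b}" unfolding \<Sigma>_def using injH injC by (auto simp: inj_on_def)
  have cont\<Sigma>: "continuous_on {a..b} \<Sigma>"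
    unfolding \<Sigma>_def
    by (intro continuous_intros continuous_on_compose2[OF uniformly_continuous_imp_continuous[OF H_unif] tangent_arc_continuous[OF arc]]) auto
  define \<Theta> where "\<Theta> = the_inv_into {a..b} \<Sigma>"
  have \<Theta>: "\<Theta> (\<Sigma> t) = t" if "t \<in> {a..b}" for t unfolding \<Theta>_def by (rule the_inv_into_f_f[OF inj\<Sigma> that])
  have cont\<Theta>: "continuous_on (\<Sigma> ` {a..b}) \<Theta>"
    using continuous_on_inv[OF cont\<Sigma>, of \<Theta>] \<Theta> by auto
  have in\<Sigma>: "\<Sigma> t0 = 0" unfolding \<Sigma>_def by simp
  have cap: "\<exists>s0>0. \<forall>s. \<bar>s\<bar> \<le> s0 \<longrightarrow> s *\<^sub>R w \<in> \<Sigma> ` {a..b}" if w: "decaying w" for w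
  proof -
    obtain s0 where s0: "s0 > 0" "\<And>s. \<bar>s\<bar> < s0 \<Longrightarrow> \<exists>t\<in>{a..b}. \<Sigma> t = s *\<^sub>R w"
      using short_arc_captures[OF arc b(3) turn t0 w] unfolding \<Sigma>_def by blast
    have "s *\<^sub>R w \<in> \<Sigma> ` {a..b}" if "\<bar>s\<bar> \<le> s0 / 2" for s
    proof -
      have "\<bar>s\<bar> < s0" using that s0(1) by simp
      then obtain t where "t \<in> {a..b}" "\<Sigma> t = s *\<^sub>R w" using s0(2) by blast
      then show ?thesis by (metis imageI)
    qed
    then show ?thesis using s0(1) by (intro exI[of _ "s0 / 2"]) auto
  qed
  define v where "v = \<Sigma> b"
  have v0: "v \<noteq> 0"
    using inj\<Sigma> t0 in\<Sigma> unfolding v_def by (metis atLeastAtMost_iff inj_on_contraD less_imp_le order.strict_trans less_irrefl order_refl)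
  have dv: "decaying v" unfolding v_def \<Sigma>_def using t0 by (intro arc_decaying[OF arc]) auto
  have track: "continuous_on {-s0..s0} (\<lambda>s. \<Theta> (s *\<^sub>R w))" if "\<forall>s. \<bar>s\<bar> \<le> s0 \<longrightarrow> s *\<^sub>R w \<in> \<Sigma> ` {a..b}" for s0 w
    by (rule continuous_on_compose2[OF cont\<Theta>]) (use that in \<open>auto intro!: continuous_intros\<close>)
  have \<Sigma>\<Theta>: "\<Sigma> (\<Theta> y) = y" if "y \<in> \<Sigma> ` {a..b}" for y using that \<Theta> by auto
  have "\<exists>c. w = c *\<^sub>R v" if w: "decaying w" for w
  proof -
    obtain s0 where s0: "s0 > 0" "\<forall>s. \<bar>s\<bar> \<le> s0 \<longrightarrow> s *\<^sub>R v \<in> \<Sigma> ` {a..b}" using cap[OF dv] by blast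
    obtain s1 where s1: "s1 > 0" "\<forall>s. \<bar>s\<bar> \<le> s1 \<longrightarrow> s *\<^sub>R w \<in> \<Sigma> ` {a..b}" using cap[OF w] by blast
    define \<tau> where "\<tau> s = \<Theta> (s *\<^sub>R v)" for s
    have c\<tau>: "continuous_on {-s0..s0} \<tau>" unfolding \<tau>_def by (rule track[OF s0(2)])
    have \<tau>v: "\<Sigma> (\<tau> s) = s *\<^sub>R v" if "\<bar>s\<bar> \<le> s0" for s unfolding \<tau>_def using s0 that by (intro \<Sigma>\<Theta>) auto
    have "inj_on \<tau> {-s0..s0}"
    proof (rule inj_onI)
      fix s s' assume ss: "s \<in> {-s0..s0}" "s' \<in> {-s0..s0}" and eq: "\<tau> s = \<tau> s'"
      have "\<bar>s\<bar> \<le> s0" "\<bar>s'\<bar> \<le> s0" using ss by auto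
      then have "\<Sigma> (\<tau> s) = s *\<^sub>R v" "\<Sigma> (\<tau> s') = s' *\<^sub>R v" by (simp_all only: \<tau>v)
      with eq have "s *\<^sub>R v = s' *\<^sub>R v" by metis
      then show "s = s'" using v0 by simp
    qed
    from continuous_inj_imp_mono[OF _ _ c\<tau> this, of 0] s0
    have "\<tau> (-s0) < \<tau> 0 \<and> \<tau> 0 < \<tau> s0 \<or> \<tau> s0 < \<tau> 0 \<and> \<tau> 0 < \<tau> (-s0)" by auto
    moreover have "\<tau> 0 = t0" unfolding \<tau>_def using \<Theta>[of t0] in\<Sigma> t0 by simp
    ultimately have between: "\<tau> (-s0) < t0 \<and> t0 < \<tau> s0 \<or> \<tau> s0 < t0 \<and> t0 < \<tau> (-s0)" by simp
    \<comment> \<open>by the intermediate value theorem, the segment of \<open>v\<close> covers a neighbourhood of \<open>t0\<close>\<close>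
    have hit: "\<exists>s'. \<bar>s'\<bar> \<le> s0 \<and> \<tau> s' = y" if "min (\<tau> (-s0)) (\<tau> s0) < y" "y < max (\<tau> (-s0)) (\<tau> s0)" for y
      using IVT'[of \<tau> "-s0" y s0] IVT2'[of \<tau> s0 y "-s0"] c\<tau> s0 that between by (auto simp: min_def max_def abs_le_iff split: if_splits)
    have "((\<lambda>s. \<Theta> (s *\<^sub>R w)) \<longlongrightarrow> \<Theta> (0 *\<^sub>R w)) (at 0 within {-s1..s1})"
      using track[OF s1(2), unfolded continuous_on_def, rule_format, of 0] s1(1) by simp
    then have lim: "((\<lambda>s. \<Theta> (s *\<^sub>R w)) \<longlongrightarrow> t0) (at 0)"
      using at_within_Icc_at[of "-s1" 0 s1] s1(1) \<Theta>[of t0] in\<Sigma> t0 by simp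
    have "\<forall>\<^sub>F s in at 0. min (\<tau> (-s0)) (\<tau> s0) < \<Theta> (s *\<^sub>R w)" "\<forall>\<^sub>F s in at 0. \<Theta> (s *\<^sub>R w) < max (\<tau> (-s0)) (\<tau> s0)"
      using between by (intro order_tendstoD[OF lim]; auto)+
    moreover have "\<forall>\<^sub>F s in at 0. s \<noteq> 0 \<and> \<bar>s\<bar> \<le> s1"
      unfolding eventually_at using s1(1) by (intro exI[of _ s1]) auto
    ultimately have "\<forall>\<^sub>F s in at (0::real). s \<noteq> 0 \<and> \<bar>s\<bar> \<le> s1 \<and> min (\<tau> (-s0)) (\<tau> s0) < \<Theta> (s *\<^sub>R w) \<and> \<Theta> (s *\<^sub>R w) < max (\<tau> (-s0)) (\<tau> s0)"
      by eventually_elim auto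
    then obtain s where s: "s \<noteq> 0" "\<bar>s\<bar> \<le> s1" "min (\<tau> (-s0)) (\<tau> s0) < \<Theta> (s *\<^sub>R w)" "\<Theta> (s *\<^sub>R w) < max (\<tau> (-s0)) (\<tau> s0)"
      using eventually_happens'[OF at_neq_bot] by blast
    obtain s' where s': "\<bar>s'\<bar> \<le> s0" "\<tau> s' = \<Theta> (s *\<^sub>R w)" using hit[OF s(3,4)] by blast
    have "s *\<^sub>R w = s' *\<^sub>R v" using \<tau>v[OF s'(1)] \<Sigma>\<Theta>[of "s *\<^sub>R w"] s1(2) s(2) s'(2) by simp
    then have "w = (s' / s) *\<^sub>R v" using s(1) by (metis divide_inverse_commute scaleR_one scaleR_scaleR left_inverse)
    then show ?thesis by blast
  qed
  with v0 dv show thesis using that by blast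
qed

end

section \<open>Translations along an arc\<close>

context linearized_line_map
begin

text \<open>After finitely many steps the orbits of \<open>x\<close> and of its translate differ by a period of the line field.\<close>

definition merging :: "'a \<Rightarrow> bool"
  where "merging w \<longleftrightarrow> (\<exists>m. \<forall>n\<ge>m. \<exists>\<kappa>. \<forall>x. orb n (Hi (H x + w)) = orb n x + \<kappa> \<and> e (orb n x + \<kappa>) = e (orb n x))"

text \<open>For merging vectors this is \<open>stable_coord_cross_ratio\<close>, and both sides are continuous in the translation vector.\<close>

lemma translated_cross_ratio:
  assumes w: "f \<longlonglongrightarrow> w" "\<And>k. merging (f k)"
    and u: "unit_tangent x u" "unit_tangent (Hi (H x + w)) u'"
    and st: "stable_pair x y" "stable_pair x z"
    and st': "\<And>w. stable_pair (Hi (H x + w)) (Hi (H y + w))" "\<And>w. stable_pair (Hi (H x + w)) (Hi (H z + w))"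
  shows "\<bar>stable_coord (Hi (H x + w)) u' (Hi (H y + w))\<bar> * \<bar>stable_coord x u z\<bar> = \<bar>stable_coord (Hi (H x + w)) u' (Hi (H z + w))\<bar> * \<bar>stable_coord x u y\<bar>"
proof -
  have contHi: "continuous_on UNIV Hi" using Hi_unif by (rule uniformly_continuous_imp_continuous)
  have lim: "(\<lambda>k. Hi (H p + f k)) \<longlonglongrightarrow> Hi (H p + w)" for p
    by (rule continuous_on_tendsto_compose[OF contHi]) (auto intro!: tendsto_intros w)
  obtain U where U: "U \<longlonglongrightarrow> u'" "\<And>k. unit_tangent (Hi (H x + f k)) (U k)"
    using tangent_section[OF u(2) lim] by blast
  have eq: "\<bar>stable_coord (Hi (H x + f k)) (U k) (Hi (H y + f k))\<bar> * \<bar>stable_coord x u z\<bar> = \<bar>stable_coord (Hi (H x + f k)) (U k) (Hi (H z + f k))\<bar> * \<bar>stable_coord x u y\<bar>" for k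
  proof -
    obtain m where m: "\<And>n. n \<ge> m \<Longrightarrow> \<exists>\<kappa>. \<forall>x. orb n (Hi (H x + f k)) = orb n x + \<kappa> \<and> e (orb n x + \<kappa>) = e (orb n x)"
      using w(2)[of k] unfolding merging_def by blast
    have d: "orb n (Hi (H p + f k)) - orb n (Hi (H x + f k)) = orb n p - orb n x" if nm: "n \<ge> m" for n p
    proof -
      obtain \<kappa> where "\<forall>x. orb n (Hi (H x + f k)) = orb n x + \<kappa> \<and> e (orb n x + \<kappa>) = e (orb n x)" using m[OF nm] by blast
      then show ?thesis by simp
    qed
    have e: "e (orb n (Hi (H x + f k))) = e (orb n x)" if nm: "n \<ge> m" for n
    proof -
      obtain \<kappa> where "\<forall>x. orb n (Hi (H x + f k)) = orb n x + \<kappa> \<and> e (orb n x + \<kappa>) = e (orb n x)" using m[OF nm] by blast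
      then show ?thesis by simp
    qed
    show ?thesis by (rule stable_coord_cross_ratio[OF u(1) U(2) st st' d d e])
  qed
  have "(\<lambda>k. \<bar>stable_coord (Hi (H x + f k)) (U k) (Hi (H y + f k))\<bar> * \<bar>stable_coord x u z\<bar>) \<longlonglongrightarrow> \<bar>stable_coord (Hi (H x + w)) u' (Hi (H y + w))\<bar> * \<bar>stable_coord x u z\<bar>"
    by (intro tendsto_intros stable_coord_tendsto_along lim U u st')
  moreover have "(\<lambda>k. \<bar>stable_coord (Hi (H x + f k)) (U k) (Hi (H z + f k))\<bar> * \<bar>stable_coord x u y\<bar>) \<longlonglongrightarrow> \<bar>stable_coord (Hi (H x + w)) u' (Hi (H z + w))\<bar> * \<bar>stable_coord x u y\<bar>"
    by (intro tendsto_intros stable_coord_tendsto_along lim U u st')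
  ultimately show ?thesis unfolding eq by (rule LIMSEQ_unique)
qed

lemma continuous_inj_increasing:
  fixes \<sigma> :: "real \<Rightarrow> real"
  assumes cont: "continuous_on {a..b} \<sigma>" and inj: "inj_on \<sigma> {a..b}" and lt: "\<sigma> a < \<sigma> b"
  shows "strict_mono_on {a..b} \<sigma>"
proof (rule strict_mono_onI)
  fix s t assume st: "s \<in> {a..b}" "t \<in> {a..b}" "s < t"
  have mid: "\<sigma> a < \<sigma> x \<and> \<sigma> x < \<sigma> b" if "a < x" "x < b" for x
    using continuous_inj_imp_mono[OF that cont inj] lt by auto
  show "\<sigma> s < \<sigma> t"
  proof (cases "s = a")
    case True
    then show ?thesis using mid[of t] lt st by (cases "t = b") auto
  next
    case False
    then have s: "a < s" "s < b" using st by auto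
    show ?thesis
    proof (cases "t = b")
      case True then show ?thesis using mid[OF s] by simp
    next
      case False
      have "continuous_on {s..b} \<sigma>" "inj_on \<sigma> {s..b}"
        using s by (auto intro!: continuous_on_subset[OF cont] inj_on_subset[OF inj])
      then have "\<sigma> s < \<sigma> t \<and> \<sigma> t < \<sigma> b \<or> \<sigma> b < \<sigma> t \<and> \<sigma> t < \<sigma> s"
        using continuous_inj_imp_mono[of s t b \<sigma>] False st by auto
      then show ?thesis using mid[OF s] by auto
    qed
  qed
qed

context
  fixes v :: 'a and \<delta> :: real
  assumes v: "v \<noteq> 0" "\<And>w. decaying w \<Longrightarrow> \<exists>c. w = c *\<^sub>R v"
    and approx: "\<And>c r. 0 < r \<Longrightarrow> \<exists>w. norm (w - c *\<^sub>R v) < r \<and> merging w"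
    and \<delta>: "0 < \<delta>" "\<delta> \<le> \<epsilon>"
      "\<And>x y w. (\<And>n. dist (orb n x) (orb n y) < \<delta>) \<Longrightarrow> stable_pair (Hi (H x + w)) (Hi (H y + w))"
begin

text \<open>Along the arc, \<open>H\<close> moves on a line with some parameter \<open>\<sigma>\<close>. Translation by the vector of parameter \<open>\<sigma> s\<close> maps \<open>C t\<close>
to the point of the arc with parameter \<open>\<sigma> t + \<sigma> s\<close>, as long as that point exists. By \<open>translated_cross_ratio\<close> it
preserves ratios of the affine coordinate, so \<open>reparametrization_C1_Hoelder\<close> applies.\<close>

lemma short_arc_C1_Hoelder_initial:
  assumes arc: "tangent_arc C C' a b" and short: "b - a < \<delta>" and coh: "coherent C' a b"
    and m: "a \<le> m" "m < b"
  shows "C1_Hoelder_on \<alpha> a m (\<lambda>t. H (C t))"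
proof -
  have short': "b - a \<le> \<epsilon>" using short \<delta> by simp
  note arc_facts = arc_stable[OF arc short' coh] arc_tangent[OF arc short' coh] arc_ab[OF arc short' coh]
  have ab: "a < b" and aa: "a \<in> {a..b}" and bb: "b \<in> {a..b}" using arc_facts(3) by auto
  define P where "P = arc_coord C C' a"
  define \<rho> where "\<rho> = arc_dens C a"
  have P0: "P a = 0" unfolding P_def by (rule arc_coord_0[OF arc short' coh])
  have Pmono: "P s \<le> P t" if "s \<in> {a..b}" "t \<in> {a..b}" "s \<le> t" for s t
    using arc_coord_mono[OF arc short' coh, of s t] that unfolding P_def by (cases "s = t") auto
  have dP: "(P has_real_derivative \<rho> t) (at t within {a..b})" if "t \<in> {a..b}" for t
    unfolding P_def \<rho>_def by (rule arc_coord_deriv[OF arc short' coh that])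
  have \<rho>pos: "0 < \<rho> t" for t unfolding \<rho>_def by (subst arc_dens_def[OF arc short' coh]) simp
  obtain Lc where \<rho>H: "\<And>s t. s \<in> {a..b} \<Longrightarrow> t \<in> {a..b} \<Longrightarrow> \<bar>\<rho> s - \<rho> t\<bar> \<le> Lc * \<bar>s - t\<bar> powr \<alpha>"
    using arc_dens_Hoelder[OF arc short' coh] unfolding \<rho>_def by metis
  have injH: "inj H" by (metis Hi_H injI)
  define \<sigma>0 where "\<sigma>0 t = ((H (C t) - H (C a)) \<bullet> v) / (v \<bullet> v)" for t
  have \<sigma>0: "H (C t) - H (C a) = \<sigma>0 t *\<^sub>R v" if t: "t \<in> {a..b}" for t
  proof -
    obtain c where "H (C t) - H (C a) = c *\<^sub>R v" using v(2) arc_decaying[OF arc t aa] by blast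
    then show ?thesis unfolding \<sigma>0_def using v(1) by simp
  qed
  have inj\<sigma>0: "inj_on \<sigma>0 {a..b}"
  proof (rule inj_onI)
    fix s t assume st: "s \<in> {a..b}" "t \<in> {a..b}" "\<sigma>0 s = \<sigma>0 t"
    then have "H (C s) - H (C a) = H (C t) - H (C a)" using \<sigma>0 by simp
    then have "C s = C t" using injH by (auto dest: injD)
    then show "s = t" using arc_inj[OF arc short' coh] st by (auto dest: inj_onD)
  qed
  have cont\<sigma>0: "continuous_on {a..b} \<sigma>0"
    unfolding \<sigma>0_def using v(1)
    by (intro continuous_intros continuous_on_compose2[OF uniformly_continuous_imp_continuous[OF H_unif] tangent_arc_continuous[OF arc]]) auto
  have \<sigma>0a: "\<sigma>0 a = 0" unfolding \<sigma>0_def by simp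
  have \<sigma>0b: "\<sigma>0 b \<noteq> 0" using inj\<sigma>0 aa bb ab \<sigma>0a by (metis inj_onD less_irrefl)
  \<comment> \<open>orients \<open>v\<close> so that the parameter increases along the arc\<close>
  define \<theta> where "\<theta> = sgn (\<sigma>0 b)"
  define \<sigma> where "\<sigma> t = \<theta> * \<sigma>0 t" for t
  have \<theta>: "\<theta> * \<theta> = 1" "\<theta> \<noteq> 0" unfolding \<theta>_def using \<sigma>0b by (auto simp: sgn_real_def)
  have \<sigma>: "H (C t) = H (C a) + \<sigma> t *\<^sub>R (\<theta> *\<^sub>R v)" if "t \<in> {a..b}" for t
  proof -
    have "\<sigma> t * \<theta> = \<sigma>0 t" unfolding \<sigma>_def using \<theta>(1) by (simp add: mult.commute mult.left_commute)
    then have eq: "\<sigma> t *\<^sub>R (\<theta> *\<^sub>R v) = \<sigma>0 t *\<^sub>R v" by (simp only: scaleR_scaleR)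
    show ?thesis unfolding eq \<sigma>0[OF that, symmetric] by simp
  qed
  have "\<sigma> a < \<sigma> b" unfolding \<sigma>_def \<theta>_def \<sigma>0a using \<sigma>0b by (simp add: sgn_real_def)
  then have \<sigma>mono: "strict_mono_on {a..b} \<sigma>"
    using inj\<sigma>0 \<theta>(2) cont\<sigma>0 unfolding \<sigma>_def
    by (intro continuous_inj_increasing) (auto simp: inj_on_def intro!: continuous_intros)
  have \<sigma>le: "s \<le> t" if "s \<in> {a..b}" "t \<in> {a..b}" "\<sigma> s \<le> \<sigma> t" for s t
    using strict_mono_onD[OF \<sigma>mono that(2,1)] that(3) by (meson not_le)
  have \<sigma>0': "0 \<le> \<sigma> t" if "t \<in> {a..b}" for t
    using strict_mono_onD[OF \<sigma>mono aa that] that \<sigma>0a unfolding \<sigma>_def by (cases "t = a") auto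
  have cross: "(P q - P s) * P t' = (P q' - P s) * P t"
    if st: "s \<in> {a..b}" "t \<in> {a..b}" "t' \<in> {a..b}" "q \<in> {a..b}" "q' \<in> {a..b}"
      and add: "\<sigma> q = \<sigma> t + \<sigma> s" "\<sigma> q' = \<sigma> t' + \<sigma> s" for s t t' q q'
  proof -
    define w where "w = \<sigma> s *\<^sub>R (\<theta> *\<^sub>R v)"
    \<comment> \<open>translation by \<open>w\<close> maps the arc along itself\<close>
    have shift: "Hi (H (C p) + w) = C p'" if "p \<in> {a..b}" "p' \<in> {a..b}" "\<sigma> p' = \<sigma> p + \<sigma> s" for p p'
    proof -
      have "H (C p) + w = H (C p')" unfolding w_def \<sigma>[OF that(1)] \<sigma>[OF that(2)] that(3) by (simp add: scaleR_add_left distrib_right)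
      then show ?thesis by (simp add: Hi_H)
    qed
    have "\<sigma> a = 0" unfolding \<sigma>_def \<sigma>0a by simp
    then have sa: "Hi (H (C a) + w) = C s" using shift[OF aa st(1)] by simp
    have "\<exists>w'. norm (w' - w) < inverse (real (Suc k)) \<and> merging w'" for k
      using approx[of "inverse (real (Suc k))" "\<sigma> s * \<theta>"] unfolding w_def by simp
    then obtain f where f: "\<And>k. norm (f k - w) < inverse (real (Suc k))" "\<And>k. merging (f k)" by metis
    have "f \<longlonglongrightarrow> w"
    proof (rule LIM_zero_cancel, rule Lim_null_comparison)
      show "\<forall>\<^sub>F k in sequentially. norm (f k - w) \<le> inverse (real (Suc k))" using f(1) by (simp add: less_imp_le)
    qed (rule LIMSEQ_inverse_real_of_nat)
    moreover have st2: "stable_pair (Hi (H (C a) + z)) (Hi (H (C p) + z))" if "p \<in> {a..b}" for p z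
    proof (rule \<delta>(3))
      fix n show "dist (orb n (C a)) (orb n (C p)) < \<delta>"
        using tangent_arc_stays_close[OF arc aa that, of n] that short by auto
    qed
    moreover have "unit_tangent (Hi (H (C a) + w)) (C' s)" unfolding sa using arc_facts(2) st by blast
    ultimately have "\<bar>stable_coord (Hi (H (C a) + w)) (C' s) (Hi (H (C t) + w))\<bar> * \<bar>stable_coord (C a) (C' a) (C t')\<bar>
      = \<bar>stable_coord (Hi (H (C a) + w)) (C' s) (Hi (H (C t') + w))\<bar> * \<bar>stable_coord (C a) (C' a) (C t)\<bar>"
      using arc_facts st aa by (intro translated_cross_ratio[of f] f(2)) auto
    then have eq: "\<bar>stable_coord (C s) (C' s) (C q)\<bar> * \<bar>P t'\<bar> = \<bar>stable_coord (C s) (C' s) (C q')\<bar> * \<bar>P t\<bar>"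
      unfolding sa shift[OF st(2,4) add(1)] shift[OF st(3,5) add(2)] P_def arc_coord_def[OF arc short' coh] .
    have cc: "P p - P s = \<rho> s * stable_coord (C s) (C' s) (C p)" if "p \<in> {a..b}" for p
      unfolding P_def \<rho>_def by (rule arc_cocycle[OF arc short' coh that st(1)])
    have pos: "0 \<le> stable_coord (C s) (C' s) (C p)" if "p \<in> {a..b}" "s \<le> p" for p
    proof -
      have "0 \<le> \<rho> s * stable_coord (C s) (C' s) (C p)" using cc[OF that(1)] Pmono[OF st(1) that] by simp
      then show ?thesis using \<rho>pos[of s] by (simp add: zero_le_mult_iff)
    qed
    have "s \<le> q" "s \<le> q'" using \<sigma>le[OF st(1,4)] \<sigma>le[OF st(1,5)] add \<sigma>0' st by auto
    moreover have "0 \<le> P t" "0 \<le> P t'" using Pmono[OF aa, of t] Pmono[OF aa, of t'] st P0 by auto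
    ultimately have "stable_coord (C s) (C' s) (C q) * P t' = stable_coord (C s) (C' s) (C q') * P t"
      using eq pos st by simp
    then show ?thesis unfolding cc[OF st(4)] cc[OF st(5)] by simp
  qed
  have cont\<sigma>: "continuous_on {a..b} \<sigma>" unfolding \<sigma>_def by (intro continuous_intros cont\<sigma>0)
  have "\<sigma> a = 0" unfolding \<sigma>_def \<sigma>0a by simp
  then obtain D c where D: "\<And>t. t \<in> {a..m} \<Longrightarrow> (\<sigma> has_real_derivative D t) (at t within {a..m})"
    "\<And>s t. s \<in> {a..m} \<Longrightarrow> t \<in> {a..m} \<Longrightarrow> \<bar>D s - D t\<bar> \<le> c * \<bar>s - t\<bar> powr \<alpha>"
    using reparametrization_C1_Hoelder[OF m alpha_pos alpha_less cont\<sigma> \<sigma>mono _ dP P0 \<rho>pos \<rho>H cross] by blast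
  have 1: "((\<lambda>t. H (C t)) has_vector_derivative D t *\<^sub>R (\<theta> *\<^sub>R v)) (at t within {a..m})" if t: "t \<in> {a..m}" for t
  proof (rule has_vector_derivative_transform[OF t])
    show "((\<lambda>t. H (C a) + \<sigma> t *\<^sub>R (\<theta> *\<^sub>R v)) has_vector_derivative D t *\<^sub>R (\<theta> *\<^sub>R v)) (at t within {a..m})"
      using has_vector_derivative_scaleR[OF D(1)[OF t] has_vector_derivative_const[of "\<theta> *\<^sub>R v"]]
        has_vector_derivative_add[OF has_vector_derivative_const[of "H (C a)"]] by fastforce
    show "H (C s) = H (C a) + \<sigma> s *\<^sub>R (\<theta> *\<^sub>R v)" if "s \<in> {a..m}" for s
      by (rule \<sigma>) (use that m in auto)
  qed
  have 2: "norm (D s *\<^sub>R (\<theta> *\<^sub>R v) - D t *\<^sub>R (\<theta> *\<^sub>R v)) \<le> (c * norm (\<theta> *\<^sub>R v)) * \<bar>s - t\<bar> powr \<alpha>" if "s \<in> {a..m}" "t \<in> {a..m}" for s t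
  proof -
    have "norm (D s *\<^sub>R (\<theta> *\<^sub>R v) - D t *\<^sub>R (\<theta> *\<^sub>R v)) = \<bar>D s - D t\<bar> * norm (\<theta> *\<^sub>R v)"
      by (simp only: scaleR_diff_left[symmetric] norm_scaleR)
    also have "\<dots> \<le> (c * \<bar>s - t\<bar> powr \<alpha>) * norm (\<theta> *\<^sub>R v)" using D(2)[OF that] by (rule mult_right_mono) simp
    finally show ?thesis by (simp add: mult_ac)
  qed
  show ?thesis unfolding C1_Hoelder_on_def
    by (rule exI[of _ "\<lambda>t. D t *\<^sub>R (\<theta> *\<^sub>R v)"], rule exI[of _ "c * norm (\<theta> *\<^sub>R v)"]) (use 1 2 in blast)
qed

text \<open>The right end point is reached by reversing the arc.\<close>

lemma short_arc_C1_Hoelder: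
  assumes arc: "tangent_arc C C' a b" and short: "b - a < \<delta>" and coh: "coherent C' a b"
  shows "C1_Hoelder_on \<alpha> a b (\<lambda>t. H (C t))"
proof -
  have ab: "a < b" using arc unfolding tangent_arc_def by simp
  define x y where "x = a + (b - a) / 3" and "y = a + 2 * (b - a) / 3"
  have xy: "a < x" "x < y" "y < b" unfolding x_def y_def using ab by (auto simp: field_simps)
  have 1: "C1_Hoelder_on \<alpha> a y (\<lambda>t. H (C t))"
    using xy by (intro short_arc_C1_Hoelder_initial[OF assms]) auto
  have "coherent (\<lambda>t. - C' (- t)) (- b) (- a)" using coh unfolding coherent_def by auto
  then have "C1_Hoelder_on \<alpha> (- b) (- x) (\<lambda>t. H (C (- t)))"
    using xy short by (intro short_arc_C1_Hoelder_initial[OF tangent_arc_reverse[OF arc]]) auto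
  from C1_Hoelder_on_reverse[OF this] have 2: "C1_Hoelder_on \<alpha> x b (\<lambda>t. H (C t))" by simp
  show ?thesis using xy by (intro C1_Hoelder_on_glue[OF 1 2] alpha_pos) auto
qed

lemma arc_C1_Hoelder:
  assumes arc: "tangent_arc C C' a b"
  shows "C1_Hoelder_on \<alpha> a b (\<lambda>t. H (C t))"
proof -
  obtain r where r: "0 < r" "\<And>s t. s \<in> {a..b} \<Longrightarrow> t \<in> {a..b} \<Longrightarrow> \<bar>s - t\<bar> \<le> r \<Longrightarrow> norm (C' s - C' t) < 1"
    using arc_short_exists[OF arc zero_less_one] by metis
  show ?thesis
  proof (rule C1_Hoelder_on_from_short)
    fix p q assume pq: "a \<le> p" "p < q" "q \<le> b" "q - p \<le> min r (\<delta> / 2)"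
    have arc': "tangent_arc C C' p q" using pq by (intro tangent_arc_subinterval[OF arc]) auto
    have "coherent C' p q"
    proof (rule coherentI)
      show "norm (C' s) = 1" if "s \<in> {p..q}" for s using tangent_arc_unit[OF arc' that] by (rule unit_tangent_norm)
      show "norm (C' s - C' t) < 1" if "s \<in> {p..q}" "t \<in> {p..q}" for s t
        using that pq by (intro r(2)) auto
    qed
    then show "C1_Hoelder_on \<alpha> p q (\<lambda>t. H (C t))"
      using pq \<delta>(1) by (intro short_arc_C1_Hoelder[OF arc']) auto
  qed (use r \<delta> arc alpha_pos in \<open>auto simp: tangent_arc_def\<close>)
qed

end

end

section \<open>Integer matrices with irreducible characteristic polynomial\<close>

definition eval_rat :: "real \<Rightarrow> rat poly \<Rightarrow> real"
  where "eval_rat x p = poly (map_poly of_rat p) x"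

lemma eval_rat_simps [simp]: "eval_rat x 0 = 0" "eval_rat x (pCons c p) = of_rat c + x * eval_rat x p"
  unfolding eval_rat_def by (simp_all add: map_poly_pCons)

lemma eval_rat_1 [simp]: "eval_rat x 1 = 1"
  by (simp add: one_pCons)

lemma eval_rat_add: "eval_rat x (p + q) = eval_rat x p + eval_rat x q"
proof (induction p q rule: poly_induct2)
  case (pCons a p b q)
  then show ?case by (simp add: of_rat_add algebra_simps)
qed simp

lemma eval_rat_smult: "eval_rat x (smult c p) = of_rat c * eval_rat x p"
  by (induction p) (simp_all add: of_rat_mult algebra_simps)

lemma eval_rat_mult: "eval_rat x (p * q) = eval_rat x p * eval_rat x q"
  by (induction p) (simp_all add: eval_rat_add eval_rat_smult algebra_simps)

lemma eval_rat_uminus: "eval_rat x (- p) = - eval_rat x p"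
  using eval_rat_add[of x p "- p"] by simp

lemma eval_rat_sum: "eval_rat x (\<Sum>i\<in>S. f i) = (\<Sum>i\<in>S. eval_rat x (f i))"
  by (induction S rule: infinite_finite_induct) (simp_all add: eval_rat_add)

lemma eval_rat_prod: "eval_rat x (\<Prod>i\<in>S. f i) = (\<Prod>i\<in>S. eval_rat x (f i))"
  by (induction S rule: infinite_finite_induct) (simp_all add: eval_rat_mult)

lemma eval_rat_monom: "eval_rat x (monom c n) = of_rat c * x ^ n"
  by (induction n) (simp_all add: monom_0 monom_Suc)

lemma eval_rat_sign: "eval_rat x (of_int (sign p)) = of_int (sign p)"
  by (simp add: sign_def eval_rat_uminus)

lemma eval_rat_det: "eval_rat x (det M) = det (\<chi> i j. eval_rat x (M $ i $ j))" for M :: "rat poly ^ 'n ^ 'n"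
  unfolding det_def by (simp add: eval_rat_sum eval_rat_mult eval_rat_prod eval_rat_sign)

lemma charpoly_root:
  fixes A :: "int ^ 'n ^ 'n"
  assumes "map_matrix real_of_int A *v v = l *\<^sub>R v" "v \<noteq> 0"
  shows "eval_rat l (rat_charpoly A) = 0"
proof -
  define N where "N = mat l - map_matrix real_of_int A"
  have "(\<chi> i j. eval_rat l ((mat [:0, 1:] - map_matrix (\<lambda>a. [:rat_of_int a:]) A) $ i $ j)) = N"
    unfolding N_def vec_eq_iff
    by (auto simp: mat_def map_matrix_def eval_rat_add[of _ _ "- _", simplified] eval_rat_uminus of_rat_minus)
  then have "eval_rat l (rat_charpoly A) = det N"
    unfolding rat_charpoly_def eval_rat_det by simp
  moreover have "N *v v = 0"
    unfolding N_def matrix_vector_mult_diff_rdistrib assms(1)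
    by (simp add: vec_eq_iff mat_def matrix_vector_mult_def if_distrib[of "\<lambda>z. z * _"] cong: if_cong)
  then have "det N = 0"
    using assms(2) invertible_det_nz[of N] matrix_left_invertible_ker[of N] invertible_left_inverse[of N] by blast
  ultimately show ?thesis by simp
qed

text \<open>The nonzero polynomial of least degree that vanishes at \<open>x\<close> divides \<open>f\<close>, so it is \<open>f\<close> up to a unit.\<close>

lemma degree_irreducible_le:
  assumes irr: "irreducible f" and f: "eval_rat x f = 0" and p: "p \<noteq> 0" "eval_rat x p = 0"
  shows "degree f \<le> degree p"
proof -
  define P where "P q \<longleftrightarrow> q \<noteq> 0 \<and> eval_rat x q = 0" for q
  obtain m where m: "P m" "\<And>q. P q \<Longrightarrow> degree m \<le> degree q"
    using p ex_has_least_nat[of P p degree] unfolding P_def by blast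
  have "m dvd f"
  proof (rule ccontr)
    assume n: "\<not> m dvd f"
    have r: "f mod m \<noteq> 0" using n by (simp add: mod_eq_0_iff_dvd)
    have "eval_rat x f = eval_rat x (f div m * m) + eval_rat x (f mod m)"
      by (subst eval_rat_add[symmetric]) simp
    then have "eval_rat x (f mod m) = 0" using m(1) f unfolding P_def by (simp add: eval_rat_mult)
    then have "degree m \<le> degree (f mod m)" using r by (intro m(2)) (simp add: P_def)
    moreover have "degree (f mod m) < degree m" using m(1) n by (intro degree_mod_less_degree) (auto simp: P_def)
    ultimately show False by simp
  qed
  then obtain k where k: "f = m * k" by (auto elim: dvdE)
  have "\<not> is_unit m"
  proof
    assume "is_unit m"
    then obtain m' where "1 = m * m'" by (auto elim: dvdE)
    then have "eval_rat x 1 = eval_rat x m * eval_rat x m'" unfolding eval_rat_mult[symmetric] by simp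
    then show False using m(1) by (simp add: P_def)
  qed
  then have "is_unit k" using irreducibleD[OF irr k] by blast
  then have "degree k = 0" by (metis is_unit_iff_degree not_is_unit_0)
  then have "degree f \<le> degree m" using k degree_mult_le[of m k] by simp
  then show ?thesis using m(2)[of p] p by (simp add: P_def)
qed

text \<open>The product over the diagonal is monic of degree \<open>CARD('n)\<close>. Every other permutation moves some index and
contributes fewer linear factors.\<close>

lemma degree_rat_charpoly:
  fixes A :: "int ^ 'n ^ 'n"
  shows "CARD('n) \<le> degree (rat_charpoly A)"
proof -
  define M where "M = mat [:0, 1:] - map_matrix (\<lambda>a. [:rat_of_int a:]) A"
  have M1: "M $ i $ i = [: - rat_of_int (A $ i $ i), 1:]" for i
    unfolding M_def by (simp add: mat_def map_matrix_def)
  have M2: "degree (M $ i $ j) = 0" if "i \<noteq> j" for i j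
    unfolding M_def using that by (simp add: mat_def map_matrix_def)
  define t where "t p = of_int (sign p) * (\<Prod>i\<in>UNIV. M $ i $ p i)" for p
  have nonid: "coeff (t p) CARD('n) = 0" if p: "p permutes UNIV" "p \<noteq> id" for p
  proof (rule coeff_eq_0)
    obtain i0 where i0: "p i0 \<noteq> i0" using p(2) by (metis eq_id_iff)
    have "degree (t p) \<le> degree (of_int (sign p) :: rat poly) + degree (\<Prod>i\<in>UNIV. M $ i $ p i)"
      unfolding t_def by (rule degree_mult_le)
    also have "degree (of_int (sign p) :: rat poly) = 0" by simp
    also have "degree (\<Prod>i\<in>UNIV. M $ i $ p i) \<le> (\<Sum>i\<in>UNIV. degree (M $ i $ p i))"
      using degree_prod_sum_le[of UNIV "\<lambda>i. M $ i $ p i"] by (simp add: o_def)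
    also have "\<dots> \<le> (\<Sum>i\<in>UNIV. if i = i0 then 0 else 1)"
    proof (rule sum_mono)
      fix i show "degree (M $ i $ p i) \<le> (if i = i0 then 0 else 1)"
        using i0 M1[of i] M2[of i "p i"] by (cases "p i = i") auto
    qed
    also have "\<dots> = card (UNIV - {i0})" by (simp add: sum.If_cases Compl_eq_Diff_UNIV)
    also have "\<dots> < CARD('n)" by (rule psubset_card_mono) auto
    finally show "degree (t p) < CARD('n)" by simp
  qed
  have "coeff (t id) CARD('n) = 1"
  proof -
    have "degree (\<Prod>i\<in>UNIV. M $ i $ i) = (\<Sum>i\<in>(UNIV::'n set). degree (M $ i $ i))"
      by (rule degree_prod_eq_sum_degree) (simp add: M1)
    then have "degree (\<Prod>i\<in>UNIV. M $ i $ i) = CARD('n)" by (simp add: M1)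
    moreover have "lead_coeff (\<Prod>i\<in>UNIV. M $ i $ i) = 1" unfolding lead_coeff_prod by (simp add: M1)
    ultimately show ?thesis unfolding t_def by simp
  qed
  moreover have "rat_charpoly A = (\<Sum>p\<in>{p. p permutes UNIV}. t p)"
    unfolding rat_charpoly_def det_def t_def M_def ..
  moreover have "(\<Sum>p\<in>{p. p permutes (UNIV :: 'n set)}. coeff (t p) CARD('n)) = coeff (t id) CARD('n)"
    using nonid by (subst sum.remove[of _ id]) (auto simp: finite_permutations permutes_id intro!: sum.neutral)
  ultimately have "coeff (rat_charpoly A) CARD('n) = 1" by (simp add: coeff_sum)
  then show ?thesis by (intro le_degree) simp
qed

lemma int_vec_minus: "int_vec (- n) = - int_vec n"
  and int_vec_diff: "int_vec (m - n) = int_vec m - int_vec n"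
  and int_vec_0 [simp]: "int_vec 0 = 0"
  by (simp_all add: int_vec_def vec_eq_iff)

lemma int_vec_inj: "int_vec m = int_vec n \<longleftrightarrow> m = n"
  by (simp add: int_vec_def vec_eq_iff)

lemma int_vec_mult: "map_matrix real_of_int A *v int_vec n = int_vec (A *v n)"
  by (simp add: int_vec_def vec_eq_iff matrix_vector_mult_def map_matrix_def)

lemma int_vec_vmult: "int_vec n v* map_matrix real_of_int A = int_vec (n v* A)"
  by (simp add: int_vec_def vec_eq_iff vector_matrix_mult_def map_matrix_def)

lemma vmult_pow_inner:
  assumes "map_matrix real_of_int A *v v = l *\<^sub>R v"
  shows "int_vec (((\<lambda>z. z v* A) ^^ k) \<xi>) \<bullet> v = l ^ k * (int_vec \<xi> \<bullet> v)"
  by (induction k) (simp_all add: int_vec_vmult[symmetric] dot_lmul_matrix assms)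

lemma det_of_int: "det (map_matrix of_int M) = (of_int (det M) :: 'a::comm_ring_1)"
  unfolding det_def by (simp add: map_matrix_def)

text \<open>The determinant of the matrix with columns \<open>\<xi>\<close>, \<open>\<xi> v* A\<close>, \<open>\<xi> v* A v* A\<close>, \<open>\<dots>\<close> is an integer, and it is multiplied
by \<open>det A\<close> when \<open>\<xi>\<close> is replaced by \<open>\<xi> v* A\<close>. For an infinitely divisible \<open>\<xi>\<close> it is divisible by all powers of
\<open>det A\<close>, so it is zero. A linear relation between the columns yields a nonzero polynomial \<open>p\<close> of degree less than
\<open>CARD('n)\<close> such that \<open>p\<close> evaluated at \<open>l\<close>, times \<open>int_vec \<xi> \<bullet> v\<close>, is zero. The first factor is nonzero, because
\<open>l\<close> is a root of an irreducible polynomial of larger degree.\<close>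

lemma infinitely_divisible_orthogonal:
  fixes A :: "int ^ 'n ^ 'n" and \<xi> :: "int ^ 'n"
  assumes irr: "irreducible (rat_charpoly A)" and v: "map_matrix real_of_int A *v v = l *\<^sub>R v" "v \<noteq> 0"
    and d: "2 \<le> \<bar>det A\<bar>" and div: "\<And>n. \<exists>\<zeta>. \<xi> = ((\<lambda>z. z v* A) ^^ n) \<zeta>"
  shows "int_vec \<xi> \<bullet> v = 0"
proof (rule ccontr)
  assume ne: "int_vec \<xi> \<bullet> v \<noteq> 0"
  let ?B = "\<lambda>z. z v* A"
  obtain f :: "'n \<Rightarrow> nat" where f: "bij_betw f UNIV {..<CARD('n)}"
    using ex_bij_betw_finite_nat[of "UNIV :: 'n set"] by (auto simp: atLeast0LessThan)
  \<comment> \<open>the columns are the iterates of \<open>\<zeta>\<close>; the bijection \<open>f\<close> orders the index type\<close>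
  define M where "M \<zeta> = (\<chi> i j. (?B ^^ f j) \<zeta> $ i)" for \<zeta> :: "int ^ 'n"
  have M_B: "M (?B \<zeta>) = transpose A ** M \<zeta>" for \<zeta>
  proof -
    have "(?B ^^ k) (?B \<zeta>) = ?B ((?B ^^ k) \<zeta>)" for k by (rule funpow_swap1[symmetric])
    moreover have "(w v* A) $ i = (\<Sum>k\<in>UNIV. transpose A $ i $ k * w $ k)" for w i
      by (simp add: vector_matrix_mult_def transpose_def mult.commute)
    ultimately show ?thesis unfolding M_def vec_eq_iff by (simp only: matrix_matrix_mult_def vec_lambda_beta) simp
  qed
  have "det (M ((?B ^^ n) \<zeta>)) = det A ^ n * det (M \<zeta>)" for n \<zeta>
    by (induction n) (simp_all add: M_B det_mul)
  then have dvd: "det A ^ n dvd det (M \<xi>)" for n using div[of n] by auto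
  have det0: "det (M \<xi>) = 0"
  proof (rule ccontr)
    assume nz: "det (M \<xi>) \<noteq> 0"
    define n where "n = nat \<bar>det (M \<xi>)\<bar>"
    have "\<bar>det A ^ n\<bar> \<le> \<bar>det (M \<xi>)\<bar>" using dvd nz by (rule dvd_imp_le_int[rotated])
    moreover have "int (2 ^ n) \<le> \<bar>det A ^ n\<bar>" using power_mono[OF d, of n] by (simp add: power_abs)
    moreover have "int n < int (2 ^ n)" by (simp only: of_nat_less_iff less_exp)
    ultimately show False unfolding n_def by linarith
  qed
  define N where "N = map_matrix rat_of_int (M \<xi>)"
  have "det N = 0" unfolding N_def det_of_int det0 by simp
  then obtain c where c: "N *v c = 0" "c \<noteq> 0"
    using invertible_det_nz[of N] matrix_left_invertible_ker[of N] invertible_left_inverse[of N] by blast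
  define p where "p = (\<Sum>j\<in>UNIV. monom (c $ j) (f j))"
  have "coeff p (f j) = c $ j" for j
  proof -
    have "coeff p (f j) = (\<Sum>i\<in>UNIV. if i = j then c $ i else 0)"
      unfolding p_def coeff_sum coeff_monom using f by (intro sum.cong) (auto dest: bij_betw_imp_inj_on injD)
    then show ?thesis by simp
  qed
  then have p0: "p \<noteq> 0" using c(2) by (auto simp: vec_eq_iff)
  have "degree p < CARD('n)"
  proof -
    have "degree p \<le> CARD('n) - 1"
      unfolding p_def
    proof (rule degree_sum_le)
      fix j :: 'n
      have "f j < CARD('n)" using f by (auto simp: bij_betw_def)
      then show "degree (monom (c $ j) (f j)) \<le> CARD('n) - 1"
        using degree_monom_le[of "c $ j" "f j"] by linarith
    qed simp
    moreover have "0 < CARD('n)" by simp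
    ultimately show ?thesis by linarith
  qed
  moreover have "eval_rat l p = 0"
  proof -
    have "(\<Sum>j\<in>UNIV. of_rat (c $ j) * real_of_int ((?B ^^ f j) \<xi> $ i)) = 0" for i
    proof -
      have "(N *v c) $ i = 0" using c by simp
      then have "(\<Sum>j\<in>UNIV. rat_of_int ((?B ^^ f j) \<xi> $ i) * c $ j) = 0"
        by (simp add: N_def M_def matrix_vector_mult_def map_matrix_def)
      then have "of_rat (\<Sum>j\<in>UNIV. rat_of_int ((?B ^^ f j) \<xi> $ i) * c $ j) = (0 :: real)" by simp
      then show ?thesis by (simp add: of_rat_sum of_rat_mult mult.commute)
    qed
    then have "(\<Sum>j\<in>UNIV. (of_rat (c $ j) :: real) *\<^sub>R int_vec ((?B ^^ f j) \<xi>)) = 0"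
      by (simp add: vec_eq_iff int_vec_def)
    then have "(\<Sum>j\<in>UNIV. (of_rat (c $ j) :: real) *\<^sub>R int_vec ((?B ^^ f j) \<xi>)) \<bullet> v = 0" by simp
    then have "(\<Sum>j\<in>UNIV. of_rat (c $ j) * (l ^ f j * (int_vec \<xi> \<bullet> v))) = 0"
      by (simp add: inner_sum_left vmult_pow_inner[OF v(1)])
    then have "(\<Sum>j\<in>UNIV. of_rat (c $ j) * l ^ f j) * (int_vec \<xi> \<bullet> v) = 0"
      by (simp add: sum_distrib_right mult.assoc)
    then show ?thesis using ne unfolding p_def eval_rat_sum eval_rat_monom by simp
  qed
  ultimately show False
    using degree_irreducible_le[OF irr charpoly_root[OF v] p0] degree_rat_charpoly[of A] by simp
qed

text \<open>By Cramer's rule the entries of the inverse are integers divided by the determinant.\<close>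

lemma inverse_denominator:
  fixes A :: "int ^ 'n ^ 'n"
  assumes d: "det A \<noteq> 0"
  obtains R where "map_matrix real_of_int A ** R = mat 1" "R ** map_matrix real_of_int A = mat 1"
    "\<And>n. \<exists>k. real_of_int (det A) *\<^sub>R (R *v int_vec n) = int_vec k"
    "\<And>n. \<exists>k. real_of_int (det A) *\<^sub>R (int_vec n v* R) = int_vec k"
proof -
  let ?A = "map_matrix real_of_int A"
  have dA: "det ?A \<noteq> 0" using d by (simp add: det_of_int)
  then have "invertible ?A" by (simp add: invertible_det_nz)
  then obtain R where R: "?A ** R = mat 1" "R ** ?A = mat 1" unfolding invertible_def by blast
  have "\<exists>q. real_of_int (det A) * (R $ i $ j) = of_int q" for i j
  proof -
    define b :: "real ^ 'n" where "b = axis j 1"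
    have "?A *v (R *v b) = b" by (simp add: matrix_vector_mul_assoc R)
    then have "R *v b = (\<chi> k. det (\<chi> i j. if j = k then b $ i else ?A $ i $ j) / det ?A)"
      using cramer[OF dA] by blast
    then have "(R *v b) $ i = det (\<chi> i' j. if j = i then b $ i' else ?A $ i' $ j) / det ?A" by simp
    moreover have "(R *v b) $ i = R $ i $ j"
      by (simp add: b_def matrix_vector_mul_component inner_axis)
    moreover have "(\<chi> i' j'. if j' = i then b $ i' else ?A $ i' $ j') = map_matrix real_of_int (\<chi> i' j'. if j' = i then (if i' = j then 1 else 0) else A $ i' $ j')"
      unfolding b_def by (auto simp: vec_eq_iff map_matrix_def axis_def)
    ultimately have "real_of_int (det A) * (R $ i $ j) = of_int (det (\<chi> i' j'. if j' = i then (if i' = j then 1 else 0) else A $ i' $ j'))"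
      using d by (simp add: det_of_int)
    then show ?thesis by blast
  qed
  then obtain Q where Q: "\<And>i j. real_of_int (det A) * (R $ i $ j) = of_int (Q i j)" by metis
  have "real_of_int (det A) *\<^sub>R (R *v int_vec n) = int_vec (\<chi> i. \<Sum>j\<in>UNIV. Q i j * n $ j)" for n
    by (simp add: vec_eq_iff int_vec_def matrix_vector_mult_def sum_distrib_left mult.assoc[symmetric] Q)
  moreover have "real_of_int (det A) *\<^sub>R (int_vec n v* R) = int_vec (\<chi> j. \<Sum>i\<in>UNIV. Q i j * n $ i)" for n
    by (simp add: vec_eq_iff int_vec_def vector_matrix_mult_def sum_distrib_left Q[symmetric] mult_ac)
  ultimately show thesis using that[OF R] by blast
qed

section \<open>Preimages of the integer lattice near the stable line\<close>

definition e2pi :: "real \<Rightarrow> complex" where "e2pi x = cis (2 * pi * x)"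

lemma e2pi_add: "e2pi (x + y) = e2pi x * e2pi y"
  unfolding e2pi_def by (simp add: cis_mult ring_distribs)

lemma e2pi_sum: "e2pi (\<Sum>i\<in>S. f i) = (\<Prod>i\<in>S. e2pi (f i))"
  by (induction S rule: infinite_finite_induct) (simp_all add: e2pi_add, simp_all add: e2pi_def)

lemma e2pi_power: "e2pi x ^ n = e2pi (real n * x)"
  unfolding e2pi_def by (simp add: Complex.DeMoivre mult_ac)

lemma e2pi_eq_1: "e2pi x = 1 \<longleftrightarrow> x \<in> \<int>"
proof -
  have "e2pi x = 1 \<longleftrightarrow> cos (2 * pi * x) = 1"
  proof
    assume "cos (2 * pi * x) = 1"
    then have "sin (2 * pi * x) = 0" by (simp add: cos_one_sin_zero)
    then show "e2pi x = 1" using \<open>cos (2 * pi * x) = 1\<close> unfolding e2pi_def by (simp add: complex_eq_iff)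
  qed (simp add: e2pi_def complex_eq_iff)
  also have "\<dots> \<longleftrightarrow> (\<exists>n::int. 2 * pi * x = real_of_int n * 2 * pi)" by (rule cos_one_2pi_int)
  also have "\<dots> \<longleftrightarrow> x \<in> \<int>" by (auto simp: Ints_def)
  finally show ?thesis .
qed

lemma character_sum:
  assumes m: "0 < m" and x: "real m * x \<in> \<int>"
  shows "(\<Sum>k<m. e2pi (real k * x)) = (if x \<in> \<int> then of_nat m else 0)"
proof (cases "x \<in> \<int>")
  case True
  then have "e2pi (real k * x) = 1" for k by (simp add: e2pi_eq_1)
  then show ?thesis using True by simp
next
  case False
  then have ne: "e2pi x \<noteq> 1" by (simp add: e2pi_eq_1)
  have "(\<Sum>k<m. e2pi (real k * x)) = (\<Sum>k<m. e2pi x ^ k)" by (simp add: e2pi_power)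
  also have "\<dots> = (e2pi x ^ m - 1) / (e2pi x - 1)" using ne by (simp add: geometric_sum)
  also have "e2pi x ^ m = 1" using x by (simp add: e2pi_power e2pi_eq_1)
  finally show ?thesis using False by simp
qed

lemma character_sum_box:
  fixes \<eta> :: "real ^ 'n"
  assumes m: "0 < m" and x: "\<And>i. real m * \<eta> $ i \<in> \<int>"
  shows "(\<Sum>k\<in>(UNIV :: 'n set) \<rightarrow>\<^sub>E {..<m}. e2pi (\<eta> \<bullet> (\<chi> i. real (k i))))
    = (if \<forall>i. \<eta> $ i \<in> \<int> then of_nat m ^ CARD('n) else 0)"
proof -
  have "(\<Sum>k\<in>(UNIV :: 'n set) \<rightarrow>\<^sub>E {..<m}. e2pi (\<eta> \<bullet> (\<chi> i. real (k i))))
    = (\<Sum>k\<in>(UNIV :: 'n set) \<rightarrow>\<^sub>E {..<m}. \<Prod>i\<in>UNIV. e2pi (real (k i) * \<eta> $ i))"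
    by (simp add: inner_vec_def e2pi_sum mult.commute)
  also have "\<dots> = (\<Prod>i\<in>UNIV. \<Sum>k<m. e2pi (real k * \<eta> $ i))"
    by (rule prod_sum_PiE[symmetric]) auto
  also have "\<dots> = (\<Prod>i\<in>UNIV. if \<eta> $ i \<in> \<int> then of_nat m else 0)"
    using character_sum[OF m x] by simp
  also have "\<dots> = (if \<forall>i. \<eta> $ i \<in> \<int> then of_nat m ^ CARD('n) else 0)"
    by (auto simp: prod_zero_iff)
  finally show ?thesis .
qed

text \<open>A trigonometric polynomial with nonnegative Fourier coefficients which for large \<open>K\<close> is concentrated near the integer
lattice.\<close>

definition cos_kernel :: "nat \<Rightarrow> real ^ 'n::finite \<Rightarrow> real"
  where "cos_kernel K x = (\<Prod>i\<in>UNIV. ((1 + cos (2 * pi * x $ i)) / 2) ^ K)"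

lemma cos_kernel_factor: "complex_of_real (((1 + cos (2 * pi * y)) / 2) ^ K)
  = (\<Sum>j\<le>2*K. of_real (real ((2*K) choose j) / 4 ^ K) * e2pi ((real j - real K) * y))"
proof -
  have "complex_of_real ((1 + cos (2 * pi * y)) / 2) = (e2pi y + 1)\<^sup>2 * e2pi (- y) / 4"
  proof -
    have "(e2pi y + 1)\<^sup>2 * e2pi (- y) = e2pi y * (e2pi y * e2pi (- y)) + 2 * (e2pi y * e2pi (- y)) + e2pi (- y)"
      by (simp add: power2_eq_square algebra_simps)
    also have "e2pi y * e2pi (- y) = 1" by (simp flip: e2pi_add) (simp add: e2pi_def)
    finally show ?thesis unfolding e2pi_def by (simp add: complex_eq_iff)
  qed
  then have "complex_of_real (((1 + cos (2 * pi * y)) / 2) ^ K) = ((e2pi y + 1)\<^sup>2 * e2pi (- y) / 4) ^ K"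
    by (metis of_real_power)
  also have "\<dots> = (e2pi y + 1) ^ (2 * K) * e2pi (- (real K * y)) / 4 ^ K"
    by (simp add: power_divide power_mult_distrib power_mult e2pi_power)
  also have "(e2pi y + 1) ^ (2 * K) = (\<Sum>j\<le>2*K. of_nat ((2*K) choose j) * e2pi y ^ j)"
    by (simp add: binomial_ring)
  also have "\<dots> * e2pi (- (real K * y)) / 4 ^ K = (\<Sum>j\<le>2*K. of_real (real ((2*K) choose j) / 4 ^ K) * e2pi ((real j - real K) * y))"
    unfolding sum_distrib_right sum_divide_distrib
  proof (intro sum.cong refl)
    fix j
    have "e2pi ((real j - real K) * y) = e2pi y ^ j * e2pi (- (real K * y))"
      by (simp add: e2pi_power algebra_simps flip: e2pi_add)
    then show "of_nat ((2*K) choose j) * e2pi y ^ j * e2pi (- (real K * y)) / 4 ^ K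
      = of_real (real ((2*K) choose j) / 4 ^ K) * e2pi ((real j - real K) * y)" by simp
  qed
  finally show ?thesis .
qed

lemma cos_kernel_expansion:
  fixes x :: "real ^ 'n::finite"
  shows "complex_of_real (cos_kernel K x) = (\<Sum>g\<in>(UNIV :: 'n set) \<rightarrow>\<^sub>E {..2*K}.
    of_real (\<Prod>i\<in>UNIV. real ((2*K) choose g i) / 4 ^ K) * e2pi (int_vec (\<chi> i. int (g i) - int K) \<bullet> x))"
proof -
  have "complex_of_real (cos_kernel K x) = (\<Prod>i\<in>UNIV. \<Sum>j\<le>2*K. of_real (real ((2*K) choose j) / 4 ^ K) * e2pi ((real j - real K) * x $ i))"
    unfolding cos_kernel_def of_real_prod cos_kernel_factor ..
  also have "\<dots> = (\<Sum>g\<in>(UNIV :: 'n set) \<rightarrow>\<^sub>E {..2*K}. \<Prod>i\<in>UNIV. of_real (real ((2*K) choose g i) / 4 ^ K) * e2pi ((real (g i) - real K) * x $ i))"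
    by (rule prod_sum_PiE) auto
  also have "\<dots> = (\<Sum>g\<in>(UNIV :: 'n set) \<rightarrow>\<^sub>E {..2*K}. of_real (\<Prod>i\<in>UNIV. real ((2*K) choose g i) / 4 ^ K) * e2pi (int_vec (\<chi> i. int (g i) - int K) \<bullet> x))"
    by (simp only: prod.distrib inner_vec_def int_vec_def e2pi_sum of_real_prod) simp
  finally show ?thesis .
qed

lemma half_bounds:
  fixes c :: real
  shows "-1 \<le> c \<Longrightarrow> 0 \<le> (1 + c) / 2" "c \<le> 1 \<Longrightarrow> (1 + c) / 2 \<le> 1" "c < 1 \<Longrightarrow> (1 + c) / 2 < 1"
  by simp_all

text \<open>The threshold is a lower bound for the constant Fourier coefficient. It decays polynomially in \<open>K\<close>, whereas away
from the lattice the kernel decays exponentially.\<close>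

lemma cos_kernel_peak:
  fixes x :: "real ^ 'n::finite"
  assumes \<epsilon>: "0 < \<epsilon>" "\<epsilon> \<le> 1/2" and K: "(1 / (2 * real K)) ^ CARD('n) > ((1 + cos (2 * pi * \<epsilon>)) / 2) ^ K"
    and x: "cos_kernel K x \<ge> (1 / (2 * real K)) ^ CARD('n)"
  shows "\<exists>l. \<forall>i. \<bar>x $ i - real_of_int (l $ i)\<bar> < \<epsilon>"
proof -
  have "\<bar>x $ i - real_of_int (round (x $ i))\<bar> < \<epsilon>" for i
  proof (rule ccontr)
    define y where "y = \<bar>x $ i - real_of_int (round (x $ i))\<bar>"
    assume "\<not> \<bar>x $ i - real_of_int (round (x $ i))\<bar> < \<epsilon>"
    then have y: "\<epsilon> \<le> y" "y \<le> 1/2"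
      unfolding y_def using of_int_round_abs_le[of "x $ i"] by (auto simp: abs_minus_commute)
    have c: "0 \<le> (1 + cos z) / 2" for z :: real using half_bounds(1)[OF cos_ge_minus_one] .
    have c': "(1 + cos z) / 2 \<le> 1" for z :: real using half_bounds(2)[OF cos_le_one] .
    have "cos (2 * pi * x $ i) = cos (2 * pi * x $ i - 2 * pi * of_int (round (x $ i)))"
      by (simp add: cos_diff cos_int_2pin sin_int_2pin)
    also have "\<dots> = cos (2 * pi * y)"
    proof -
      define z where "z = x $ i - real_of_int (round (x $ i))"
      have "2 * pi * x $ i - 2 * pi * of_int (round (x $ i)) = 2 * pi * z" unfolding z_def by (rule right_diff_distrib[symmetric])
      moreover have "y = z \<or> 2 * pi * y = - (2 * pi * z)" unfolding y_def z_def[symmetric] by (auto simp: abs_if)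
      ultimately show ?thesis by (auto simp only: cos_minus)
    qed
    also have "\<dots> \<le> cos (2 * pi * \<epsilon>)"
      using y \<epsilon> by (intro cos_monotone_0_pi_le) auto
    finally have "((1 + cos (2 * pi * x $ i)) / 2) ^ K \<le> ((1 + cos (2 * pi * \<epsilon>)) / 2) ^ K"
      using c[of "2 * pi * x $ i"] by (intro power_mono) auto
    moreover have "cos_kernel K x \<le> ((1 + cos (2 * pi * x $ i)) / 2) ^ K"
    proof -
      have "cos_kernel K x = ((1 + cos (2 * pi * x $ i)) / 2) ^ K * (\<Prod>i\<in>UNIV - {i}. ((1 + cos (2 * pi * x $ i)) / 2) ^ K)"
        unfolding cos_kernel_def by (rule prod.remove) auto
      also have "\<dots> \<le> ((1 + cos (2 * pi * x $ i)) / 2) ^ K * 1"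
        using c c' by (intro mult_left_mono prod_le_1) (auto intro!: power_le_one zero_le_power simp del: divide_le_eq_1_pos)
      finally show ?thesis by simp
    qed
    ultimately show False using K x by linarith
  qed
  then show ?thesis by (intro exI[of _ "\<chi> i. round (x $ i)"]) simp
qed

lemma cos_kernel_exponent_exists:
  assumes "0 < \<epsilon>" "\<epsilon> \<le> 1/2"
  shows "\<exists>K>0. (1 / (2 * real K)) ^ d > ((1 + cos (2 * pi * \<epsilon>)) / 2) ^ K"
proof -
  define q where "q = (1 + cos (2 * pi * \<epsilon>)) / 2"
  have "cos (2 * pi * \<epsilon>) < cos 0" using assms by (intro cos_monotone_0_pi) auto
  then have q1: "q < 1" unfolding q_def cos_zero by (rule half_bounds(3))
  have q0: "0 \<le> q" unfolding q_def using half_bounds(1)[OF cos_ge_minus_one] .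
  note q = q0 q1
  have "(\<lambda>K. real K ^ d * q ^ K) \<longlonglongrightarrow> 0"
  proof -
    define r c where "r = max q (1/2)" and "c = - ln r"
    have r: "0 < r" "r < 1" "q \<le> r" unfolding r_def using q by auto
    have c: "0 < c" unfolding c_def using r by simp
    have "filterlim (\<lambda>K. c * real K) at_top sequentially"
      using c filterlim_real_sequentially by (intro filterlim_tendsto_pos_mult_at_top[OF tendsto_const])
    from filterlim_compose[OF tendsto_power_div_exp_0 this, of d]
    have "(\<lambda>K. (c * real K) ^ d / exp (c * real K) / c ^ d) \<longlonglongrightarrow> 0 / c ^ d"
      using c by (intro tendsto_divide tendsto_const) auto
    moreover have "(c * real K) ^ d / exp (c * real K) / c ^ d = real K ^ d * r ^ K" for K
    proof -
      have "exp (c * real K) = inverse (r ^ K)"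
        unfolding c_def using r by (simp add: exp_minus exp_of_nat2_mult mult.commute flip: powr_realpow) (simp add: powr_def mult.commute)
      then show ?thesis using c by (simp add: power_mult_distrib divide_inverse)
    qed
    ultimately have "(\<lambda>K. real K ^ d * r ^ K) \<longlonglongrightarrow> 0" by simp
    then show ?thesis
      by (rule Lim_null_comparison[rotated]) (use q r in \<open>auto intro!: always_eventually mult_left_mono power_mono\<close>)
  qed
  then have "\<forall>\<^sub>F K in sequentially. real K ^ d * q ^ K < 1 / 2 ^ d" by (intro order_tendstoD) auto
  then have "\<forall>\<^sub>F K in sequentially. 0 < K \<and> real K ^ d * q ^ K < 1 / 2 ^ d"
    using eventually_gt_at_top[of 0] by eventually_elim auto
  then obtain K :: nat where "0 < K" "real K ^ d * q ^ K < 1 / 2 ^ d"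
    using eventually_happens'[OF sequentially_bot] by blast
  then have "q ^ K < (1 / (2 * real K)) ^ d" by (simp add: field_simps power_mult_distrib)
  then show ?thesis using \<open>0 < K\<close> unfolding q_def by blast
qed

lemma vmult_scaleR: "(c *\<^sub>R x) v* R = c *\<^sub>R (x v* R)" for x :: "real ^ 'n"
  by (simp add: vector_matrix_mult_def vec_eq_iff sum_distrib_left mult_ac)

text \<open>A quantitative form of Weyl's criterion. Average the kernel, centred at \<open>t *\<^sub>R v\<close>, over the preimage of the integer
lattice under \<open>A\<^sup>N\<close>, modulo the lattice. The average of a character vanishes unless its frequency is divisible by
\<open>A\<^sup>N\<close>, and then it is one. For large \<open>N\<close>, those of the finitely many frequencies of the kernel that survive are
infinitely divisible and hence orthogonal to \<open>v\<close>, so their contribution does not depend on the shift by \<open>t *\<^sub>R v\<close>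
and is nonnegative. Thus the average is at least the constant coefficient, and by \<open>cos_kernel_peak\<close> some preimage
is close to \<open>t *\<^sub>R v\<close> modulo the lattice.\<close>

lemma stable_line_approximable:
  fixes A :: "int ^ 'n::finite ^ 'n" and v :: "real ^ 'n"
  assumes irr: "irreducible (rat_charpoly A)" and v: "map_matrix real_of_int A *v v = l *\<^sub>R v" "v \<noteq> 0"
    and d: "2 \<le> \<bar>det A\<bar>" and \<epsilon>: "0 < \<epsilon>"
  shows "\<exists>n w k. ((\<lambda>x. map_matrix real_of_int A *v x) ^^ n) w = int_vec k \<and> norm (w - t *\<^sub>R v) < \<epsilon>"
proof -
  let ?A = "map_matrix real_of_int A" and ?B = "\<lambda>z. z v* A"
  define \<delta> where "\<delta> = min (1/2) (\<epsilon> / (2 * CARD('n)))"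
  have \<delta>: "0 < \<delta>" "\<delta> \<le> 1/2" unfolding \<delta>_def using \<epsilon> by auto
  obtain K where K: "0 < K" "(1 / (2 * real K)) ^ CARD('n) > ((1 + cos (2 * pi * \<delta>)) / 2) ^ K"
    using cos_kernel_exponent_exists[OF \<delta>] by blast
  define Gs where "Gs = (UNIV :: 'n set) \<rightarrow>\<^sub>E {..2*K}"
  have finG: "finite Gs" unfolding Gs_def by (intro finite_PiE) auto
  define c where "c g = (\<Prod>i\<in>(UNIV :: 'n set). real ((2*K) choose g i) / 4 ^ K)" for g
  define \<xi> :: "('n \<Rightarrow> nat) \<Rightarrow> int ^ 'n" where "\<xi> g = (\<chi> i. int (g i) - int K)" for g
  \<comment> \<open>frequencies that survive every average; one \<open>N\<close> removes all others because the kernel has finitely many frequencies\<close>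
  define good where "good \<zeta> \<longleftrightarrow> (\<forall>n. \<exists>z. \<zeta> = (?B ^^ n) z)" for \<zeta>
  have "\<exists>n. \<forall>z. \<xi> g \<noteq> (?B ^^ n) z" if "\<not> good (\<xi> g)" for g using that unfolding good_def by blast
  then obtain bad where bad: "\<And>g z. \<not> good (\<xi> g) \<Longrightarrow> \<xi> g \<noteq> (?B ^^ bad g) z" by metis
  define N where "N = Max (bad ` Gs)"
  have N: "good (\<xi> g)" if "g \<in> Gs" "\<xi> g = (?B ^^ N) z" for g z
  proof (rule ccontr)
    assume "\<not> good (\<xi> g)"
    have "bad g \<le> N" unfolding N_def using finG that by auto
    then have "(?B ^^ N) z = (?B ^^ bad g) ((?B ^^ (N - bad g)) z)"
      by (metis add_diff_inverse_nat funpow_add linorder_not_less o_apply)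
    then show False using bad[OF \<open>\<not> good (\<xi> g)\<close>] that by auto
  qed
  obtain R where R: "?A ** R = mat 1" "R ** ?A = mat 1"
    and intR: "\<And>n. \<exists>k. real_of_int (det A) *\<^sub>R (int_vec n v* R) = int_vec k"
    using inverse_denominator[of A] d by (metis abs_zero linorder_not_less zero_less_numeral)
  define L where "L = ((\<lambda>x. R *v x) ^^ N)"
  have AL: "((\<lambda>x. ?A *v x) ^^ n) (((\<lambda>x. R *v x) ^^ n) x) = x" for n x
  proof (induction n arbitrary: x)
    case (Suc n)
    have "((\<lambda>x. ?A *v x) ^^ Suc n) (((\<lambda>x. R *v x) ^^ Suc n) x) = ((\<lambda>x. ?A *v x) ^^ n) (?A *v (R *v (((\<lambda>x. R *v x) ^^ n) x)))"
      by (simp add: funpow_swap1)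
    also have "?A *v (R *v (((\<lambda>x. R *v x) ^^ n) x)) = ((\<lambda>x. R *v x) ^^ n) x"
      by (simp only: matrix_vector_mul_assoc R matrix_vector_mul_lid)
    finally show ?case using Suc by simp
  qed simp
  define \<eta> where "\<eta> \<zeta> = ((\<lambda>x. x v* R) ^^ N) (int_vec \<zeta>)" for \<zeta> :: "int ^ 'n"
  have adj: "z \<bullet> ((\<lambda>x. R *v x) ^^ n) x = ((\<lambda>x. x v* R) ^^ n) z \<bullet> x" for z x n
  proof (induction n arbitrary: z)
    case (Suc n)
    have "z \<bullet> ((\<lambda>x. R *v x) ^^ Suc n) x = (z v* R) \<bullet> ((\<lambda>x. R *v x) ^^ n) x" by (simp add: dot_lmul_matrix)
    also have "\<dots> = ((\<lambda>x. x v* R) ^^ n) (z v* R) \<bullet> x" by (rule Suc)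
    finally show ?case using funpow_swap1[of "\<lambda>x. x v* R" n z] by simp
  qed simp
  have etaA: "((\<lambda>x. x v* ?A) ^^ n) (((\<lambda>x. x v* R) ^^ n) z) = z" for n z
  proof (induction n arbitrary: z)
    case (Suc n)
    have "((\<lambda>x. x v* ?A) ^^ Suc n) (((\<lambda>x. x v* R) ^^ Suc n) z) = ((\<lambda>x. x v* ?A) ^^ n) ((((\<lambda>x. x v* R) ^^ n) z v* R) v* ?A)"
      using funpow_swap1[of "\<lambda>x. x v* ?A" n "((\<lambda>x. x v* R) ^^ n) z v* R"] by simp
    also have "(((\<lambda>x. x v* R) ^^ n) z v* R) v* ?A = ((\<lambda>x. x v* R) ^^ n) z"
      by (simp only: vector_matrix_mul_assoc R vector_matrix_mul_rid)
    finally show ?case using Suc by simp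
  qed simp
  have int_pow: "((\<lambda>x. x v* ?A) ^^ n) (int_vec z) = int_vec ((?B ^^ n) z)" for n z
    by (induction n) (simp_all add: int_vec_vmult)
  \<comment> \<open>all points of the average have denominator \<open>m\<close>, so indices below \<open>m\<close> represent each of them equally often\<close>
  define m where "m = nat (\<bar>det A\<bar> ^ N)"
  have m0: "0 < m" unfolding m_def using d by simp
  have eta_int: "\<exists>k. real_of_int (det A ^ n) *\<^sub>R ((\<lambda>x. x v* R) ^^ n) (int_vec z) = int_vec k" for n z
  proof (induction n)
    case (Suc n)
    then obtain k where k: "real_of_int (det A ^ n) *\<^sub>R ((\<lambda>x. x v* R) ^^ n) (int_vec z) = int_vec k" by blast
    obtain k' where "real_of_int (det A) *\<^sub>R (int_vec k v* R) = int_vec k'" using intR by blast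
    then have "real_of_int (det A ^ Suc n) *\<^sub>R ((\<lambda>x. x v* R) ^^ Suc n) (int_vec z) = int_vec k'"
      unfolding k[symmetric] by (simp add: vmult_scaleR)
    then show ?case by blast
  qed (auto intro: exI[of _ z])
  have eta_m: "real m * \<eta> z $ i \<in> \<int>" for z i
  proof -
    obtain k where "real_of_int (det A ^ N) *\<^sub>R \<eta> z = int_vec k" using eta_int unfolding \<eta>_def by blast
    then have "real_of_int (det A ^ N) * \<eta> z $ i = of_int (k $ i)" by (simp add: vec_eq_iff int_vec_def)
    moreover have "real m = real_of_int (det A ^ N) \<or> real m = - real_of_int (det A ^ N)"
      unfolding m_def by (simp flip: power_abs) (auto simp: abs_if)
    ultimately show ?thesis by auto
  qed
  define Ks where "Ks = (UNIV :: 'n set) \<rightarrow>\<^sub>E {..<m}"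
  define V :: "('n \<Rightarrow> nat) \<Rightarrow> real ^ 'n" where "V k = (\<chi> i. real (k i))" for k
  define J where "J g \<longleftrightarrow> (\<forall>i. \<eta> (\<xi> g) $ i \<in> \<int>)" for g
  have char: "(\<Sum>k\<in>Ks. e2pi (int_vec (\<xi> g) \<bullet> (L (V k) - t *\<^sub>R v))) = (if J g then of_nat m ^ CARD('n) else 0)"
    if g: "g \<in> Gs" for g
  proof -
    have "(\<Sum>k\<in>Ks. e2pi (int_vec (\<xi> g) \<bullet> (L (V k) - t *\<^sub>R v)))
      = (\<Sum>k\<in>Ks. e2pi (\<eta> (\<xi> g) \<bullet> V k) * e2pi (- (t * (int_vec (\<xi> g) \<bullet> v))))"
      by (simp add: inner_diff_right L_def adj \<eta>_def flip: e2pi_add)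
    also have "\<dots> = (if J g then of_nat m ^ CARD('n) else 0) * e2pi (- (t * (int_vec (\<xi> g) \<bullet> v)))"
      unfolding sum_distrib_right[symmetric] Ks_def V_def J_def by (subst character_sum_box[OF m0 eta_m]) simp
    also have "\<dots> = (if J g then of_nat m ^ CARD('n) else 0)"
    proof (cases "J g")
      case True
      then have "\<forall>i. \<exists>q. \<eta> (\<xi> g) $ i = real_of_int q" unfolding J_def Ints_def by auto
      then obtain q where "\<And>i. \<eta> (\<xi> g) $ i = real_of_int (q i)" by metis
      then have "\<eta> (\<xi> g) = int_vec (\<chi> i. q i)" by (simp add: vec_eq_iff int_vec_def)
      then have "int_vec (\<xi> g) = int_vec ((?B ^^ N) (\<chi> i. q i))"
        using etaA[of N "int_vec (\<xi> g)"] int_pow[of N] unfolding \<eta>_def by simp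
      then have "good (\<xi> g)" using N[OF g] by (simp add: int_vec_inj)
      then have "int_vec (\<xi> g) \<bullet> v = 0"
        unfolding good_def by (intro infinitely_divisible_orthogonal[OF irr v d]) blast
      then show ?thesis by (simp add: e2pi_def)
    qed simp
    finally show ?thesis .
  qed
  have "complex_of_real (\<Sum>k\<in>Ks. cos_kernel K (L (V k) - t *\<^sub>R v))
    = (\<Sum>k\<in>Ks. \<Sum>g\<in>Gs. of_real (c g) * e2pi (int_vec (\<xi> g) \<bullet> (L (V k) - t *\<^sub>R v)))"
    unfolding of_real_sum cos_kernel_expansion Gs_def c_def \<xi>_def ..
  also have "\<dots> = (\<Sum>g\<in>Gs. of_real (c g) * (\<Sum>k\<in>Ks. e2pi (int_vec (\<xi> g) \<bullet> (L (V k) - t *\<^sub>R v))))"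
    by (subst sum.swap) (simp add: sum_distrib_left)
  also have "\<dots> = (\<Sum>g\<in>Gs. of_real (c g * (if J g then real m ^ CARD('n) else 0)))"
    by (intro sum.cong refl) (simp add: char)
  also have "\<dots> = of_real (\<Sum>g\<in>Gs. c g * (if J g then real m ^ CARD('n) else 0))" by simp
  finally have sumK: "(\<Sum>k\<in>Ks. cos_kernel K (L (V k) - t *\<^sub>R v)) = (\<Sum>g\<in>Gs. c g * (if J g then real m ^ CARD('n) else 0))"
    using of_real_eq_iff by blast
  \<comment> \<open>the index of the constant term\<close>
  define g0 where "g0 = (\<lambda>i :: 'n. K)"
  have g0: "g0 \<in> Gs" unfolding g0_def Gs_def by auto
  have "\<eta> (\<xi> g0) = 0"
  proof -
    have "\<xi> g0 = 0" unfolding \<xi>_def g0_def by (simp add: vec_eq_iff)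
    moreover have "((\<lambda>x. x v* R) ^^ n) 0 = 0" for n by (induction n) simp_all
    ultimately show ?thesis unfolding \<eta>_def by simp
  qed
  then have J0: "J g0" unfolding J_def by simp
  have "(1 / (2 * real K)) ^ CARD('n) \<le> c g0"
  proof -
    have "1 / (2 * real K) \<le> real ((2*K) choose K) / 4 ^ K"
      using central_binomial_lower_bound[OF K(1)] by (simp add: field_simps)
    then show ?thesis unfolding c_def g0_def using power_mono[of "1 / (2 * real K)" "real ((2*K) choose K) / 4 ^ K" "CARD('n)"] by simp
  qed
  then have "(1 / (2 * real K)) ^ CARD('n) * real m ^ CARD('n) \<le> c g0 * (if J g0 then real m ^ CARD('n) else 0)"
    using J0 by (simp add: mult_right_mono)
  also have "\<dots> \<le> (\<Sum>g\<in>Gs. c g * (if J g then real m ^ CARD('n) else 0))"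
    using finG g0 by (intro member_le_sum) (auto simp: c_def intro!: mult_nonneg_nonneg prod_nonneg)
  finally have big: "(1 / (2 * real K)) ^ CARD('n) * real m ^ CARD('n) \<le> (\<Sum>k\<in>Ks. cos_kernel K (L (V k) - t *\<^sub>R v))"
    unfolding sumK .
  have card: "card Ks = m ^ CARD('n)" unfolding Ks_def by (simp add: card_PiE)
  have "\<exists>k. cos_kernel K (L (V k) - t *\<^sub>R v) \<ge> (1 / (2 * real K)) ^ CARD('n)"
  proof (rule ccontr)
    assume "\<nexists>k. cos_kernel K (L (V k) - t *\<^sub>R v) \<ge> (1 / (2 * real K)) ^ CARD('n)"
    then have less: "cos_kernel K (L (V k) - t *\<^sub>R v) < (1 / (2 * real K)) ^ CARD('n)" for k by (simp add: not_le)
    have "finite Ks" "Ks \<noteq> {}" using card m0 card_gt_0_iff[of Ks] by auto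
    then have "(\<Sum>k\<in>Ks. cos_kernel K (L (V k) - t *\<^sub>R v)) < (\<Sum>k\<in>Ks. (1 / (2 * real K)) ^ CARD('n))"
      using less by (intro sum_strict_mono)
    then show False using big card by (simp add: mult.commute)
  qed
  then obtain k where k: "cos_kernel K (L (V k) - t *\<^sub>R v) \<ge> (1 / (2 * real K)) ^ CARD('n)" by blast
  obtain q where q: "\<And>i. \<bar>(L (V k) - t *\<^sub>R v) $ i - real_of_int (q $ i)\<bar> < \<delta>"
    using cos_kernel_peak[OF \<delta> K(2) k] by blast
  define w where "w = L (V k) - int_vec q"
  have "norm (w - t *\<^sub>R v) \<le> (\<Sum>i\<in>UNIV. \<bar>(w - t *\<^sub>R v) $ i\<bar>)" by (rule norm_le_l1_cart)
  also have "\<dots> \<le> (\<Sum>i\<in>(UNIV :: 'n set). \<delta>)"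
  proof (rule sum_mono)
    fix i show "\<bar>(w - t *\<^sub>R v) $ i\<bar> \<le> \<delta>" using q[of i] unfolding w_def by (simp add: int_vec_def algebra_simps)
  qed
  also have "\<dots> \<le> \<epsilon> / 2"
  proof -
    have "real CARD('n) * \<delta> \<le> real CARD('n) * (\<epsilon> / (2 * CARD('n)))" unfolding \<delta>_def by (intro mult_left_mono) auto
    then show ?thesis by simp
  qed
  finally have "norm (w - t *\<^sub>R v) < \<epsilon>" using \<epsilon> by simp
  moreover have "((\<lambda>x. ?A *v x) ^^ N) w = int_vec ((\<chi> i. int (k i)) - ((\<lambda>z. A *v z) ^^ N) q)"
  proof -
    have "((\<lambda>x. ?A *v x) ^^ n) (x - y) = ((\<lambda>x. ?A *v x) ^^ n) x - ((\<lambda>x. ?A *v x) ^^ n) y" for n x y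
      by (induction n) (simp_all add: matrix_vector_mult_diff_distrib)
    moreover have "((\<lambda>x. ?A *v x) ^^ n) (int_vec z) = int_vec (((\<lambda>z. A *v z) ^^ n) z)" for n z
      by (induction n) (simp_all add: int_vec_mult)
    moreover have "V k = int_vec (\<chi> i. int (k i))" by (simp add: V_def int_vec_def vec_eq_iff)
    ultimately show ?thesis unfolding w_def L_def by (simp add: AL int_vec_diff)
  qed
  ultimately show ?thesis by blast
qed

lemma unimodular_toral_map_bij:
  fixes A :: "int ^ 'n::finite ^ 'n"
  assumes "\<bar>det A\<bar> = 1"
  shows "bij (toral_map A)"
proof -
  let ?A = "map_matrix real_of_int A"
  have d: "det A \<noteq> 0" using assms by auto
  obtain R where R: "?A ** R = mat 1" "R ** ?A = mat 1"
    and intR: "\<And>n. \<exists>k. real_of_int (det A) *\<^sub>R (R *v int_vec n) = int_vec k"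
    using inverse_denominator[OF d] by metis
  have intR': "\<exists>k. R *v int_vec n = int_vec k" for n
  proof -
    obtain k where k: "real_of_int (det A) *\<^sub>R (R *v int_vec n) = int_vec k" using intR by blast
    have "det A = 1 \<or> det A = -1" using assms by linarith
    then show ?thesis using k by (auto simp: minus_equation_iff intro: exI[of _ k] exI[of _ "-k"] simp: int_vec_minus)
  qed
  have "inj (toral_map A)"
  proof (rule injI)
    fix p q assume eq: "toral_map A p = toral_map A q"
    define x y where "x = rep_torus p" and "y = rep_torus q"
    have xy: "p = proj x" "q = proj y"
      unfolding x_def y_def by (simp_all add: Quotient_abs_rep[OF Quotient_torus])
    obtain n where "?A *v x - ?A *v y = int_vec n"
      using eq unfolding xy toral_map.abs_eq by (subst (asm) torus.abs_eq_iff) auto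
    then have "?A *v (x - y) = int_vec n" by (simp add: matrix_vector_mult_diff_distrib)
    then have "R *v (?A *v (x - y)) = R *v int_vec n" by simp
    then have "x - y = R *v int_vec n" by (simp only: matrix_vector_mul_assoc R matrix_vector_mul_lid)
    then obtain k where "x - y = int_vec k" using intR' by metis
    then show "p = q" unfolding xy by (subst torus.abs_eq_iff) blast
  qed
  moreover have "surj (toral_map A)"
  proof (rule surjI)
    fix q :: "'n torus"
    show "toral_map A (proj (R *v rep_torus q)) = q"
      unfolding toral_map.abs_eq matrix_vector_mul_assoc R matrix_vector_mul_lid by (rule Quotient_abs_rep[OF Quotient_torus])
  qed
  ultimately show ?thesis by (simp add: bij_def)
qed

section \<open>Lifts to Euclidean space\<close>

lemma proj_eq_iff: "proj x = proj y \<longleftrightarrow> (\<exists>n. x - y = int_vec n)"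
  by (rule torus.abs_eq_iff)

lemma proj_rep [simp]: "proj (rep_torus p) = p"
  by (rule Quotient_abs_rep[OF Quotient_torus])

lemma proj_shift [simp]: "proj (x + int_vec n) = proj x"
  unfolding proj_eq_iff by (rule exI[of _ n]) simp

lemma continuous_proj: "continuous_on S (proj :: real ^ 'n::finite \<Rightarrow> 'n torus)"
proof -
  have "continuous_on UNIV (proj :: real ^ 'n \<Rightarrow> 'n torus)"
    unfolding continuous_on_open_vimage[OF open_UNIV] by (auto simp: open_torus_def)
  then show ?thesis by (rule continuous_on_subset) simp
qed

lemma continuous_on_torus:
  fixes g :: "'n::finite torus \<Rightarrow> 'b::topological_space"
  assumes "continuous_on UNIV (\<lambda>x. g (proj x))"
  shows "continuous_on UNIV g"
  unfolding continuous_on_open_vimage[OF open_UNIV]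
proof (intro allI impI)
  fix B :: "'b set" assume "open B"
  then have "open ((\<lambda>x. g (proj x)) -` B)" using assms by (simp add: continuous_on_open_vimage[OF open_UNIV])
  moreover have "(\<lambda>x. g (proj x)) -` B = proj -` (g -` B)" by auto
  ultimately show "open (g -` B \<inter> UNIV)" by (simp add: open_torus_def)
qed

text \<open>The coordinates are lifted one at a time by continuous logarithms of the corresponding circle-valued maps.\<close>

lemma lift_exists:
  fixes \<phi> :: "'a::real_normed_vector \<Rightarrow> 'n::finite torus"
  assumes S: "contractible S" and \<phi>: "continuous_on S \<phi>"
  obtains \<Phi> where "continuous_on S \<Phi>" "\<And>x. x \<in> S \<Longrightarrow> proj (\<Phi> x) = \<phi> x"
proof -
  define E :: "'n \<Rightarrow> 'n torus \<Rightarrow> complex" where "E i p = e2pi (rep_torus p $ i)" for i p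
  have E: "E i (proj x) = e2pi (x $ i)" for i x
  proof -
    obtain n where "rep_torus (proj x) - x = int_vec n" using proj_eq_iff[of "rep_torus (proj x)" x] by auto
    then have "rep_torus (proj x) = x + int_vec n" by (simp add: algebra_simps)
    then have "rep_torus (proj x) $ i = x $ i + real_of_int (n $ i)"
      by (simp add: int_vec_def)
    then show ?thesis unfolding E_def by (simp add: e2pi_add) (simp add: e2pi_eq_1)
  qed
  have "continuous_on UNIV (E i)" for i
  proof (rule continuous_on_torus)
    show "continuous_on UNIV (\<lambda>x. E i (proj x))" unfolding E e2pi_def cis_conv_exp by (intro continuous_intros)
  qed
  then have "continuous_on S (\<lambda>x. E i (\<phi> x))" for i
    using continuous_on_compose2[OF _ \<phi>] by blast
  moreover have "E i p \<noteq> 0" for i p unfolding E_def e2pi_def by simp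
  ultimately have "\<exists>g. continuous_on S g \<and> (\<forall>x\<in>S. E i (\<phi> x) = exp (g x))" for i
    using continuous_logarithm_on_contractible[OF _ S, of "\<lambda>x. E i (\<phi> x)"] by metis
  then obtain g where g: "\<And>i. continuous_on S (g i)" "\<And>i x. x \<in> S \<Longrightarrow> E i (\<phi> x) = exp (g i x)" by metis
  define \<Phi> where "\<Phi> x = (\<chi> i. Im (g i x) / (2 * pi))" for x
  show thesis
  proof
    show "continuous_on S \<Phi>" unfolding \<Phi>_def by (intro continuous_intros g) auto
    fix x assume x: "x \<in> S"
    define p where "p = rep_torus (\<phi> x)"
    have "\<Phi> x $ i - p $ i \<in> \<int>" for i
    proof -
      have eq: "e2pi (p $ i) = exp (g i x)" using g(2)[OF x, of i] unfolding E_def p_def .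
      then have "norm (exp (g i x)) = 1" unfolding e2pi_def by (metis norm_cis)
      then have "Re (g i x) = 0" by simp
      then have "exp (g i x) = e2pi (\<Phi> x $ i)" unfolding e2pi_def \<Phi>_def by (simp add: exp_eq_polar)
      then have "e2pi (\<Phi> x $ i) = e2pi (p $ i)" using eq by simp
      moreover have "e2pi (- (p $ i)) * e2pi (p $ i) = 1" by (simp flip: e2pi_add) (simp add: e2pi_def)
      ultimately have "e2pi (\<Phi> x $ i - p $ i) = 1" by (simp add: e2pi_add[of _ "- _", simplified] mult.commute)
      then show ?thesis by (simp add: e2pi_eq_1)
    qed
    then have "\<forall>i. \<exists>n. \<Phi> x $ i - p $ i = real_of_int n" by (auto simp: Ints_def)
    then obtain n where "\<And>i. \<Phi> x $ i - p $ i = real_of_int (n i)" by metis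
    then have "\<Phi> x - p = int_vec (\<chi> i. n i)" by (simp add: vec_eq_iff int_vec_def)
    then have "proj (\<Phi> x) = proj p" using proj_eq_iff by blast
    then show "proj (\<Phi> x) = \<phi> x" unfolding p_def by simp
  qed
qed

lemma int_vec_close_eq:
  assumes "norm (int_vec m - int_vec n) < 1"
  shows "m = n"
proof -
  have "m $ i = n $ i" for i
  proof -
    have "\<bar>(int_vec m - int_vec n) $ i\<bar> < 1" using assms component_le_norm_cart[of "int_vec m - int_vec n" i] by linarith
    then show ?thesis by (simp add: int_vec_def)
  qed
  then show ?thesis by (simp add: vec_eq_iff)
qed

text \<open>The difference of two lifts is an integer vector and continuous at \<open>x\<close>.\<close>

lemma lifts_differ_locally:
  fixes F G :: "'a::metric_space \<Rightarrow> real ^ 'n::finite"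
  assumes "\<forall>\<^sub>F y in at x within S. proj (F y) = proj (G y)" "proj (F x) = proj (G x)"
    and "continuous (at x within S) F" "continuous (at x within S) G"
  shows "\<forall>\<^sub>F y in at x within S. F y = G y + (F x - G x)"
proof -
  have "((\<lambda>y. F y - G y) \<longlongrightarrow> F x - G x) (at x within S)"
    using assms(3,4) unfolding continuous_within by (rule tendsto_diff)
  then have "\<forall>\<^sub>F y in at x within S. dist (F y - G y) (F x - G x) < 1" by (rule tendstoD) simp
  with assms(1) show ?thesis
  proof eventually_elim
    case (elim y)
    obtain m where m: "F y - G y = int_vec m" using elim(1) proj_eq_iff by blast
    obtain n where n: "F x - G x = int_vec n" using assms(2) proj_eq_iff by blast
    have "m = n" using elim(2) unfolding m n by (intro int_vec_close_eq) (simp add: dist_norm)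
    then show ?case using m n by (simp add: algebra_simps)
  qed
qed

lemma lifts_differ_constant:
  fixes F G :: "'a::metric_space \<Rightarrow> real ^ 'n::finite"
  assumes S: "connected S" "x0 \<in> S" and "continuous_on S F" "continuous_on S G"
    and eq: "\<And>x. x \<in> S \<Longrightarrow> proj (F x) = proj (G x)"
  obtains n where "\<And>x. x \<in> S \<Longrightarrow> F x = G x + int_vec n"
proof -
  obtain n where n: "F x0 - G x0 = int_vec n" using eq[OF S(2)] proj_eq_iff by blast
  have "F x - G x = F x0 - G x0" if "x \<in> S" for x
  proof (rule connected_local_const[OF S(1) that S(2)])
    show "\<forall>a\<in>S. \<forall>\<^sub>F b in at a within S. F a - G a = F b - G b"
    proof
      fix a assume a: "a \<in> S"
      have "\<forall>\<^sub>F y in at a within S. F y = G y + (F a - G a)"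
        using assms a by (intro lifts_differ_locally) (auto simp: continuous_on_eq_continuous_within eventually_at_filter)
      then show "\<forall>\<^sub>F b in at a within S. F a - G a = F b - G b" by eventually_elim simp
    qed
  qed
  then have "F x = G x + int_vec n" if "x \<in> S" for x using that n by (metis add.commute diff_add_cancel)
  then show thesis using that by blast
qed

lemma has_derivative_lift:
  fixes F :: "real ^ 'n \<Rightarrow> real ^ 'n::finite"
  assumes F: "continuous_on UNIV F" "\<And>x. proj (F x) = f (proj x)" and D: "has_torus_derivative f D (proj x)"
  shows "(F has_derivative blinfun_apply D) (at x)"
proof -
  obtain y G where y: "proj y = proj x" and G: "\<forall>\<^sub>F z in nhds y. proj (G z) = f (proj z)"
    and dG: "(G has_derivative blinfun_apply D) (at y)"
    using D unfolding has_torus_derivative_def by blast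
  obtain n where n: "y - x = int_vec n" using y proj_eq_iff by blast
  then have yx: "y = x + int_vec n" by (simp add: algebra_simps)
  have shift: "((\<lambda>z. z + int_vec n) has_derivative (\<lambda>z. z)) (at x)" by (auto intro!: derivative_eq_intros)
  have dG': "((\<lambda>z. G (z + int_vec n)) has_derivative blinfun_apply D) (at x)"
    using has_derivative_compose[OF shift, of G "blinfun_apply D"] dG unfolding yx by simp
  have "((\<lambda>z. z + int_vec n) \<longlongrightarrow> y) (nhds x)" unfolding yx by (intro tendsto_intros filterlim_ident)
  from eventually_compose_filterlim[OF G this]
  have ev: "\<forall>\<^sub>F z in nhds x. proj (F z) = proj (G (z + int_vec n))" by (rule eventually_mono) (simp add: F)
  have "\<forall>\<^sub>F z in at x. F z = G (z + int_vec n) + (F x - G (x + int_vec n))"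
  proof (rule lifts_differ_locally)
    show "\<forall>\<^sub>F z in at x. proj (F z) = proj (G (z + int_vec n))" using ev by (auto simp: eventually_at_filter elim: eventually_mono)
    show "proj (F x) = proj (G (x + int_vec n))" using eventually_nhds_x_imp_x[OF ev] .
    show "isCont F x" using F(1) by (simp add: continuous_on_eq_continuous_at)
    show "isCont (\<lambda>z. G (z + int_vec n)) x" using has_derivative_continuous[OF dG'] .
  qed
  moreover have "((\<lambda>z. G (z + int_vec n) + (F x - G (x + int_vec n))) has_derivative blinfun_apply D) (at x)"
    using has_derivative_add_const[OF dG'] .
  ultimately have "\<forall>\<^sub>F z in at x. G (z + int_vec n) + (F x - G (x + int_vec n)) = F z"
    and 1: "((\<lambda>z. G (z + int_vec n) + (F x - G (x + int_vec n))) has_derivative blinfun_apply D) (at x)"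
    by (auto elim: eventually_mono)
  then show ?thesis by (intro has_derivative_transform_eventually[OF 1]) simp_all
qed

lemma torus_deriv_lift:
  fixes F :: "real ^ 'n \<Rightarrow> real ^ 'n::finite"
  assumes F: "\<And>x. proj (F x) = f (proj x)" and D: "(F has_derivative blinfun_apply D) (at x)"
  shows "torus_deriv f (proj x) = D"
proof -
  have "has_torus_derivative f D (proj x)"
    unfolding has_torus_derivative_def using F D by (intro exI[of _ x] exI[of _ F]) auto
  then show ?thesis unfolding torus_deriv_def using has_torus_derivative_unique by blast
qed

lemma has_vector_derivative_lift:
  fixes C :: "real \<Rightarrow> real ^ 'n::finite"
  assumes C: "continuous_on S C" "\<And>t. t \<in> S \<Longrightarrow> proj (C t) = c t" and t: "t \<in> S" and D: "has_curve_derivative c v t S"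
  shows "(C has_vector_derivative v) (at t within S)"
proof -
  obtain G where G: "proj (G t) = c t" "\<forall>\<^sub>F s in at t within S. proj (G s) = c s"
    and dG: "(G has_vector_derivative v) (at t within S)"
    using D unfolding has_curve_derivative_def by blast
  have "\<forall>\<^sub>F s in at t within S. C s = G s + (C t - G t)"
  proof (rule lifts_differ_locally)
    have "\<forall>\<^sub>F s in at t within S. s \<in> S" by (auto simp: eventually_at_filter)
    with G(2) show "\<forall>\<^sub>F s in at t within S. proj (C s) = proj (G s)" by eventually_elim (simp add: C)
    show "proj (C t) = proj (G t)" using C(2)[OF t] G(1) by simp
    show "continuous (at t within S) C" using C(1) t by (simp add: continuous_on_eq_continuous_within)
    show "continuous (at t within S) G" using has_vector_derivative_continuous[OF dG] .
  qed
  moreover have "((\<lambda>s. G s + (C t - G t)) has_vector_derivative v) (at t within S)"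
    using has_vector_derivative_add[OF dG has_vector_derivative_const] by simp
  ultimately have ev: "\<forall>\<^sub>F s in at t within S. G s + (C t - G t) = C s"
    and 1: "((\<lambda>s. G s + (C t - G t)) has_vector_derivative v) (at t within S)"
    by (auto elim: eventually_mono)
  show ?thesis
    using has_derivative_transform_eventually[OF 1[unfolded has_vector_derivative_def] ev _ t]
    unfolding has_vector_derivative_def by simp
qed

lemma curve_derivative_imp_continuous:
  fixes c :: "real \<Rightarrow> 'n::finite torus"
  assumes "\<And>t. t \<in> S \<Longrightarrow> has_curve_derivative c (c' t) t S"
  shows "continuous_on S c"
  unfolding continuous_on_def
proof
  fix t assume "t \<in> S"
  then obtain G where G: "proj (G t) = c t" "\<forall>\<^sub>F s in at t within S. proj (G s) = c s"
    and dG: "(G has_vector_derivative c' t) (at t within S)"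
    using assms unfolding has_curve_derivative_def by blast
  have "(G \<longlongrightarrow> G t) (at t within S)"
    using has_vector_derivative_continuous[OF dG] by (simp add: continuous_within)
  then have "((\<lambda>s. proj (G s)) \<longlongrightarrow> proj (G t)) (at t within S)"
    by (rule continuous_on_tendsto_compose[OF continuous_proj[of UNIV]]) auto
  then show "(c \<longlongrightarrow> c t) (at t within S)" unfolding G(1)
    by (rule Lim_transform_eventually) (use G(2) in simp)
qed

lemma floor_representative: "\<exists>n. x + int_vec n \<in> cbox 0 1" for x :: "real ^ 'n::finite"
proof
  have "0 \<le> x $ i - real_of_int \<lfloor>x $ i\<rfloor> \<and> x $ i - real_of_int \<lfloor>x $ i\<rfloor> \<le> 1" for i
    using floor_correct[of "x $ i"] by linarith
  then show "x + int_vec (\<chi> i. - \<lfloor>x $ i\<rfloor>) \<in> cbox 0 1"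
    unfolding mem_box_cart int_vec_def by simp
qed

lemma periodic_bounded:
  fixes \<phi> :: "real ^ 'n::finite \<Rightarrow> real"
  assumes "continuous_on UNIV \<phi>" and per: "\<And>x n. \<phi> (x + int_vec n) = \<phi> x"
  obtains B where "\<And>x. \<phi> x \<le> B"
proof -
  have "compact (cbox (0 :: real ^ 'n) 1)" "cbox (0 :: real ^ 'n) 1 \<noteq> {}"
    by (auto simp: interval_ne_empty_cart)
  then obtain x0 where "\<forall>x\<in>cbox 0 1. \<phi> x \<le> \<phi> x0"
    using continuous_attains_sup[of "cbox 0 1" \<phi>] continuous_on_subset[OF assms(1)] by blast
  then have "\<phi> x \<le> \<phi> x0" for x using floor_representative[of x] per by metis
  then show thesis using that by blast
qed

lemma equivariant_uniformly_continuous: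
  fixes \<phi> :: "real ^ 'n::finite \<Rightarrow> 'b::real_normed_vector"
  assumes cont: "continuous_on UNIV \<phi>" and per: "\<And>n. \<exists>m. \<forall>x. \<phi> (x + int_vec n) = \<phi> x + m"
  shows "uniformly_continuous_on UNIV \<phi>"
  unfolding uniformly_continuous_on_def
proof (intro allI impI)
  fix r :: real assume r: "0 < r"
  define Q :: "(real ^ 'n) set" where "Q = cbox (\<chi> i. -1) (\<chi> i. 2)"
  have "uniformly_continuous_on Q \<phi>"
    unfolding Q_def by (intro compact_uniformly_continuous continuous_on_subset[OF cont]) auto
  then obtain d where d: "0 < d" "\<And>x y. x \<in> Q \<Longrightarrow> y \<in> Q \<Longrightarrow> dist y x < d \<Longrightarrow> dist (\<phi> y) (\<phi> x) < r"
    using r unfolding uniformly_continuous_on_def by metis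
  have "dist (\<phi> y) (\<phi> x) < r" if "dist y x < min d 1" for x y
  proof -
    obtain n where n: "x + int_vec n \<in> cbox 0 1" using floor_representative by blast
    have near: "\<bar>(y - x) $ i\<bar> < 1" for i
      using that component_le_norm_cart[of "y - x" i] by (simp add: dist_norm)
    have bx: "0 \<le> (x + int_vec n) $ i \<and> (x + int_vec n) $ i \<le> 1" for i
      using n unfolding mem_box_cart by simp
    have by': "-1 \<le> (y + int_vec n) $ i \<and> (y + int_vec n) $ i \<le> 2" for i
    proof -
      have "(y + int_vec n) $ i = (x + int_vec n) $ i + (y - x) $ i" by simp
      then show ?thesis using bx[of i] near[of i] by linarith
    qed
    have "- 1 \<le> (x + int_vec n) $ i \<and> (x + int_vec n) $ i \<le> 2" for i using bx[of i] by linarith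
    then have "x + int_vec n \<in> Q" "y + int_vec n \<in> Q"
      using by' unfolding Q_def mem_box_cart by simp_all
    moreover have "dist (y + int_vec n) (x + int_vec n) < d" using that by simp
    ultimately have "dist (\<phi> (y + int_vec n)) (\<phi> (x + int_vec n)) < r" using d(2) by blast
    moreover obtain m where "\<forall>x. \<phi> (x + int_vec n) = \<phi> x + m" using per by blast
    ultimately show ?thesis by simp
  qed
  then show "\<exists>d>0. \<forall>x\<in>UNIV. \<forall>x'\<in>UNIV. dist x' x < d \<longrightarrow> dist (\<phi> x') (\<phi> x) < r"
    using d(1) by (intro exI[of _ "min d 1"]) auto
qed

text \<open>An isolated point is the only point of the set in some interval with rational end points.\<close>

lemma countable_isolated_points: "countable {t \<in> S. \<not> t islimpt S}" for S :: "real set"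
proof -
  have *: "\<exists>p\<in>\<rat>. \<exists>q\<in>\<rat>. {p<..<q} \<inter> S = {t}" if t: "t \<in> S" "\<not> t islimpt S" for t
  proof -
    obtain r where r: "0 < r" "\<And>y. y \<in> S \<Longrightarrow> dist y t < r \<Longrightarrow> y = t"
      using t(2) unfolding islimpt_approachable by metis
    obtain p where p: "p \<in> \<rat>" "t - r < p" "p < t" using Rats_dense_in_real[of "t - r" t] r by auto
    obtain q where q: "q \<in> \<rat>" "t < q" "q < t + r" using Rats_dense_in_real[of t "t + r"] r by auto
    have "y = t" if "y \<in> {p<..<q} \<inter> S" for y
      using that p q by (intro r(2)) (auto simp: dist_real_def abs_less_iff)
    then have "{p<..<q} \<inter> S \<subseteq> {t}" by blast
    moreover have "t \<in> {p<..<q} \<inter> S" using p q t(1) by simp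
    ultimately have "{p<..<q} \<inter> S = {t}" by blast
    then show ?thesis using p q by blast
  qed
  have "{t \<in> S. \<not> t islimpt S} \<subseteq> (\<Union>p\<in>\<rat>. \<Union>q\<in>\<rat>. {t. {p<..<q} \<inter> S = {t}})"
  proof (intro subsetI)
    fix t assume "t \<in> {t \<in> S. \<not> t islimpt S}"
    then have "t \<in> S" "\<not> t islimpt S" by simp_all
    from * [OF this] obtain p q where "p \<in> \<rat>" "q \<in> \<rat>" "{p<..<q} \<inter> S = {t}" by (elim bexE)
    then show "t \<in> (\<Union>p\<in>\<rat>. \<Union>q\<in>\<rat>. {t. {p<..<q} \<inter> S = {t}})"
      by (intro UN_I) simp_all
  qed
  moreover have "countable (\<Union>p\<in>\<rat>. \<Union>q\<in>\<rat>. {t. {p<..<q} \<inter> S = {t}})"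
  proof (intro countable_UN countable_rat)
    fix p q :: real
    have "{t. {p<..<q} \<inter> S = {t}} \<subseteq> {THE t. {p<..<q} \<inter> S = {t}}"
    proof
      fix t assume "t \<in> {t. {p<..<q} \<inter> S = {t}}"
      then have "{p<..<q} \<inter> S = {t}" by simp
      then have "(THE t. {p<..<q} \<inter> S = {t}) = t" by (intro the_equality) simp_all
      then show "t \<in> {THE t. {p<..<q} \<inter> S = {t}}" by simp
    qed
    then show "countable {t. {p<..<q} \<inter> S = {t}}" by (rule countable_subset) simp
  qed
  ultimately show ?thesis by (rule countable_subset)
qed

section \<open>The lifted Anosov map\<close>

lemma infdist_line:
  assumes e: "norm (e :: 'a::euclidean_space) = 1"
  shows "infdist u (span {e}) = transverse e u"
proof (rule antisym)
  have "infdist u (span {e}) \<le> dist u ((e \<bullet> u) *\<^sub>R e)"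
    by (intro infdist_le span_mul span_base) simp
  then show "infdist u (span {e}) \<le> transverse e u" unfolding transverse_def by (simp add: dist_norm)
  obtain z where z: "z \<in> span {e}" "infdist u (span {e}) = dist u z"
    using infdist_attains_inf[of "span {e}" u] span_zero closed_span by blast
  then obtain c where c: "z = c *\<^sub>R e" unfolding span_singleton by auto
  have "e \<bullet> e = 1" using e by (simp add: norm_eq_1)
  then have "u - (e \<bullet> u) *\<^sub>R e = (u - z) - (e \<bullet> (u - z)) *\<^sub>R e"
    unfolding c by (simp add: inner_diff_right algebra_simps)
  then have "transverse e u = transverse e (u - z)" unfolding transverse_def by (rule arg_cong)
  also have "\<dots> \<le> norm (u - z)" by (rule transverse_le_norm[OF e])
  finally show "transverse e u \<le> infdist u (span {e})" using z(2) by (simp add: dist_norm)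
qed

lemma line_field_frame:
  fixes E :: "'n::finite torus \<Rightarrow> (real ^ 'n) set"
  assumes "continuous_subbundle E" "\<forall>p. dim (E p) = 1"
  obtains U s where "open U" "p \<in> U" "continuous_on U s" "\<And>q. q \<in> U \<Longrightarrow> s q \<noteq> 0" "\<And>q. q \<in> U \<Longrightarrow> E q = span {s q}"
proof -
  obtain k where k: "\<And>p. \<exists>U e. open U \<and> p \<in> U \<and> (\<forall>i<k. continuous_on U (e i)) \<and>
       (\<forall>q\<in>U. inj_on (\<lambda>i::nat. e i q) {..<k} \<and> independent ((\<lambda>i. e i q) ` {..<k}) \<and>
              span ((\<lambda>i. e i q) ` {..<k}) = E q)"
    using assms(1) unfolding continuous_subbundle_def by blast
  obtain U e where U: "open U" "p \<in> U" "\<And>i. i < k \<Longrightarrow> continuous_on U (e i)"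
    and e: "\<And>q. q \<in> U \<Longrightarrow> inj_on (\<lambda>i::nat. e i q) {..<k}" "\<And>q. q \<in> U \<Longrightarrow> independent ((\<lambda>i. e i q) ` {..<k})"
      "\<And>q. q \<in> U \<Longrightarrow> span ((\<lambda>i. e i q) ` {..<k}) = E q"
    using k[of p] by blast
  have "dim (span ((\<lambda>i. e i p) ` {..<k})) = card ((\<lambda>i. e i p) ` {..<k})"
    using e(2)[OF U(2)] by (simp add: dim_eq_card_independent)
  then have "k = 1" using e(1)[OF U(2)] e(3)[OF U(2)] assms(2) by (simp add: card_image)
  then have "(\<lambda>i. e i q) ` {..<k} = {e 0 q}" for q by (auto simp: lessThan_Suc)
  then show thesis
    using U e \<open>k = 1\<close> by (intro that[of U "e 0"]) auto
qed

locale conjugated_stable_line =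
  fixes f h h' :: "'n::finite torus \<Rightarrow> 'n torus" and E :: "'n torus \<Rightarrow> (real ^ 'n) set"
    and A :: "int ^ 'n ^ 'n" and \<alpha> :: real
  assumes alpha: "0 < \<alpha>" "\<alpha> < 1" and f_Hoelder: "torus_C1_Hoelder \<alpha> f"
    and stable: "stable_bundle f E" and dim_E: "\<forall>p. dim (E p) = 1"
    and irr: "irreducible (rat_charpoly A)" and not_bij: "\<not> bij f"
    and homeo: "homeomorphism UNIV UNIV h h'" and h_conj: "h \<circ> f = toral_map A \<circ> h"
begin

abbreviation "Areal \<equiv> map_matrix real_of_int A"

lemma h_simps: "h' (h p) = p" "h (h' p) = p" "h (f p) = toral_map A (h p)"
  using homeo h_conj unfolding homeomorphism_def by (auto simp: o_def fun_eq_iff)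

lemma f_continuous: "continuous_on UNIV f"
proof -
  have cA: "continuous_on UNIV (toral_map A)"
  proof (rule continuous_on_torus)
    have "continuous_on UNIV (\<lambda>x. proj (Areal *v x))"
      by (rule continuous_on_compose2[OF continuous_proj[of UNIV]])
        (auto intro: linear_continuous_on linear_linear)
    then show "continuous_on UNIV (\<lambda>x. toral_map A (proj x))" by (simp add: toral_map.abs_eq)
  qed
  have ch: "continuous_on UNIV h" "continuous_on UNIV h'" using homeo unfolding homeomorphism_def by auto
  from continuous_on_compose2[OF cA ch(1)] have "continuous_on UNIV (\<lambda>p. toral_map A (h p))" by simp
  from continuous_on_compose2[OF ch(2) this] have "continuous_on UNIV (\<lambda>p. h' (toral_map A (h p)))" by simp
  moreover have "f p = h' (toral_map A (h p))" for p by (metis h_simps)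
  ultimately show ?thesis by simp
qed

lemma global_lift:
  assumes "continuous_on UNIV \<phi>"
  shows "\<exists>\<Phi> :: real ^ 'n \<Rightarrow> real ^ 'n. continuous_on UNIV \<Phi> \<and> (\<forall>x. proj (\<Phi> x) = \<phi> (proj x))"
proof -
  have "contractible (UNIV :: (real ^ 'n) set)" by (simp add: convex_imp_contractible)
  moreover have "continuous_on UNIV (\<lambda>x. \<phi> (proj x))"
    by (rule continuous_on_compose2[OF assms continuous_proj]) auto
  ultimately show ?thesis using lift_exists by (metis UNIV_I)
qed

lemma lift_equivariant:
  fixes \<Phi> :: "real ^ 'n \<Rightarrow> real ^ 'n"
  assumes "continuous_on UNIV \<Phi>" "\<And>x. proj (\<Phi> x) = \<phi> (proj x)"
  shows "\<exists>m. \<forall>x. \<Phi> (x + int_vec n) = \<Phi> x + int_vec m"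
proof -
  have "continuous_on UNIV (\<lambda>x. \<Phi> (x + int_vec n))"
    by (rule continuous_on_compose2[OF assms(1)]) (auto intro!: continuous_intros)
  from lifts_differ_constant[OF connected_UNIV UNIV_I this assms(1)] show ?thesis
    by (metis UNIV_I assms(2) proj_shift)
qed

definition "F = (SOME \<Phi> :: real ^ 'n \<Rightarrow> real ^ 'n. continuous_on UNIV \<Phi> \<and> (\<forall>x. proj (\<Phi> x) = f (proj x)))"

lemma F: "continuous_on UNIV F" "proj (F x) = f (proj x)"
  using someI_ex[OF global_lift[OF f_continuous]] unfolding F_def by blast+

lemma F_iter: "proj ((F ^^ n) x) = (f ^^ n) (proj x)"
  by (induction n) (simp_all add: F)

text \<open>The lifts of \<open>h\<close> and of its inverse compose to a deck translation, which is absorbed into the second lift.\<close>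

lemma conjugating_lifts:
  obtains H Hi :: "real ^ 'n \<Rightarrow> real ^ 'n" where "continuous_on UNIV H" "continuous_on UNIV Hi"
    "\<And>x. proj (H x) = h (proj x)" "\<And>x. proj (Hi x) = h' (proj x)" "\<And>x. Hi (H x) = x" "\<And>y. H (Hi y) = y"
proof -
  have "continuous_on UNIV h" "continuous_on UNIV h'" using homeo unfolding homeomorphism_def by auto
  then obtain H Hj :: "real ^ 'n \<Rightarrow> real ^ 'n" where H: "continuous_on UNIV H" "\<And>x. proj (H x) = h (proj x)"
    and Hj: "continuous_on UNIV Hj" "\<And>x. proj (Hj x) = h' (proj x)"
    using global_lift by metis
  have "continuous_on UNIV (\<lambda>x. Hj (H x))" by (rule continuous_on_compose2[OF Hj(1) H(1)]) auto
  then obtain a where a: "\<And>x. Hj (H x) = x + int_vec a"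
    using lifts_differ_constant[OF connected_UNIV UNIV_I, of "\<lambda>x. Hj (H x)" id] by (auto simp: H Hj h_simps)
  define Hi where "Hi y = Hj y - int_vec a" for y
  have Hi: "continuous_on UNIV Hi" unfolding Hi_def by (intro continuous_intros Hj)
  have pHi: "proj (Hi y) = h' (proj y)" for y
    using proj_shift[of "Hi y" a] unfolding Hi_def by (simp add: Hj)
  have HiH: "Hi (H x) = x" for x unfolding Hi_def a by simp
  have "continuous_on UNIV (\<lambda>x. H (Hi x))" by (rule continuous_on_compose2[OF H(1) Hi]) auto
  then obtain b where b: "\<And>x. H (Hi x) = x + int_vec b"
    using lifts_differ_constant[OF connected_UNIV UNIV_I, of "\<lambda>x. H (Hi x)" id] by (auto simp: H pHi h_simps)
  have "int_vec b = 0" using b[of "H 0"] unfolding HiH by simp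
  then have "H (Hi y) = y" for y using b by simp
  then show thesis using that[OF H(1) Hi H(2) pHi HiH] by blast
qed

lemma H_F:
  assumes "continuous_on UNIV H" "\<And>x. proj (H x) = h (proj x)"
  obtains c where "\<And>n x. H ((F ^^ n) x) = ((\<lambda>y. Areal *v y) ^^ n) (H x) + c n"
proof -
  have c1: "continuous_on UNIV (\<lambda>x. H (F x))" by (rule continuous_on_compose2[OF assms(1) F(1)]) auto
  have c2: "continuous_on UNIV (\<lambda>x. Areal *v H x)"
    by (rule continuous_on_compose2[OF _ assms(1), of UNIV]) (auto intro: linear_continuous_on linear_linear)
  have p: "proj (H (F x)) = proj (Areal *v H x)" for x
    unfolding assms(2) F(2) h_simps(3) toral_map.abs_eq[symmetric] by simp
  obtain k where k: "\<And>x. H (F x) = Areal *v H x + int_vec k"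
    using lifts_differ_constant[OF connected_UNIV UNIV_I c1 c2 p] by auto
  have "\<exists>c. \<forall>x. H ((F ^^ n) x) = ((\<lambda>y. Areal *v y) ^^ n) (H x) + c" for n
  proof (induction n)
    case (Suc n)
    then obtain c where "\<forall>x. H ((F ^^ n) x) = ((\<lambda>y. Areal *v y) ^^ n) (H x) + c" by blast
    then have "\<forall>x. H ((F ^^ Suc n) x) = ((\<lambda>y. Areal *v y) ^^ Suc n) (H x) + (Areal *v c + int_vec k)"
      by (simp add: k matrix_vector_right_distrib)
    then show ?case by blast
  qed (auto intro: exI[of _ 0])
  then show thesis using that by metis
qed

definition "DF n x = torus_deriv (f ^^ n) (proj x)"

lemma has_torus_deriv_f: "has_torus_derivative f (torus_deriv f p) p"
proof -
  obtain d where d: "has_torus_derivative f d p"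
    using f_Hoelder unfolding torus_C1_Hoelder_def torus_C1_on_def by blast
  then have "torus_deriv f p = d" unfolding torus_deriv_def using has_torus_derivative_unique by blast
  with d show ?thesis by simp
qed

lemma F_deriv: "(F has_derivative DF 1 x) (at x)"
  unfolding DF_def using has_derivative_lift[OF F has_torus_deriv_f, of x] by simp

lemma DF_Suc: "DF (Suc n) x = DF 1 ((F ^^ n) x) o\<^sub>L DF n x" and F_iter_deriv: "((F ^^ n) has_derivative DF n x) (at x)"
proof -
  have *: "((F ^^ n) has_derivative DF n x) (at x) \<Longrightarrow> ((F ^^ Suc n) has_derivative (DF 1 ((F ^^ n) x) o\<^sub>L DF n x)) (at x)" for n
  proof -
    assume "((F ^^ n) has_derivative DF n x) (at x)"
    from has_derivative_compose[OF this F_deriv]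
    show "((F ^^ Suc n) has_derivative (DF 1 ((F ^^ n) x) o\<^sub>L DF n x)) (at x)" by (simp add: o_def blinfun_compose.rep_eq)
  qed
  have 0: "((F ^^ 0) has_derivative DF 0 x) (at x)"
  proof -
    have "((F ^^ 0) has_derivative id_blinfun) (at x)" by (simp add: id_def)
    moreover from this have "DF 0 x = id_blinfun" unfolding DF_def by (intro torus_deriv_lift[of "F ^^ 0"]) simp_all
    ultimately show ?thesis by simp
  qed
  have step: "DF (Suc n) x = DF 1 ((F ^^ n) x) o\<^sub>L DF n x" if "((F ^^ n) has_derivative DF n x) (at x)" for n
    unfolding DF_def[of "Suc n"] by (rule torus_deriv_lift[of "F ^^ Suc n" "f ^^ Suc n", OF F_iter *[OF that]])
  show d: "((F ^^ n) has_derivative DF n x) (at x)" for n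
  proof (induction n)
    case (Suc n)
    show ?case unfolding step[OF Suc] by (rule *[OF Suc])
  qed (rule 0)
  show "DF (Suc n) x = DF 1 ((F ^^ n) x) o\<^sub>L DF n x" by (rule step[OF d])
qed

lemma DF_periodic: "DF n (x + int_vec m) = DF n x" unfolding DF_def by simp

lemma DF1_bounded: obtains B where "1 \<le> B" "\<And>x. norm (DF 1 x) \<le> B"
proof -
  have "continuous_on UNIV (torus_deriv f)" using f_Hoelder unfolding torus_C1_Hoelder_def torus_C1_on_def by blast
  then have "continuous_on UNIV (\<lambda>x. norm (DF 1 x))"
    unfolding DF_def by (intro continuous_intros) (auto intro!: continuous_on_compose2[of UNIV _ UNIV proj] continuous_proj)
  then obtain B where "\<And>x. norm (DF 1 x) \<le> B" using periodic_bounded DF_periodic by metis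
  then show thesis by (intro that[of "max B 1"]) (auto simp: le_max_iff_disj)
qed

lemma DF_bounds:
  shows "\<exists>B K. 1 \<le> B \<and> 1 \<le> K \<and> (\<forall>x. norm (DF n x) \<le> B) \<and> (\<forall>x y. dist ((F ^^ n) x) ((F ^^ n) y) \<le> B * dist x y) \<and>
    (\<forall>x y. norm (DF n x - DF n y) \<le> K * dist x y powr \<alpha>)"
proof -
  obtain B1 where B1: "1 \<le> B1" "\<And>x. norm (DF 1 x) \<le> B1" using DF1_bounded by metis
  obtain K1 where K1: "\<And>x y. norm (DF 1 x - DF 1 y) \<le> K1 * dist x y powr \<alpha>"
    using f_Hoelder unfolding torus_C1_Hoelder_def DF_def by auto
  define K where "K = max K1 1"
  have K: "1 \<le> K" "norm (DF 1 x - DF 1 y) \<le> K * dist x y powr \<alpha>" for x y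
  proof -
    show "1 \<le> K" unfolding K_def by simp
    have "K1 * dist x y powr \<alpha> \<le> K * dist x y powr \<alpha>"
      unfolding K_def by (intro mult_right_mono) auto
    with K1[of x y] show "norm (DF 1 x - DF 1 y) \<le> K * dist x y powr \<alpha>" by (rule order_trans)
  qed
  show ?thesis
  proof (induction n)
    case 0
    have "DF 0 x = id_blinfun" for x
      unfolding DF_def by (rule torus_deriv_lift[of "F ^^ 0"]) (simp_all add: id_def)
    then show ?case by (intro exI[of _ 1]) (auto simp: norm_blinfun_id_le)
  next
    case (Suc n)
    then obtain B L where B: "1 \<le> B" "1 \<le> L" "\<And>x. norm (DF n x) \<le> B" "\<And>x y. dist ((F ^^ n) x) ((F ^^ n) y) \<le> B * dist x y"
      "\<And>x y. norm (DF n x - DF n y) \<le> L * dist x y powr \<alpha>" by blast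
    have "norm (DF (Suc n) x) \<le> B1 * B" for x
    proof -
      have "norm (DF (Suc n) x) \<le> norm (DF 1 ((F ^^ n) x)) * norm (DF n x)" unfolding DF_Suc by (rule norm_blinfun_compose)
      also have "\<dots> \<le> B1 * B" using B B1 by (intro mult_mono) auto
      finally show ?thesis .
    qed
    note nD = this
    have lip: "dist ((F ^^ Suc n) x) ((F ^^ Suc n) y) \<le> B1 * B * dist x y" for x y
    proof -
      have "norm ((F ^^ Suc n) x - (F ^^ Suc n) y) \<le> B1 * B * norm (x - y)"
      proof (rule differentiable_bound[where S = UNIV])
        show "((F ^^ Suc n) has_derivative DF (Suc n) z) (at z within UNIV)" for z
          by (rule has_derivative_at_withinI[OF F_iter_deriv])
        show "onorm (blinfun_apply (DF (Suc n) z)) \<le> B1 * B" for z using nD by (simp add: norm_blinfun.rep_eq)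
      qed auto
      then show ?thesis by (simp only: dist_norm)
    qed
    define L' where "L' = B1 * L + K * B powr \<alpha> * B"
    have "norm (DF (Suc n) x - DF (Suc n) y) \<le> L' * dist x y powr \<alpha>" for x y
    proof -
      let ?X = "(F ^^ n) x" and ?Y = "(F ^^ n) y"
      have "DF (Suc n) x - DF (Suc n) y = (DF 1 ?X o\<^sub>L (DF n x - DF n y)) + ((DF 1 ?X - DF 1 ?Y) o\<^sub>L DF n y)"
        unfolding DF_Suc by (intro blinfun_eqI) (simp add: blinfun.bilinear_simps)
      then have "norm (DF (Suc n) x - DF (Suc n) y) \<le> norm (DF 1 ?X o\<^sub>L (DF n x - DF n y)) + norm ((DF 1 ?X - DF 1 ?Y) o\<^sub>L DF n y)"
        by (metis norm_triangle_ineq)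
      also have "norm (DF 1 ?X o\<^sub>L (DF n x - DF n y)) \<le> B1 * (L * dist x y powr \<alpha>)"
        using B B1 by (intro order_trans[OF norm_blinfun_compose] mult_mono) auto
      also have "norm ((DF 1 ?X - DF 1 ?Y) o\<^sub>L DF n y) \<le> (K * (B powr \<alpha> * dist x y powr \<alpha>)) * B"
      proof (intro order_trans[OF norm_blinfun_compose] mult_mono)
        have "dist ?X ?Y powr \<alpha> \<le> (B * dist x y) powr \<alpha>" using B(4) alpha by (intro powr_mono2) auto
        also have "\<dots> = B powr \<alpha> * dist x y powr \<alpha>" by (rule powr_mult)
        finally have "K * dist ?X ?Y powr \<alpha> \<le> K * (B powr \<alpha> * dist x y powr \<alpha>)" using K(1) by (intro mult_left_mono) auto
        then show "norm (DF 1 ?X - DF 1 ?Y) \<le> K * (B powr \<alpha> * dist x y powr \<alpha>)" using K(2)[of ?X ?Y] by linarith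
      qed (use B K in auto)
      finally show ?thesis unfolding L'_def by (simp add: algebra_simps)
    qed
    moreover have "1 \<le> B1 * B" using B(1) B1(1) mult_mono[of 1 B1 1 B] by simp
    moreover have "1 \<le> L'"
    proof -
      have "1 \<le> B1 * L" using B(2) B1(1) mult_mono[of 1 B1 1 L] by simp
      moreover have "0 \<le> K * B powr \<alpha> * B" using K B by simp
      ultimately show ?thesis unfolding L'_def by linarith
    qed
    ultimately show ?case using nD lip by blast
  qed
qed

lemma E_line: "\<exists>u. norm u = 1 \<and> E p = span {u}"
proof -
  obtain U s where "p \<in> U" "\<And>q. q \<in> U \<Longrightarrow> s q \<noteq> 0" "\<And>q. q \<in> U \<Longrightarrow> E q = span {s q}"
    using line_field_frame[of E p] stable dim_E unfolding stable_bundle_def by metis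
  then have s: "s p \<noteq> 0" "E p = span {s p}" by auto
  have "span {sgn (s p)} = span {s p}"
    unfolding sgn_div_norm using span_image_scale[of "{s p}" "\<lambda>_. inverse (norm (s p))"] s(1) by simp
  then show ?thesis using s by (intro exI[of _ "sgn (s p)"]) (simp add: norm_sgn)
qed

text \<open>The signs at different points are unrelated; since \<open>e x\<close> is a function of \<open>proj x\<close>, it is periodic.\<close>

definition "e x = (SOME u. norm u = 1 \<and> E (proj x) = span {u})"

lemma e: "norm (e x) = 1" "E (proj x) = span {e x}"
  using someI_ex[OF E_line[of "proj x"]] unfolding e_def by auto

lemma e_periodic: "e (x + int_vec n) = e x" unfolding e_def by simp

lemma unit_in_E: 
  assumes "u \<in> E (proj x)" "norm u = 1"
  shows "u = e x \<or> u = - e x"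
proof -
  obtain c where c: "u = c *\<^sub>R e x" using assms(1) unfolding e(2) span_singleton by auto
  then have "\<bar>c\<bar> = 1" using assms(2) e(1)[of x] by simp
  then have "c = 1 \<or> c = -1" by linarith
  then show ?thesis using c by auto
qed

lemma e_in_E: "e x \<in> E (proj x)" unfolding e(2) by (rule span_base) simp

lemma e_section:
  assumes u: "u = e x \<or> u = - e x" and lim: "g \<longlonglongrightarrow> x"
  shows "\<exists>U. U \<longlonglongrightarrow> u \<and> (\<forall>k. U k = e (g k) \<or> U k = - e (g k))"
proof -
  obtain V s where V: "open V" "proj x \<in> V" "continuous_on V s" and s: "\<And>q. q \<in> V \<Longrightarrow> s q \<noteq> 0" "\<And>q. q \<in> V \<Longrightarrow> E q = span {s q}"
    using line_field_frame[of E "proj x"] stable dim_E unfolding stable_bundle_def by metis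
  define w where "w q = sgn (s q)" for q
  have w: "w q \<in> E q" "norm (w q) = 1" if "q \<in> V" for q
  proof -
    show "w q \<in> E q" unfolding w_def s(2)[OF that] sgn_div_norm by (intro span_mul span_base) simp
    show "norm (w q) = 1" unfolding w_def using s(1)[OF that] by (simp add: norm_sgn)
  qed
  have "u = w (proj x) \<or> u = - w (proj x)" using unit_in_E[OF w[OF V(2)]] u by auto
  then obtain \<theta> :: real where \<theta>: "\<theta> = 1 \<or> \<theta> = -1" "u = \<theta> *\<^sub>R w (proj x)" by (metis scaleR_one scaleR_minus1_left)
  have projlim: "(\<lambda>k. proj (g k)) \<longlonglongrightarrow> proj x"
    by (rule continuous_on_tendsto_compose[OF continuous_proj[of UNIV] lim]) auto
  have ev: "\<forall>\<^sub>F k in sequentially. proj (g k) \<in> V" using topological_tendstoD[OF projlim V(1,2)] .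
  have "(\<lambda>k. s (proj (g k))) \<longlonglongrightarrow> s (proj x)"
    by (rule continuous_on_tendsto_compose[OF V(3) projlim V(2) ev])
  then have lim2: "(\<lambda>k. \<theta> *\<^sub>R w (proj (g k))) \<longlonglongrightarrow> u"
    unfolding \<theta>(2) w_def using s(1)[OF V(2)] by (intro tendsto_intros tendsto_sgn)
  define U where "U k = (if proj (g k) \<in> V then \<theta> *\<^sub>R w (proj (g k)) else e (g k))" for k
  have "U \<longlonglongrightarrow> u"
    by (rule Lim_transform_eventually[OF lim2]) (use ev in \<open>auto simp: U_def elim: eventually_mono\<close>)
  moreover have "U k = e (g k) \<or> U k = - e (g k)" for k
    using unit_in_E[OF w, of "g k"] \<theta>(1) unfolding U_def by auto
  ultimately show ?thesis by blast
qed

lemma DF_E: "DF n x (e x) \<noteq> 0 \<and> DF n x (e x) \<in> E (proj ((F ^^ n) x))"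
proof (induction n)
  case 0
  have "DF 0 x = id_blinfun" unfolding DF_def by (rule torus_deriv_lift[of "F ^^ 0"]) (simp_all add: id_def)
  then show ?case using e(1)[of x] e_in_E by auto
next
  case (Suc n)
  define y where "y = (F ^^ n) x"
  have img: "blinfun_apply (DF 1 y) ` E (proj y) = E (f (proj y))"
    using stable unfolding stable_bundle_def DF_def by simp
  have ne: "DF 1 y (e y) \<noteq> 0"
  proof
    assume 0: "DF 1 y (e y) = 0"
    have "E (f (proj y)) \<subseteq> {0}"
    proof
      fix z assume "z \<in> E (f (proj y))"
      then obtain c where "z = DF 1 y (c *\<^sub>R e y)" unfolding img[symmetric] e(2) span_singleton by auto
      then show "z \<in> {0}" using 0 by (simp add: blinfun.scaleR_right)
    qed
    then have "e (F y) = 0" using e_in_E[of "F y"] F(2) by auto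
    then show False using e(1)[of "F y"] by simp
  qed
  obtain c where c: "DF n x (e x) = c *\<^sub>R e y" using Suc unfolding y_def e(2) span_singleton by auto
  then have "c \<noteq> 0" using Suc by auto
  have "DF (Suc n) x (e x) = c *\<^sub>R DF 1 y (e y)"
    unfolding DF_Suc y_def[symmetric] using c by (simp add: blinfun.scaleR_right)
  moreover have "DF 1 y (e y) \<in> E (f (proj y))" using img e_in_E by blast
  then have "c *\<^sub>R DF 1 y (e y) \<in> E (f (proj y))" unfolding F(2)[symmetric] e(2) by (rule span_mul)
  ultimately show ?case using ne \<open>c \<noteq> 0\<close> unfolding y_def by (simp add: F)
qed

text \<open>A high iterate absorbs the constants in uniform contraction and expansion. The lower bound \<open>g0\<close> exists by
compactness, since the derivative is injective: a vector in its kernel has no transverse component by expansion, and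
no tangential one by invariance of the bundle.\<close>

lemma stable_line_map_exists:
  obtains N B K g0 \<epsilon> where "1 \<le> N" "stable_line_map (F ^^ N) (DF N) e \<alpha> K B g0 \<epsilon>"
proof -
  obtain C r where C: "0 < C" "0 < r" "r < 1"
    "\<And>p n v. v \<in> E p \<Longrightarrow> norm (torus_deriv (f ^^ n) p v) \<le> C * r ^ n * norm v"
    using stable unfolding stable_bundle_def uniformly_contracting_def by metis
  obtain C' \<mu> where C': "0 < C'" "1 < \<mu>"
    "\<And>p n v. infdist (torus_deriv (f ^^ n) p v) (E ((f ^^ n) p)) \<ge> C' * \<mu> ^ n * infdist v (E p)"
    using stable unfolding stable_bundle_def quotient_uniformly_expanding_def by metis
  have "(\<lambda>n. C * r ^ n) \<longlonglongrightarrow> C * 0" using C by (intro tendsto_intros LIMSEQ_power_zero) auto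
  then have "\<forall>\<^sub>F n in sequentially. C * r ^ n < 1/4" by (intro order_tendstoD) auto
  moreover have "(\<lambda>n. (1/\<mu>) ^ n) \<longlonglongrightarrow> 0" using C' by (intro LIMSEQ_power_zero) auto
  then have "\<forall>\<^sub>F n in sequentially. (1/\<mu>) ^ n < C' / 4" using C' by (intro order_tendstoD) auto
  ultimately have "\<forall>\<^sub>F n in sequentially. C * r ^ n < 1/4 \<and> (1/\<mu>) ^ n < C' / 4 \<and> 1 \<le> n"
    using eventually_ge_at_top[of 1] by eventually_elim auto
  then obtain N where N: "C * r ^ N < 1/4" "(1/\<mu>) ^ N < C' / 4" "1 \<le> N"
    using eventually_happens'[OF sequentially_bot] by blast
  have N2: "4 \<le> C' * \<mu> ^ N"
  proof -
    have "1 / \<mu> ^ N < C' / 4" using N(2) by (simp add: power_one_over)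
    then show ?thesis using C' by (simp add: field_simps)
  qed
  obtain B K where BK: "1 \<le> B" "1 \<le> K" "\<And>x. norm (DF N x) \<le> B" "\<And>x y. norm (DF N x - DF N y) \<le> K * dist x y powr \<alpha>"
    using DF_bounds[of N] by blast
  have expand: "4 * transverse (e x) u \<le> transverse (e ((F ^^ N) x)) (DF N x u)" for x u
  proof -
    have "C' * \<mu> ^ N * transverse (e x) u \<le> transverse (e ((F ^^ N) x)) (DF N x u)"
      using C'(3)[where p = "proj x" and n = N and v = u] unfolding DF_def[symmetric] F_iter[symmetric] e(2) infdist_line[OF e(1)] .
    moreover have "4 * transverse (e x) u \<le> C' * \<mu> ^ N * transverse (e x) u"
      using N2 by (intro mult_right_mono) (auto simp: transverse_def)
    ultimately show ?thesis by linarith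
  qed
  \<comment> \<open>minimising over all unit vectors, not only over the discontinuous \<open>e\<close>, needs injectivity of the whole derivative\<close>
  have inj: "u = 0" if "DF N x u = 0" for x u
  proof -
    have "transverse (e x) u \<le> 0" using expand[of x u] that unfolding transverse_def by simp
    then have u: "u = (e x \<bullet> u) *\<^sub>R e x" unfolding transverse_def by simp
    then have "(e x \<bullet> u) *\<^sub>R DF N x (e x) = 0" using that by (metis blinfun.scaleR_right)
    then have "e x \<bullet> u = 0" using DF_E by simp
    then show ?thesis using u by simp
  qed
  have contD: "continuous_on UNIV (DF N)"
    using BK(4) by (intro Hoelder_imp_continuous_on[OF alpha(1), of _ _ K]) auto
  define Z where "Z = cbox (0 :: real ^ 'n) 1 \<times> sphere (0 :: real ^ 'n) 1"
  have "compact Z" unfolding Z_def by (intro compact_Times) auto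
  moreover have "(0, e 0) \<in> Z" unfolding Z_def using e(1)[of 0] by (auto simp: mem_box_cart)
  then have "Z \<noteq> {}" by blast
  moreover have "continuous_on Z (\<lambda>z. norm (DF N (fst z) (snd z)))"
    by (intro continuous_intros continuous_on_compose2[OF contD]) auto
  ultimately obtain z0 where z0: "z0 \<in> Z" "\<forall>z\<in>Z. norm (DF N (fst z0) (snd z0)) \<le> norm (DF N (fst z) (snd z))"
    using continuous_attains_inf by blast
  define g0 where "g0 = norm (DF N (fst z0) (snd z0))"
  have g0: "0 < g0" unfolding g0_def using z0(1) inj[of "fst z0" "snd z0"] unfolding Z_def by auto
  have g0_le: "g0 \<le> norm (DF N x (e x))" for x
  proof -
    obtain n where n: "x + int_vec n \<in> cbox 0 1" using floor_representative by blast
    then have "g0 \<le> norm (DF N (x + int_vec n) (e x))"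
      unfolding g0_def using bspec[OF z0(2), of "(x + int_vec n, e x)"] e(1)[of x] by (simp add: Z_def)
    then show ?thesis by (simp add: DF_periodic)
  qed
  \<comment> \<open>the factor 2 makes the smallness condition of the locale strict\<close>
  define \<epsilon> where "\<epsilon> = (g0 / (2 * (K * (1 + 8 * B)))) powr (1 / \<alpha>)"
  have KB: "0 < K * (1 + 8 * B)" using BK by simp
  have \<epsilon>: "\<epsilon> powr \<alpha> = g0 / (2 * (K * (1 + 8 * B)))"
  proof -
    have "0 < g0 / (2 * (K * (1 + 8 * B)))" using g0 KB by simp
    moreover have "(z powr (1 / \<alpha>)) powr \<alpha> = z" if "0 < z" for z :: real
      using that alpha by (simp add: powr_powr)
    ultimately show ?thesis unfolding \<epsilon>_def by blast
  qed
  have \<epsilon>2: "K * \<epsilon> powr \<alpha> * (1 + 8 * B) = g0 / 2" 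
  proof -
    have "K \<noteq> 0" "1 + 8 * B \<noteq> 0" using BK by auto
    then show ?thesis unfolding \<epsilon> by (simp add: divide_simps)
  qed
  have "stable_line_map (F ^^ N) (DF N) e \<alpha> K B g0 \<epsilon>"
  proof
    have "0 < g0 / (2 * (K * (1 + 8 * B)))" using g0 KB by simp
    then show "0 < \<epsilon>" unfolding \<epsilon>_def powr_gt_zero by (rule less_imp_neq[symmetric])
    show "K * \<epsilon> powr \<alpha> * (1 + 8 * B) < g0" unfolding \<epsilon>2 using g0 by simp
    show "\<exists>c. DF N x (e x) = c *\<^sub>R e ((F ^^ N) x)" for x using DF_E[of N x] unfolding e(2) span_singleton by auto
    show "norm (DF N x (e x)) \<le> 1 / 4" for x
      using C(4)[OF e_in_E[of x], where n = N] N(1) e(1)[of x] unfolding DF_def[symmetric] by simp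
  qed (use alpha BK F_iter_deriv e(1) g0_le expand in auto)
  then show thesis using that N(3) by blast
qed

end

section \<open>The lifted conjugacy along stable arcs\<close>

context conjugated_stable_line
begin

lemma matrix_pow_linear: "linear ((\<lambda>x. Areal *v x) ^^ n)"
proof (induction n)
  case (Suc n)
  then have "linear ((\<lambda>x. Areal *v x) \<circ> ((\<lambda>x. Areal *v x) ^^ n))" by (intro linear_compose) auto
  then show ?case by (simp only: funpow.simps)
qed (simp only: funpow.simps linear_id)

lemma matrix_pow_int: "((\<lambda>x. Areal *v x) ^^ n) (int_vec k) = int_vec (((\<lambda>z. A *v z) ^^ n) k)"
  by (induction n) (simp_all add: int_vec_mult)

text \<open>The stable space of the linear part is a line that \<open>A\<close> leaves invariant, so it is spanned by an eigenvector of \<open>A\<close>.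
If \<open>det A\<close> were zero, the kernel of \<open>A\<close> would be this line and the iterate of \<open>F\<close> would collapse the arc; if
\<open>det A\<close> were \<open>1\<close> or \<open>-1\<close>, then \<open>f\<close> would be a bijection. So \<open>stable_line_approximable\<close> applies, and the
approximating vectors are merging, because \<open>Hi\<close> maps integer translations to integer translations.\<close>

lemma lifted_arc_C1_Hoelder:
  assumes H: "continuous_on UNIV H" "continuous_on UNIV Hi"
      "\<And>x. proj (H x) = h (proj x)" "\<And>x. proj (Hi x) = h' (proj x)" "\<And>x. Hi (H x) = x" "\<And>y. H (Hi y) = y"
    and ab: "a < b" and C': "continuous_on {a..b} C'"
    and C: "\<And>t. t \<in> {a..b} \<Longrightarrow> (C has_vector_derivative C' t) (at t within {a..b})"
      "\<And>t. t \<in> {a..b} \<Longrightarrow> norm (C' t) = 1" "\<And>t. t \<in> {a..b} \<Longrightarrow> C' t \<in> E (proj (C t))"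
  shows "C1_Hoelder_on \<alpha> a b (\<lambda>t. H (C t))"
proof -
  obtain N B K g0 \<epsilon> where N: "1 \<le> N" and slm: "stable_line_map (F ^^ N) (DF N) e \<alpha> K B g0 \<epsilon>"
    by (rule stable_line_map_exists)
  interpret stable_line_map "F ^^ N" "DF N" e \<alpha> K B g0 \<epsilon> by (rule slm)
  obtain c where c: "\<And>n x. H ((F ^^ n) x) = ((\<lambda>y. Areal *v y) ^^ n) (H x) + c n" by (rule H_F[OF H(1,3)]) (rule that)
  define L where "L = ((\<lambda>y. Areal *v y) ^^ N)"
  interpret linearized_line_map "F ^^ N" "DF N" e \<alpha> K B g0 \<epsilon> H Hi L "c N"
  proof
    show "\<alpha> < 1" by (rule alpha)
    show "uniformly_continuous_on UNIV H"
      by (rule equivariant_uniformly_continuous[OF H(1)]) (use lift_equivariant[OF H(1,3)] in blast)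
    show "uniformly_continuous_on UNIV Hi"
      by (rule equivariant_uniformly_continuous[OF H(2)]) (use lift_equivariant[OF H(2,4)] in blast)
    show "Hi (H x) = x" for x by (rule H)
    show "H (Hi y) = y" for y by (rule H)
    show "L (x + y) = L x + L y" for x y unfolding L_def by (rule linear_add[OF matrix_pow_linear])
    show "L (r *\<^sub>R x) = r *\<^sub>R L x" for r x unfolding L_def by (rule linear_scale[OF matrix_pow_linear])
    show "H ((F ^^ N) x) = L (H x) + c N" for x unfolding L_def by (rule c)
    show "\<exists>U. U \<longlonglongrightarrow> u \<and> (\<forall>k. unit_tangent (g k) (U k))" if "unit_tangent x u" "g \<longlonglongrightarrow> x" for x u g
      using e_section[of u x g] that unfolding unit_tangent_def by blast
  qed
  have arc: "tangent_arc C C' a b"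
    unfolding tangent_arc_def unit_tangent_def using ab C' C unit_in_E by blast
  obtain v where v: "v \<noteq> 0" "decaying v" "\<And>w. decaying w \<Longrightarrow> \<exists>c. w = c *\<^sub>R v"
    by (rule stable_space_line[OF arc]) (rule that)
  have commute: "(L ^^ n) (Areal *v w) = Areal *v (L ^^ n) w" for n w
  proof -
    have "((\<lambda>y. Areal *v y) ^^ m) (Areal *v w) = Areal *v ((\<lambda>y. Areal *v y) ^^ m) w" for m w
      by (rule funpow_swap1[symmetric])
    then show ?thesis unfolding L_def funpow_mult by blast
  qed
  have "decaying (Areal *v v)"
  proof -
    have "(\<lambda>n. Areal *v (L ^^ n) v) \<longlonglongrightarrow> Areal *v 0"
      using v(2) unfolding decaying_def
      by (intro continuous_on_tendsto_compose[of UNIV "\<lambda>x. Areal *v x"]) (auto intro: linear_continuous_on linear_linear)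
    then show ?thesis unfolding decaying_def commute by simp
  qed
  then obtain l where l: "Areal *v v = l *\<^sub>R v" using v(3) by blast
  have det0: "det A \<noteq> 0"
  proof
    assume "det A = 0"
    then have "det Areal = 0" by (simp add: det_of_int)
    then obtain u where u: "Areal *v u = 0" "u \<noteq> 0"
      using invertible_det_nz[of Areal] matrix_left_invertible_ker[of Areal] invertible_left_inverse[of Areal] by blast
    have Lu: "L u = 0"
    proof -
      obtain m where m: "N = Suc m" using N by (cases N) auto
      have "L u = ((\<lambda>y. Areal *v y) ^^ m) (Areal *v u)" unfolding L_def m funpow_Suc_right by simp
      then show ?thesis unfolding u(1) linear_0[OF matrix_pow_linear] .
    qed
    have "(L ^^ Suc n) u = 0" for n by (induction n) (simp_all add: Lu linear_0[OF lin])
    then have "decaying u" unfolding decaying_def by (rule LIMSEQ_imp_Suc[of _ 0, OF tendsto_eventually[OF always_eventually], OF allI])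
    then obtain s where s: "u = s *\<^sub>R v" using v(3) by blast
    then have Lv: "L v = 0" using Lu u(2) by (auto simp: linear_scale[OF lin])
    have aa: "a \<in> {a..b}" using ab by simp
    have const: "orb 1 (C t) = orb 1 (C a)" if t: "t \<in> {a..b}" for t
    proof -
      obtain r where r: "H (C t) - H (C a) = r *\<^sub>R v" using v(3) arc_decaying[OF arc t aa] by blast
      have "H (orb 1 (C t)) - H (orb 1 (C a)) = 0"
        unfolding H_orb_diff r using Lv by (simp add: linear_scale[OF lin])
      then show ?thesis using Hi_H by (metis right_minus_eq)
    qed
    have "((\<lambda>t. orb 1 (C t)) has_vector_derivative 0) (at a within {a..b})"
      by (rule has_vector_derivative_transform[OF aa const has_vector_derivative_const])
    with tangent_arc_orb[OF arc aa, of 1] have "contraction 1 (C a) *\<^sub>R direction 1 (C a) (C' a) = 0"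
      using vector_derivative_unique_within_closed_interval[of a b a] ab aa by fastforce
    moreover have "norm (direction 1 (C a) (C' a)) = 1"
      by (rule unit_tangent_norm[OF direction_unit_tangent[OF tangent_arc_unit[OF arc aa]]])
    ultimately show False using contraction_pos[of 1 "C a"] by auto
  qed
  have "\<bar>det A\<bar> \<noteq> 1"
  proof
    assume "\<bar>det A\<bar> = 1"
    then have "bij (toral_map A)" by (rule unimodular_toral_map_bij)
    moreover have "bij h" "bij h'" using h_simps by (auto intro!: o_bij[of h' h] o_bij[of h h'] simp: fun_eq_iff)
    ultimately have "bij (h' \<circ> (toral_map A \<circ> h))" by (intro bij_comp)
    moreover have "h' \<circ> (toral_map A \<circ> h) = f" using h_simps by (auto simp: fun_eq_iff) (metis h_simps)
    ultimately show False using not_bij by simp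
  qed
  then have det2: "2 \<le> \<bar>det A\<bar>" using det0 by linarith
  have approx: "\<exists>w. norm (w - s *\<^sub>R v) < r \<and> merging w" if r: "0 < r" for s r
  proof -
    obtain n w k where w: "((\<lambda>x. Areal *v x) ^^ n) w = int_vec k" "norm (w - s *\<^sub>R v) < r"
      using stable_line_approximable[OF irr l v(1) det2 r] by blast
    have "\<exists>\<kappa>. \<forall>x. orb j (Hi (H x + w)) = orb j x + \<kappa> \<and> e (orb j x + \<kappa>) = e (orb j x)" if j: "n \<le> j" for j
    proof -
      \<comment> \<open>\<open>j\<close> steps of the iterate are \<open>N * j\<close> steps of \<open>F\<close>\<close>
      let ?m = "N * j"
      have nm: "n \<le> ?m" using j N by (metis mult_le_mono1 mult_1 order_trans)
      have "((\<lambda>x. Areal *v x) ^^ ?m) w = ((\<lambda>x. Areal *v x) ^^ (?m - n)) (int_vec k)"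
        unfolding w(1)[symmetric] using nm by (metis funpow_add le_add_diff_inverse2 o_apply)
      then obtain k' where k': "((\<lambda>x. Areal *v x) ^^ ?m) w = int_vec k'" unfolding matrix_pow_int by blast
      obtain q where q: "\<And>z. Hi (z + int_vec k') = Hi z + int_vec q" using lift_equivariant[OF H(2,4)] by metis
      have "orb j (Hi (H x + w)) = orb j x + int_vec q" for x
      proof -
        have "H ((F ^^ ?m) (Hi (H x + w))) = ((\<lambda>y. Areal *v y) ^^ ?m) (H x + w) + c ?m" unfolding c H ..
        also have "\<dots> = H ((F ^^ ?m) x) + int_vec k'" unfolding c linear_add[OF matrix_pow_linear] k' by simp
        finally have "Hi (H ((F ^^ ?m) (Hi (H x + w)))) = Hi (H ((F ^^ ?m) x) + int_vec k')" by simp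
        then show ?thesis unfolding q H funpow_mult .
      qed
      then show ?thesis using e_periodic by blast
    qed
    then show ?thesis using w(2) unfolding merging_def by blast
  qed
  obtain \<delta> where \<delta>: "0 < \<delta>" "\<delta> \<le> \<epsilon>"
    "\<And>x y w. (\<And>n. dist (orb n x) (orb n y) < \<delta>) \<Longrightarrow> stable_pair (Hi (H x + w)) (Hi (H y + w))"
  proof (rule translate_stable)
    fix \<delta> assume d: "0 < \<delta>" "\<delta> \<le> \<epsilon>"
      "\<And>x y w. (\<And>n. dist (orb n x) (orb n y) < \<delta>) \<Longrightarrow> stable_pair (Hi (H x + w)) (Hi (H y + w))"
    show thesis by (rule that[OF d])
  qed
  show ?thesis by (rule arc_C1_Hoelder[OF v(1,3) approx \<delta> arc])
qed

end

section \<open>Curves contained in a leaf\<close>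

lemma span_limit_direction:
  fixes p q :: "'a::euclidean_space"
  assumes "P \<longlonglongrightarrow> p" "Q \<longlonglongrightarrow> q" "q \<noteq> 0" "\<And>k. P k = \<rho> k *\<^sub>R Q k"
  shows "p \<in> span {q}"
proof -
  have "(\<lambda>k. (Q k \<bullet> Q k) *\<^sub>R P k - (Q k \<bullet> P k) *\<^sub>R Q k) \<longlonglongrightarrow> (q \<bullet> q) *\<^sub>R p - (q \<bullet> p) *\<^sub>R q"
    by (intro tendsto_intros assms)
  moreover have "(Q k \<bullet> Q k) *\<^sub>R P k - (Q k \<bullet> P k) *\<^sub>R Q k = 0" for k by (simp add: assms(4) mult.commute)
  ultimately have "(q \<bullet> q) *\<^sub>R p - (q \<bullet> p) *\<^sub>R q = 0" by (simp add: LIMSEQ_const_iff)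
  then have "(q \<bullet> q) *\<^sub>R p = (q \<bullet> p) *\<^sub>R q" by simp
  then have "p = ((q \<bullet> p) / (q \<bullet> q)) *\<^sub>R q"
    using assms(3) by (metis divide_inverse_commute inner_eq_zero_iff left_inverse scaleR_one scaleR_scaleR)
  then show ?thesis by (metis span_base span_mul singletonI)
qed

lemma vector_derivative_sequence:
  assumes "(C has_vector_derivative v) (at t within S)" "s \<longlonglongrightarrow> t" "\<And>k. s k \<in> S" "\<And>k. s k \<noteq> t"
  shows "(\<lambda>k. (C (s k) - C t) /\<^sub>R (s k - t)) \<longlonglongrightarrow> v"
proof -
  have "((\<lambda>y. (1 / norm (y - t)) *\<^sub>R (C y - (C t + (y - t) *\<^sub>R v))) \<longlongrightarrow> 0) (at t within S)"
    using assms(1) unfolding has_vector_derivative_def has_derivative_within by simp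
  then have "((\<lambda>y. norm ((1 / norm (y - t)) *\<^sub>R (C y - (C t + (y - t) *\<^sub>R v)))) \<longlongrightarrow> 0) (at t within S)"
    by (rule tendsto_norm_zero)
  then have "((\<lambda>y. norm ((C y - C t) /\<^sub>R (y - t) - v)) \<longlongrightarrow> 0) (at t within S)"
  proof (rule Lim_transform_eventually)
    show "\<forall>\<^sub>F y in at t within S. norm ((1 / norm (y - t)) *\<^sub>R (C y - (C t + (y - t) *\<^sub>R v))) = norm ((C y - C t) /\<^sub>R (y - t) - v)"
      unfolding eventually_at_filter
    proof (intro always_eventually allI impI)
      fix y assume "y \<noteq> t"
      then have "(C y - C t) /\<^sub>R (y - t) - v = inverse (y - t) *\<^sub>R (C y - (C t + (y - t) *\<^sub>R v))"
        by (simp add: scaleR_diff_right scaleR_add_right)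
      then show "norm ((1 / norm (y - t)) *\<^sub>R (C y - (C t + (y - t) *\<^sub>R v))) = norm ((C y - C t) /\<^sub>R (y - t) - v)"
        by (simp add: divide_inverse)
    qed
  qed
  then have "((\<lambda>y. (C y - C t) /\<^sub>R (y - t)) \<longlongrightarrow> v) (at t within S)"
    by (rule LIM_zero_cancel[OF tendsto_norm_zero_cancel])
  moreover have "filterlim s (at t within S) sequentially"
    unfolding filterlim_at using assms by simp
  ultimately show ?thesis by (rule filterlim_compose)
qed

text \<open>The times \<open>s k\<close> are those at which the curve visits a compact piece of the leaf; the corresponding leaf parameters
need not depend continuously on time. Along a subsequence they converge to some \<open>\<theta>\<close>, and from some index on the
secants of the curve at \<open>t\<close> are secants of the leaf parametrisation at \<open>\<theta>\<close>, up to a constant deck translation.\<close>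

lemma leaf_tangent_at_accumulation:
  fixes C C0 :: "real \<Rightarrow> real ^ 'n::finite"
  assumes dC: "(C has_vector_derivative p) (at t within S)" and p: "p \<noteq> 0"
    and dC0: "\<And>\<theta>. (C0 has_vector_derivative C0' \<theta>) (at \<theta>)" and C0': "\<And>\<theta>. C0' \<theta> \<noteq> 0"
    and s: "s \<longlonglongrightarrow> t" "\<And>k. s k \<in> S" "\<And>k. s k \<noteq> t"
    and track: "\<And>k. \<theta> k \<in> {-R..R}" "\<And>k. proj (C (s k)) = proj (C0 (\<theta> k))"
  shows "\<exists>\<theta>. proj (C t) = proj (C0 \<theta>) \<and> p \<in> span {C0' \<theta>}"
proof -
  obtain \<theta>0 r where r: "strict_mono r" "(\<theta> \<circ> r) \<longlonglongrightarrow> \<theta>0"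
    using compact_Icc[of "-R" R] track(1) unfolding compact_def by metis
  have sr: "(\<lambda>k. s (r k)) \<longlonglongrightarrow> t" using LIMSEQ_subseq_LIMSEQ[OF s(1) r(1)] by (simp add: o_def)
  have tr: "(\<lambda>k. \<theta> (r k)) \<longlonglongrightarrow> \<theta>0" using r(2) by (simp add: o_def)
  have quot: "(\<lambda>k. (C (s (r k)) - C t) /\<^sub>R (s (r k) - t)) \<longlonglongrightarrow> p"
    using vector_derivative_sequence[OF dC sr] s by blast
  have "(\<lambda>k. (s (r k) - t) *\<^sub>R ((C (s (r k)) - C t) /\<^sub>R (s (r k) - t))) \<longlonglongrightarrow> (t - t) *\<^sub>R p"
    by (intro tendsto_intros sr quot)
  then have "(\<lambda>k. C (s (r k)) - C t) \<longlonglongrightarrow> 0" using s(3) by simp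
  then have Clim: "(\<lambda>k. C (s (r k))) \<longlonglongrightarrow> C t" by (rule LIM_zero_cancel)
  have "isCont C0 \<theta>0" using has_vector_derivative_continuous[OF dC0] .
  then have C0lim: "(\<lambda>k. C0 (\<theta> (r k))) \<longlonglongrightarrow> C0 \<theta>0" using tr by (rule isCont_tendsto_compose)
  define \<Delta> where "\<Delta> k = C (s (r k)) - C0 (\<theta> (r k))" for k
  have \<Delta>: "\<Delta> \<longlonglongrightarrow> C t - C0 \<theta>0" unfolding \<Delta>_def by (intro tendsto_intros Clim C0lim)
  have "\<exists>m. \<Delta> k = int_vec m" for k unfolding \<Delta>_def using track(2) proj_eq_iff by blast
  then obtain m where m: "\<And>k. \<Delta> k = int_vec (m k)" by metis
  have "\<forall>\<^sub>F k in sequentially. dist (\<Delta> k) (C t - C0 \<theta>0) < 1/2" using \<Delta> by (rule tendstoD) simp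
  then obtain k0 where k0: "\<And>k. k \<ge> k0 \<Longrightarrow> dist (\<Delta> k) (C t - C0 \<theta>0) < 1/2" unfolding eventually_sequentially by blast
  \<comment> \<open>the deck translations converge, so they are eventually constant\<close>
  have const: "\<Delta> k = \<Delta> k0" if "k \<ge> k0" for k
  proof -
    have "dist (\<Delta> k) (\<Delta> k0) < 1"
      using dist_triangle_half_l[OF k0[OF that] k0[OF order_refl]] by simp
    then show ?thesis unfolding m using int_vec_close_eq[of "m k" "m k0"] by (simp add: dist_norm)
  qed
  have "\<Delta> \<longlonglongrightarrow> \<Delta> k0"
    by (rule Lim_transform_eventually[OF tendsto_const]) (rule eventually_sequentiallyI[of k0], rule const[symmetric])
  then have lim_eq: "C t - C0 \<theta>0 = \<Delta> k0" using \<Delta> LIMSEQ_unique by blast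
  then have projeq: "proj (C t) = proj (C0 \<theta>0)" unfolding m proj_eq_iff by blast
  have "\<forall>\<^sub>F k in sequentially. (C (s (r k)) - C t) /\<^sub>R (s (r k) - t) \<noteq> 0"
    using tendsto_imp_eventually_ne[OF quot p] .
  then obtain k1 where k1: "\<And>k. k \<ge> k1 \<Longrightarrow> (C (s (r k)) - C t) /\<^sub>R (s (r k) - t) \<noteq> 0" unfolding eventually_sequentially by blast
  define j where "j k = r (k + (k0 + k1))" for k
  have diff: "C (s (j k)) - C t = C0 (\<theta> (j k)) - C0 \<theta>0" for k
  proof -
    have "\<Delta> (k + (k0 + k1)) = C t - C0 \<theta>0" unfolding lim_eq by (rule const) simp
    then show ?thesis unfolding \<Delta>_def j_def by (simp add: algebra_simps)
  qed
  have ne: "\<theta> (j k) \<noteq> \<theta>0" for k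
  proof
    assume "\<theta> (j k) = \<theta>0"
    then have "C (s (j k)) - C t = 0" unfolding diff by simp
    then show False using k1[of "k + (k0 + k1)"] unfolding j_def by simp
  qed
  have P: "(\<lambda>k. (C (s (j k)) - C t) /\<^sub>R (s (j k) - t)) \<longlonglongrightarrow> p"
    unfolding j_def using LIMSEQ_ignore_initial_segment[OF quot] .
  have tj: "(\<lambda>k. \<theta> (j k)) \<longlonglongrightarrow> \<theta>0" unfolding j_def using LIMSEQ_ignore_initial_segment[OF tr] .
  have Q: "(\<lambda>k. (C0 (\<theta> (j k)) - C0 \<theta>0) /\<^sub>R (\<theta> (j k) - \<theta>0)) \<longlonglongrightarrow> C0' \<theta>0"
    using vector_derivative_sequence[OF dC0 tj] ne by simp
  have "p \<in> span {C0' \<theta>0}"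
  proof (rule span_limit_direction[OF P Q C0'])
    fix k show "(C (s (j k)) - C t) /\<^sub>R (s (j k) - t) = ((\<theta> (j k) - \<theta>0) / (s (j k) - t)) *\<^sub>R ((C0 (\<theta> (j k)) - C0 \<theta>0) /\<^sub>R (\<theta> (j k) - \<theta>0))"
      unfolding diff using ne[of k] by (simp add: divide_inverse)
  qed
  with projeq show ?thesis by blast
qed

text \<open>A curve that is contained in a leaf as a set of points could jump between different pieces of the leaf. But a set of
real numbers has only countably many isolated points, so at all but countably many times the curve returns to the same
compact piece of the leaf at times arbitrarily close by, and \<open>leaf_tangent_at_accumulation\<close> applies. The remaining
times follow by continuity of the bundle.\<close>

lemma curve_in_leaf_tangent:
  fixes C :: "real \<Rightarrow> real ^ 'n::finite"
  assumes E: "continuous_subbundle E" "\<forall>p. dim (E p) = 1"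
    and leaf: "leaf_parametrization L c0 c0'" and tangent: "\<And>t. span {c0' t} = E (c0 t)"
    and ab: "a < b" and C': "continuous_on {a..b} C'" and Ccont: "continuous_on {a..b} C"
    and C: "\<And>t. t \<in> {a..b} \<Longrightarrow> (C has_vector_derivative C' t) (at t within {a..b})"
      "\<And>t. t \<in> {a..b} \<Longrightarrow> norm (C' t) = 1" "\<And>t. t \<in> {a..b} \<Longrightarrow> proj (C t) \<in> L"
    and t: "t \<in> {a..b}"
  shows "C' t \<in> E (proj (C t))"
proof -
  have c0: "\<And>t. has_curve_derivative c0 (c0' t) t UNIV" "\<And>t. c0' t \<noteq> 0" "range c0 = L"
    using leaf unfolding leaf_parametrization_def C1_curve_on_def by auto
  have "continuous_on UNIV c0" using c0(1) by (rule curve_derivative_imp_continuous)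
  moreover have "contractible (UNIV :: real set)" by (simp add: convex_imp_contractible)
  ultimately obtain C0 where C0: "continuous_on UNIV C0" "\<And>x. proj (C0 x) = c0 x"
    using lift_exists by (metis UNIV_I)
  have dC0: "(C0 has_vector_derivative c0' \<theta>) (at \<theta>)" for \<theta>
    using has_vector_derivative_lift[OF C0(1) C0(2) UNIV_I c0(1)] by simp
  define S where "S n = {t \<in> {a..b}. \<exists>\<theta>\<in>{-real n..real n}. proj (C t) = c0 \<theta>}" for n :: nat
  define good where "good t \<longleftrightarrow> (\<exists>n. t \<in> S n \<and> t islimpt S n)" for t
  have cover: "\<exists>n. t \<in> S n" if tab: "t \<in> {a..b}" for t
  proof -
    obtain \<theta> where \<theta>: "proj (C t) = c0 \<theta>" using C(3)[OF tab] c0(3) by auto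
    obtain n :: nat where "\<bar>\<theta>\<bar> < real n" using reals_Archimedean2 by blast
    then have "\<theta> \<in> {-real n..real n}" by auto
    then show ?thesis unfolding S_def using \<theta> tab by blast
  qed
  have tangent_good: "C' t \<in> E (proj (C t))" if g: "good t" for t
  proof -
    obtain n where n: "t \<in> S n" "t islimpt S n" using g unfolding good_def by blast
    obtain s where s: "\<And>k. s k \<in> S n - {t}" "s \<longlonglongrightarrow> t" using n(2) unfolding islimpt_sequential by blast
    have "\<exists>\<theta>\<in>{-real n..real n}. proj (C (s k)) = proj (C0 \<theta>)" for k using s(1)[of k] unfolding S_def C0(2) by blast
    then obtain \<theta> where \<theta>: "\<And>k. \<theta> k \<in> {-real n..real n}" "\<And>k. proj (C (s k)) = proj (C0 (\<theta> k))" by metis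
    have tab: "t \<in> {a..b}" using n(1) unfolding S_def by simp
    have "C' t \<noteq> 0" using C(2)[OF tab] by auto
    have sab: "s k \<in> {a..b}" "s k \<noteq> t" for k using s(1)[of k] unfolding S_def by auto
    obtain \<theta>0 where "proj (C t) = proj (C0 \<theta>0)" "C' t \<in> span {c0' \<theta>0}"
      using leaf_tangent_at_accumulation[OF C(1)[OF tab] \<open>C' t \<noteq> 0\<close> dC0 c0(2) s(2) sab \<theta>] by blast
    then show ?thesis using tangent[of \<theta>0] C0(2) by simp
  qed
  \<comment> \<open>a countable set contains no open interval\<close>
  have dense: "\<exists>s. good s \<and> p < s \<and> s < q" if pq: "a \<le> p" "p < q" "q \<le> b" for p q
  proof (rule ccontr)
    assume no: "\<not> (\<exists>s. good s \<and> p < s \<and> s < q)"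
    have "{p<..<q} \<subseteq> (\<Union>n. {t \<in> S n. \<not> t islimpt S n})"
    proof
      fix s assume s: "s \<in> {p<..<q}"
      then have "s \<in> {a..b}" using pq by auto
      then obtain n where "s \<in> S n" using cover by blast
      moreover have "\<not> good s" using no s by auto
      ultimately show "s \<in> (\<Union>n. {t \<in> S n. \<not> t islimpt S n})" unfolding good_def by blast
    qed
    moreover have "countable (\<Union>n. {t \<in> S n. \<not> t islimpt S n})"
      by (intro countable_UN countable_isolated_points) simp
    ultimately have "countable {p<..<q}" by (rule countable_subset)
    then show False using uncountable_open_interval[of p q] pq by simp
  qed
  have "\<exists>s. good s \<and> s \<in> {a..b} \<and> \<bar>s - t\<bar> < inverse (real (Suc k))" for k
  proof -
    define r where "r = inverse (real (Suc k))"
    have r: "0 < r" unfolding r_def by simp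
    obtain s where "good s" "max a (t - r) < s" "s < min b (t + r)"
      using dense[of "max a (t - r)" "min b (t + r)"] t ab r by auto
    then show ?thesis unfolding r_def[symmetric] by (intro exI[of _ s]) auto
  qed
  then obtain s where s: "\<And>k. good (s k)" "\<And>k. s k \<in> {a..b}" "\<And>k. \<bar>s k - t\<bar> < inverse (real (Suc k))" by metis
  have slim: "s \<longlonglongrightarrow> t"
  proof (rule LIM_zero_cancel, rule Lim_null_comparison)
    show "\<forall>\<^sub>F k in sequentially. norm (s k - t) \<le> inverse (real (Suc k))" using s(3) by (simp add: less_imp_le)
  qed (rule LIMSEQ_inverse_real_of_nat)
  obtain V w where V: "open V" "proj (C t) \<in> V" "continuous_on V w" "\<And>q. q \<in> V \<Longrightarrow> w q \<noteq> 0" "\<And>q. q \<in> V \<Longrightarrow> E q = span {w q}"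
    using line_field_frame[OF E] by blast
  have evs: "\<forall>\<^sub>F k in sequentially. s k \<in> {a..b}" using s(2) by simp
  have C's: "(\<lambda>k. C' (s k)) \<longlonglongrightarrow> C' t" by (rule continuous_on_tendsto_compose[OF C' slim t evs])
  have Cs: "(\<lambda>k. C (s k)) \<longlonglongrightarrow> C t" by (rule continuous_on_tendsto_compose[OF Ccont slim t evs])
  have pCs: "(\<lambda>k. proj (C (s k))) \<longlonglongrightarrow> proj (C t)"
    by (rule continuous_on_tendsto_compose[OF continuous_proj[of UNIV] Cs]) auto
  have evV: "\<forall>\<^sub>F k in sequentially. proj (C (s k)) \<in> V" using topological_tendstoD[OF pCs V(1,2)] .
  have ws: "(\<lambda>k. w (proj (C (s k)))) \<longlonglongrightarrow> w (proj (C t))"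
    by (rule continuous_on_tendsto_compose[OF V(3) pCs V(2) evV])
  obtain k0 where k0: "\<And>k. k \<ge> k0 \<Longrightarrow> proj (C (s k)) \<in> V" using evV unfolding eventually_sequentially by blast
  have "\<exists>\<rho>. C' (s (k + k0)) = \<rho> *\<^sub>R w (proj (C (s (k + k0))))" for k
    using tangent_good[OF s(1)] V(5)[OF k0, of "k + k0"] unfolding span_singleton by auto
  then obtain \<rho> where \<rho>: "\<And>k. C' (s (k + k0)) = \<rho> k *\<^sub>R w (proj (C (s (k + k0))))" by metis
  have "C' t \<in> span {w (proj (C t))}"
    by (rule span_limit_direction[OF LIMSEQ_ignore_initial_segment[OF C's] LIMSEQ_ignore_initial_segment[OF ws] V(4)[OF V(2)] \<rho>])
  then show ?thesis using V(5)[OF V(2)] by simp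
qed

section \<open>Smoothness along the stable foliation\<close>

theorem corollary1p3:
  fixes f h :: "'n::finite torus \<Rightarrow> 'n torus"
    and E :: "'n torus \<Rightarrow> (real ^ 'n) set"
    and W :: "'n torus set set"
    and A :: "int ^ 'n ^ 'n"
    and \<alpha> :: real
  assumes "0 < \<alpha>" and "\<alpha> < 1"
    and "torus_C1_Hoelder \<alpha> f"
    and "anosov_map f"
    and "stable_bundle f E" and "\<forall>p. dim (E p) = 1"
    and "stable_foliation f E W"
    and "is_linearization f A"
    and "irreducible (rat_charpoly A)"
    and "\<not> bij f"
    and "\<exists>h'. homeomorphism UNIV UNIV h h'"
    and "h \<circ> f = toral_map A \<circ> h"
  shows "C1_Hoelder_along \<alpha> W h"
proof -
  obtain h' where h': "homeomorphism UNIV UNIV h h'" using assms(11) by blast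
  interpret conjugated_stable_line f h h' E A \<alpha> by (rule conjugated_stable_line.intro; fact assms h')
  obtain H Hi where H: "continuous_on UNIV H" "continuous_on UNIV Hi"
    "\<And>x. proj (H x) = h (proj x)" "\<And>x. proj (Hi x) = h' (proj x)" "\<And>x. Hi (H x) = x" "\<And>y. H (Hi y) = y"
  proof (rule conjugating_lifts)
    fix H Hi :: "real ^ 'n \<Rightarrow> real ^ 'n"
    assume H: "continuous_on UNIV H" "continuous_on UNIV Hi" "\<And>x. proj (H x) = h (proj x)"
      "\<And>x. proj (Hi x) = h' (proj x)" "\<And>x. Hi (H x) = x" "\<And>y. H (Hi y) = y"
    show thesis by (rule that[OF H])
  qed
  show ?thesis
    unfolding C1_Hoelder_along_def
  proof (intro ballI allI impI, elim conjE)
    fix L a b c c'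
    assume L: "L \<in> W" and ab: "a < b" and curve: "C1_curve_on {a..b} c c'" and sub: "c ` {a..b} \<subseteq> L"
      and unit: "\<forall>t\<in>{a..b}. norm (c' t) = 1"
    have dc: "\<And>t. t \<in> {a..b} \<Longrightarrow> has_curve_derivative c (c' t) t {a..b}" and c': "continuous_on {a..b} c'"
      using curve unfolding C1_curve_on_def by auto
    have "continuous_on {a..b} c" using dc by (rule curve_derivative_imp_continuous)
    then obtain C where C: "continuous_on {a..b} C" "\<And>t. t \<in> {a..b} \<Longrightarrow> proj (C t) = c t"
      using lift_exists[OF convex_imp_contractible[OF convex_real_interval(5)]] by metis
    have dC: "(C has_vector_derivative c' t) (at t within {a..b})" if "t \<in> {a..b}" for t
      by (rule has_vector_derivative_lift[OF C that dc[OF that]])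
    obtain c0 c0' where leaf: "leaf_parametrization L c0 c0'"
      using assms(7) L unfolding stable_foliation_def one_dim_foliation_def by blast
    have tangent: "span {c0' t} = E (c0 t)" for t
      using assms(7) L leaf unfolding stable_foliation_def tangent_to_def by blast
    have sub_bundle: "continuous_subbundle E" using assms(5) unfolding stable_bundle_def by blast
    have inL: "proj (C t) \<in> L" if "t \<in> {a..b}" for t using C(2)[OF that] sub that by auto
    have inE: "c' t \<in> E (proj (C t))" if "t \<in> {a..b}" for t
      by (rule curve_in_leaf_tangent[OF sub_bundle assms(6) leaf tangent ab c' C(1) dC _ inL that]) (use unit in auto)
    have "C1_Hoelder_on \<alpha> a b (\<lambda>t. H (C t))"
      by (rule lifted_arc_C1_Hoelder[OF H ab c' dC _ inE]) (use unit in auto)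
    then obtain g K where g: "\<And>t. t \<in> {a..b} \<Longrightarrow> ((\<lambda>t. H (C t)) has_vector_derivative g t) (at t within {a..b})"
      "\<And>s t. s \<in> {a..b} \<Longrightarrow> t \<in> {a..b} \<Longrightarrow> norm (g s - g t) \<le> K * \<bar>s - t\<bar> powr \<alpha>"
      unfolding C1_Hoelder_on_def by metis
    have "continuous_on {a..b} g"
      using g(2) by (intro Hoelder_imp_continuous_on[OF alpha(1), of _ _ K]) (auto simp: dist_real_def)
    moreover have "has_curve_derivative (h \<circ> c) (g t) t {a..b}" if t: "t \<in> {a..b}" for t
      unfolding has_curve_derivative_def
    proof (intro exI conjI)
      show "proj (H (C t)) = (h \<circ> c) t" by (simp add: H C(2)[OF t])
      show "\<forall>\<^sub>F s in at t within {a..b}. proj (H (C s)) = (h \<circ> c) s"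
        by (auto simp: eventually_at_filter H C(2))
      show "((\<lambda>t. H (C t)) has_vector_derivative g t) (at t within {a..b})" by (rule g(1)[OF t])
    qed
    ultimately have "C1_curve_on {a..b} (h \<circ> c) g" unfolding C1_curve_on_def by blast
    then show "\<exists>g'. C1_curve_on {a..b} (h \<circ> c) g' \<and>
        (\<exists>K. \<forall>s\<in>{a..b}. \<forall>t\<in>{a..b}. norm (g' s - g' t) \<le> K * \<bar>s - t\<bar> powr \<alpha>)"
      using g(2) by blast
  qed
qed

end
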